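(* Let $M$ be a closed $n$-dimensional manifold ($n>1$) with a smooth family of Riemannian metrics $g(t)$, $t\in[0,T]$, satisfying $\partial_t g_{ij}=-2h_{ij}$, where $h=h(t)$ is a smooth time-dependent symmetric $(0,2)$-tensor. Let $\lambda(t)$ be the first nonzero eigenvalue of the Laplacian $\Delta_{g(t)}$ and let $\varphi(t,x)$ be a corresponding eigenfunction, $-\Delta_{g(t)}\varphi(t,\cdot)=\lambda(t)\varphi(t,\cdot)$, where $\lambda$ depends smoothly on $t$ and $\varphi$ depends smoothly on $(t,x)$. Then $\lambda(t)$ evolves by $$\frac{d}{dt}\lambda(t)\int_M\varphi^2\,d\mu=\lambda(t)\int_M\mathcal{H}\varphi^2\,d\mu-\int_M\mathcal{H}|\nabla\varphi|^2\,d\mu+2\int_M\langle h,d\varphi\otimes d\varphi\rangle\,d\mu .$$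
   Context: Closed means compact without boundary. $\Delta_{g}=\operatorname{div}\operatorname{grad}$ is the Laplace–Beltrami operator, $\mathcal{H}=g^{ij}h_{ij}$ is the metric trace of $h$, and $d\mu=d\mu_{g(t)}$ is the Riemannian volume measure. Norms, gradients and the pairing $\langle h,d\varphi\otimes d\varphi\rangle=h^{ij}\nabla_i\varphi\nabla_j\varphi$ are taken with respect to $g(t)$. *)

theory Defs
  imports "HOL-Analysis.Analysis"
begin

subsection \<open>Smooth maps on subsets of Euclidean spaces\<close>

primrec Ck_on :: "nat \<Rightarrow> 'a::euclidean_space set \<Rightarrow> ('a \<Rightarrow> 'b::real_normed_vector) \<Rightarrow> bool" where
  "Ck_on 0 S f \<longleftrightarrow> continuous_on S f"
| "Ck_on (Suc k) S f \<longleftrightarrow>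
     (\<forall>x\<in>S. f differentiable (at x)) \<and>
     (\<forall>b\<in>Basis. Ck_on k S (\<lambda>x. frechet_derivative f (at x) b))"

text \<open>
  Smoothness on an arbitrary set is local extendability to a smooth map on an open set. On an
  open set this is ordinary smoothness; on \<open>{0..T} \<times> V\<close> with \<open>V\<close> open it is smoothness up to the
  endpoints of the time interval.
\<close>

definition smooth_on :: "'a::euclidean_space set \<Rightarrow> ('a \<Rightarrow> 'b::real_normed_vector) \<Rightarrow> bool" where
  "smooth_on S f \<longleftrightarrow>
     (\<forall>x\<in>S. \<exists>U F. open U \<and> x \<in> U \<and> (\<forall>k. Ck_on k U F) \<and> (\<forall>y\<in>U \<inter> S. F y = f y))"

subsection \<open>Closed manifolds\<close>

type_synonym ('m, 'n) chart = "'m set \<times> ('m \<Rightarrow> real ^ 'n)"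

abbreviation cdom :: "('m, 'n) chart \<Rightarrow> 'm set" where
  "cdom c \<equiv> fst c"

abbreviation cmap :: "('m, 'n) chart \<Rightarrow> 'm \<Rightarrow> real ^ 'n" where
  "cmap c \<equiv> snd c"

definition cimg :: "('m, 'n) chart \<Rightarrow> (real ^ 'n) set" where
  "cimg c = cmap c ` cdom c"

definition cinv :: "('m, 'n) chart \<Rightarrow> real ^ 'n \<Rightarrow> 'm" where
  "cinv c = inv_into (cdom c) (cmap c)"

definition chart_on :: "'m::t2_space set \<Rightarrow> ('m, 'n::finite) chart \<Rightarrow> bool" where
  "chart_on M c \<longleftrightarrow>
     openin (top_of_set M) (cdom c) \<and> open (cimg c) \<and>
     homeomorphism (cdom c) (cimg c) (cmap c) (cinv c)"

definition smooth_atlas :: "'m::t2_space set \<Rightarrow> ('m, 'n::finite) chart set \<Rightarrow> bool" where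
  "smooth_atlas M A \<longleftrightarrow>
     (\<forall>c\<in>A. chart_on M c) \<and> (\<Union>c\<in>A. cdom c) = M \<and>
     (\<forall>c\<in>A. \<forall>d\<in>A. smooth_on (cmap c ` (cdom c \<inter> cdom d)) (cmap d \<circ> cinv c))"

text \<open>
  Charts take values in open subsets of \<open>real ^ 'n\<close>, so there is no boundary. Second countability
  follows from compactness.
\<close>

definition closed_manifold :: "'m::t2_space set \<Rightarrow> ('m, 'n::finite) chart set \<Rightarrow> bool" where
  "closed_manifold M A \<longleftrightarrow> compact M \<and> smooth_atlas M A"

definition smooth_fun :: "('m, 'n::finite) chart set \<Rightarrow> ('m \<Rightarrow> real) \<Rightarrow> bool" where
  "smooth_fun A u \<longleftrightarrow> (\<forall>c\<in>A. smooth_on (cimg c) (u \<circ> cinv c))"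

definition smooth_fun_family ::
    "('m, 'n::finite) chart set \<Rightarrow> real set \<Rightarrow> (real \<Rightarrow> 'm \<Rightarrow> real) \<Rightarrow> bool" where
  "smooth_fun_family A I u \<longleftrightarrow>
     (\<forall>c\<in>A. smooth_on (I \<times> cimg c) (\<lambda>(t, x). u t (cinv c x)))"

definition partial :: "('m, 'n::finite) chart \<Rightarrow> 'n \<Rightarrow> ('m \<Rightarrow> real) \<Rightarrow> 'm \<Rightarrow> real" where
  "partial c i u p = frechet_derivative (u \<circ> cinv c) (at (cmap c p)) (axis i 1)"

subsection \<open>Tensor fields\<close>

text \<open>
  Tensor fields are given classically, by their components in every chart of the atlas, subject to
  the transformation law. Scalars built from components are evaluated at \<open>p\<close> in the chart
  \<open>chart_at A p\<close>; by the transformation law the choice of chart is immaterial.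
\<close>

type_synonym ('m, 'n) tensor02 = "('m, 'n) chart \<Rightarrow> 'm \<Rightarrow> real ^ 'n ^ 'n"

type_synonym ('m, 'n) vfield = "('m, 'n) chart \<Rightarrow> 'm \<Rightarrow> real ^ 'n"

definition chart_at :: "('m, 'n) chart set \<Rightarrow> 'm \<Rightarrow> ('m, 'n) chart" where
  "chart_at A p = (SOME c. c \<in> A \<and> p \<in> cdom c)"

definition transition_jacobian ::
    "('m, 'n::finite) chart \<Rightarrow> ('m, 'n) chart \<Rightarrow> 'm \<Rightarrow> real ^ 'n ^ 'n" where
  "transition_jacobian c d p = matrix (frechet_derivative (cmap c \<circ> cinv d) (at (cmap d p)))"

definition symmetric_tensor02 ::
    "('m, 'n::finite) chart set \<Rightarrow> ('m, 'n) tensor02 \<Rightarrow> bool" where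
  "symmetric_tensor02 A h \<longleftrightarrow>
     (\<forall>c\<in>A. \<forall>p\<in>cdom c. transpose (h c p) = h c p) \<and>
     (\<forall>c\<in>A. \<forall>d\<in>A. \<forall>p\<in>cdom c \<inter> cdom d.
        h d p = transpose (transition_jacobian c d p) ** h c p ** transition_jacobian c d p)"

definition smooth_tensor02 :: "('m, 'n::finite) chart set \<Rightarrow> ('m, 'n) tensor02 \<Rightarrow> bool" where
  "smooth_tensor02 A h \<longleftrightarrow> (\<forall>c\<in>A. smooth_on (cimg c) (\<lambda>x. h c (cinv c x)))"

definition smooth_tensor02_family ::
    "('m, 'n::finite) chart set \<Rightarrow> real set \<Rightarrow> (real \<Rightarrow> ('m, 'n) tensor02) \<Rightarrow> bool" where
  "smooth_tensor02_family A I h \<longleftrightarrow>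
     (\<forall>c\<in>A. smooth_on (I \<times> cimg c) (\<lambda>(t, x). h t c (cinv c x)))"

subsection \<open>Riemannian metrics\<close>

definition riemannian_metric ::
    "('m, 'n::finite) chart set \<Rightarrow> ('m, 'n) tensor02 \<Rightarrow> bool" where
  "riemannian_metric A g \<longleftrightarrow>
     symmetric_tensor02 A g \<and> smooth_tensor02 A g \<and>
     (\<forall>c\<in>A. \<forall>p\<in>cdom c. \<forall>v. v \<noteq> 0 \<longrightarrow> 0 < v \<bullet> (g c p *v v))"

definition vol_density :: "('m, 'n::finite) tensor02 \<Rightarrow> ('m, 'n) chart \<Rightarrow> 'm \<Rightarrow> real" where
  "vol_density g c p = sqrt (det (g c p))"

text \<open>
  The Riemannian volume measure is the unique Borel measure on \<open>M\<close> which in every chart has density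
  \<open>sqrt (det g\<^sub>i\<^sub>j)\<close> with respect to Lebesgue measure.
\<close>

definition riemannian_volume ::
    "'m::t2_space set \<Rightarrow> ('m, 'n::finite) chart set \<Rightarrow> ('m, 'n) tensor02 \<Rightarrow> 'm measure" where
  "riemannian_volume M A g =
     (THE \<mu>. sets \<mu> = sets (restrict_space borel M) \<and>
        (\<forall>c\<in>A. \<forall>E\<in>sets \<mu>. E \<subseteq> cdom c \<longrightarrow>
           emeasure \<mu> E = (\<integral>\<^sup>+ x \<in> cmap c ` E. ennreal (vol_density g c (cinv c x)) \<partial>lborel)))"

definition grad :: "('m, 'n::finite) tensor02 \<Rightarrow> ('m \<Rightarrow> real) \<Rightarrow> ('m, 'n) vfield" where
  "grad g u c p = matrix_inv (g c p) *v (\<chi> i. partial c i u p)"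

definition divergence ::
    "('m, 'n::finite) chart set \<Rightarrow> ('m, 'n) tensor02 \<Rightarrow> ('m, 'n) vfield \<Rightarrow> 'm \<Rightarrow> real" where
  "divergence A g X p =
     (let c = chart_at A p in
        (\<Sum>i\<in>UNIV. partial c i (\<lambda>q. vol_density g c q * X c q $ i) p) / vol_density g c p)"

definition laplacian ::
    "('m, 'n::finite) chart set \<Rightarrow> ('m, 'n) tensor02 \<Rightarrow> ('m \<Rightarrow> real) \<Rightarrow> 'm \<Rightarrow> real" where
  "laplacian A g u = divergence A g (grad g u)"

definition grad_norm ::
    "('m, 'n::finite) chart set \<Rightarrow> ('m, 'n) tensor02 \<Rightarrow> ('m \<Rightarrow> real) \<Rightarrow> 'm \<Rightarrow> real" where
  "grad_norm A g u p =
     (let c = chart_at A p in sqrt (grad g u c p \<bullet> (g c p *v grad g u c p)))"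

definition metric_trace ::
    "('m, 'n::finite) chart set \<Rightarrow> ('m, 'n) tensor02 \<Rightarrow> ('m, 'n) tensor02 \<Rightarrow> 'm \<Rightarrow> real" where
  "metric_trace A g h p =
     (let c = chart_at A p in
        \<Sum>i\<in>UNIV. \<Sum>j\<in>UNIV. matrix_inv (g c p) $ i $ j * h c p $ i $ j)"

definition raise_indices ::
    "('m, 'n::finite) tensor02 \<Rightarrow> ('m, 'n) tensor02 \<Rightarrow> ('m, 'n) chart \<Rightarrow> 'm \<Rightarrow> real ^ 'n ^ 'n" where
  "raise_indices g h c p =
     (\<chi> i j. \<Sum>k\<in>UNIV. \<Sum>l\<in>UNIV.
        matrix_inv (g c p) $ i $ k * matrix_inv (g c p) $ j $ l * h c p $ k $ l)"

definition tensor_pairing ::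
    "('m, 'n::finite) chart set \<Rightarrow> ('m, 'n) tensor02 \<Rightarrow> ('m, 'n) tensor02 \<Rightarrow> ('m \<Rightarrow> real) \<Rightarrow>
     'm \<Rightarrow> real" where
  "tensor_pairing A g h u p =
     (let c = chart_at A p in
        \<Sum>i\<in>UNIV. \<Sum>j\<in>UNIV. raise_indices g h c p $ i $ j * partial c i u p * partial c j u p)"

subsection \<open>Eigenvalues of the Laplacian\<close>

definition laplace_eigenfunction ::
    "'m set \<Rightarrow> ('m, 'n::finite) chart set \<Rightarrow> ('m, 'n) tensor02 \<Rightarrow> real \<Rightarrow> ('m \<Rightarrow> real) \<Rightarrow> bool" where
  "laplace_eigenfunction M A g \<nu> u \<longleftrightarrow>
     smooth_fun A u \<and> (\<exists>p\<in>M. u p \<noteq> 0) \<and> (\<forall>p\<in>M. - laplacian A g u p = \<nu> * u p)"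

definition laplace_eigenvalue ::
    "'m set \<Rightarrow> ('m, 'n::finite) chart set \<Rightarrow> ('m, 'n) tensor02 \<Rightarrow> real \<Rightarrow> bool" where
  "laplace_eigenvalue M A g \<nu> \<longleftrightarrow> (\<exists>u. laplace_eigenfunction M A g \<nu> u)"

definition first_nonzero_eigenvalue ::
    "'m set \<Rightarrow> ('m, 'n::finite) chart set \<Rightarrow> ('m, 'n) tensor02 \<Rightarrow> real \<Rightarrow> bool" where
  "first_nonzero_eigenvalue M A g \<nu> \<longleftrightarrow>
     laplace_eigenvalue M A g \<nu> \<and> \<nu> \<noteq> 0 \<and>
     (\<forall>\<nu>'. laplace_eigenvalue M A g \<nu>' \<and> \<nu>' \<noteq> 0 \<longrightarrow> \<nu> \<le> \<nu>')"

end

theory Submission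
  imports Defs
begin

text \<open>
  For fixed \<open>t\<close> put \<open>P s r = (g s)(\<nabla>\<phi> r, \<nabla>\<phi> t) - lam s * \<phi> r * \<phi> t\<close>, with gradients with respect to
  \<open>g s\<close>, multiplied by the density of the volume of \<open>g s\<close> with respect to that of \<open>g t\<close>. Since
  \<open>M\<close> is closed, Green's formula shows that the integral of \<open>P s r\<close> vanishes both for \<open>r = s\<close>,
  as \<open>\<phi> s\<close> is an eigenfunction of \<open>g s\<close>, and for \<open>s = t\<close>, as \<open>\<phi> t\<close> is an eigenfunction of \<open>g t\<close>.
  Differentiating the integral of \<open>P s s - P t s\<close> at \<open>s = t\<close> therefore yields \<open>\<integral> \<partial>\<^sub>s P t t = 0\<close>,
  and no time derivative of \<open>\<phi>\<close> is involved. By \<open>\<partial>\<^sub>t sqrt (det g) = - H * sqrt (det g)\<close> and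
  \<open>\<partial>\<^sub>t g\<^sup>i\<^sup>j = 2 * h\<^sup>i\<^sup>j\<close> this is the evolution equation.
\<close>

subsection \<open>Calculus of determinants and inverse matrices\<close>

lemma
  fixes A :: "'a::semiring_1^'n^'m"
  assumes "invertible A"
  shows matrix_inv_right: "A ** matrix_inv A = mat 1"
    and matrix_inv_left: "matrix_inv A ** A = mat 1"
  using someI_ex[OF assms[unfolded invertible_def]] by (auto simp: matrix_inv_def)

lemma matrix_inv_unique:
  fixes A :: "'a::semiring_1^'n^'n"
  assumes "A ** B = mat 1" "B ** A = mat 1"
  shows "matrix_inv A = B"
proof -
  have "invertible A"
    using assms by (auto simp: invertible_def)
  then have "matrix_inv A ** (A ** B) = B"
    by (simp add: matrix_mul_assoc matrix_inv_left)
  then show ?thesis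
    by (simp add: assms)
qed

lemma matrix_inv_transpose:
  fixes A :: "'a::comm_semiring_1^'n^'n"
  assumes "invertible A"
  shows "matrix_inv (transpose A) = transpose (matrix_inv A)"
  by (rule matrix_inv_unique)
     (simp_all add: assms matrix_inv_left matrix_inv_right flip: matrix_transpose_mul)

lemma matrix_inv_mult:
  fixes A B :: "'a::semiring_1^'n^'n"
  assumes "invertible A" "invertible B"
  shows "matrix_inv (A ** B) = matrix_inv B ** matrix_inv A"
proof (rule matrix_inv_unique)
  have "A ** B ** (matrix_inv B ** matrix_inv A) = A ** (B ** matrix_inv B) ** matrix_inv A"
    by (simp add: matrix_mul_assoc)
  then show "A ** B ** (matrix_inv B ** matrix_inv A) = mat 1"
    using assms by (simp add: matrix_inv_right)
  have "matrix_inv B ** matrix_inv A ** (A ** B) = matrix_inv B ** (matrix_inv A ** A) ** B"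
    by (simp add: matrix_mul_assoc)
  then show "matrix_inv B ** matrix_inv A ** (A ** B) = mat 1"
    using assms by (simp add: matrix_inv_left)
qed

lemma matrix_inv_congruence:
  fixes G J :: "real^'n^'n"
  assumes "invertible G" "invertible J"
  shows "matrix_inv (transpose J ** G ** J) =
    matrix_inv J ** matrix_inv G ** transpose (matrix_inv J)"
  using assms transpose_invertible[OF assms(2)]
  by (simp add: matrix_inv_mult invertible_mult matrix_inv_transpose matrix_mul_assoc)

lemma inner_transpose_mult: "x \<bullet> (transpose A *v y) = (A *v x) \<bullet> y" for A :: "real^'n^'m"
  by (metis dot_lmul_matrix inner_commute transpose_matrix_vector)

lemma bounded_bilinear_matrix_matrix_mult:
  "bounded_bilinear ((**) :: real^'n^'m \<Rightarrow> real^'k^'n \<Rightarrow> real^'k^'m)"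
  unfolding bilinear_conv_bounded_bilinear[symmetric] bilinear_def
  by (auto intro!: linearI simp: vec_eq_iff matrix_matrix_mult_def algebra_simps
      sum.distrib sum_distrib_left)

lemma bounded_bilinear_matrix_vector_mult:
  "bounded_bilinear ((*v) :: real^'n^'m \<Rightarrow> real^'n \<Rightarrow> real^'m)"
  unfolding bilinear_conv_bounded_bilinear[symmetric] bilinear_def
  by (auto intro!: linearI simp: vec_eq_iff matrix_vector_mult_def algebra_simps
      sum.distrib sum_distrib_left)

lemma bounded_linear_trace: "bounded_linear (trace :: real^'n^'n \<Rightarrow> real)"
  unfolding linear_conv_bounded_linear[symmetric]
  by (auto intro!: linearI simp: trace_def sum.distrib sum_distrib_left)

lemmas continuous_on_matrix_matrix_mult [continuous_intros] =
  bounded_bilinear.continuous_on[OF bounded_bilinear_matrix_matrix_mult]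

lemmas continuous_on_matrix_vector_mult [continuous_intros] =
  bounded_bilinear.continuous_on[OF bounded_bilinear_matrix_vector_mult]

lemmas continuous_on_trace [continuous_intros] =
  bounded_linear.continuous_on[OF bounded_linear_trace]

lemma tendsto_det:
  fixes L :: "real^'n^'n"
  assumes "(f \<longlongrightarrow> L) F"
  shows "((\<lambda>x. det (f x)) \<longlongrightarrow> det L) F"
  unfolding det_def by (intro tendsto_intros assms)

lemma matrix_inv_component:
  fixes A :: "real^'n^'n"
  assumes "invertible A"
  shows "matrix_inv A $ i $ j = det (\<chi> k l. if l = i then mat 1 $ k $ j else A $ k $ l) / det A"
proof -
  have "A *v column j (matrix_inv A) = column j (mat 1)"
    using arg_cong[OF matrix_inv_right[OF assms], of "column j"]
    by (simp add: vec_eq_iff matrix_vector_mult_def matrix_matrix_mult_def column_def)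
  then have "column j (matrix_inv A) =
      (\<chi> i. det (\<chi> k l. if l = i then column j (mat 1) $ k else A $ k $ l) / det A)"
    using assms by (simp add: cramer invertible_det_nz)
  then show ?thesis
    by (simp add: vec_eq_iff column_def cong: if_cong)
qed

lemma tendsto_matrix_inv:
  fixes L :: "real^'n^'n"
  assumes f: "(f \<longlongrightarrow> L) F" and "invertible L"
  shows "((\<lambda>x. matrix_inv (f x)) \<longlongrightarrow> matrix_inv L) F"
proof (intro vec_tendstoI)
  fix i j
  have "((\<lambda>x. det (\<chi> k l. if l = i then mat 1 $ k $ j else f x $ k $ l) / det (f x))
      \<longlongrightarrow> matrix_inv L $ i $ j) F"
    unfolding matrix_inv_component[OF assms(2)]
    using f assms(2) by (intro tendsto_divide tendsto_det vec_tendstoI)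
      (auto simp: invertible_det_nz intro: tendsto_vec_nth)
  moreover have "\<forall>\<^sub>F x in F. det (f x) \<noteq> 0"
    using assms(2) tendsto_imp_eventually_ne[OF tendsto_det[OF f]] by (simp add: invertible_det_nz)
  then have "\<forall>\<^sub>F x in F. det (\<chi> k l. if l = i then mat 1 $ k $ j else f x $ k $ l) / det (f x) =
      matrix_inv (f x) $ i $ j"
    by eventually_elim (simp add: matrix_inv_component invertible_det_nz)
  ultimately show "((\<lambda>x. matrix_inv (f x) $ i $ j) \<longlongrightarrow> matrix_inv L $ i $ j) F"
    by (rule Lim_transform_eventually)
qed

lemma continuous_on_det [continuous_intros]:
  fixes f :: "'a::topological_space \<Rightarrow> real^'n^'n"
  shows "continuous_on S f \<Longrightarrow> continuous_on S (\<lambda>x. det (f x))"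
  by (simp add: continuous_on_def tendsto_det)

lemma continuous_on_matrix_inv:
  fixes f :: "'a::topological_space \<Rightarrow> real^'n^'n"
  shows "continuous_on S f \<Longrightarrow> (\<And>x. x \<in> S \<Longrightarrow> invertible (f x)) \<Longrightarrow>
    continuous_on S (\<lambda>x. matrix_inv (f x))"
  by (simp add: continuous_on_def tendsto_matrix_inv)

lemma positive_definite_imp_invertible:
  fixes A :: "real^'n^'n"
  assumes "\<And>v. v \<noteq> 0 \<Longrightarrow> 0 < v \<bullet> (A *v v)"
  shows "invertible A"
  unfolding invertible_left_inverse matrix_left_invertible_ker
  using assms by (metis inner_zero_right less_irrefl)

text \<open>The determinant cannot change sign on the segment of positive definite matrices from the
  identity to \<open>A\<close>.\<close>

lemma positive_definite_imp_det_pos: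
  fixes A :: "real^'n^'n"
  assumes pos: "\<And>v. v \<noteq> 0 \<Longrightarrow> 0 < v \<bullet> (A *v v)"
  shows "0 < det A"
proof (rule ccontr)
  define B where "B s = (1 - s) *\<^sub>R mat 1 + s *\<^sub>R A" for s :: real
  assume "\<not> 0 < det A"
  moreover have "continuous_on {0..1} (\<lambda>s. det (B s))"
    unfolding B_def by (intro continuous_intros)
  ultimately obtain s where s: "0 \<le> s" "s \<le> 1" "det (B s) = 0"
    using IVT2'[of "\<lambda>s. det (B s)" 1 0 0] by (auto simp: B_def)
  have "0 < v \<bullet> (B s *v v)" if "v \<noteq> 0" for v
  proof -
    have "v \<bullet> (B s *v v) = (1 - s) * (v \<bullet> v) + s * (v \<bullet> (A *v v))"
      by (simp add: B_def matrix_vector_mult_add_rdistrib inner_add_right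
          flip: scaleR_matrix_vector_assoc)
    also have "\<dots> > 0"
      using s that pos[OF that]
      by (cases "s = 0") (auto intro!: add_nonneg_pos simp: inner_gt_zero_iff)
    finally show ?thesis .
  qed
  from positive_definite_imp_invertible[OF this] s(3) show False
    by (simp add: invertible_det_nz)
qed

lemma (in bounded_bilinear) has_derivative_both_zero:
  assumes f: "(f has_derivative f') (at x within S)" and "f x = 0"
    and k: "(k \<longlongrightarrow> 0) (at x within S)"
  shows "((\<lambda>y. prod (k y) (f y)) has_derivative (\<lambda>h. 0)) (at x within S)"
  unfolding has_derivative_iff_norm
proof (intro conjI bounded_linear_zero)
  let ?r = "\<lambda>y. norm (f y - f' (y - x)) / norm (y - x)"
  obtain K where K: "\<And>a b. norm (prod a b) \<le> norm a * norm b * K" "0 \<le> K"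
    using nonneg_bounded by blast
  obtain C where C: "\<And>h. norm (f' h) \<le> norm h * C"
    using has_derivative_bounded_linear[OF f] bounded_linear.bounded by blast
  have "norm (prod (k y) (f y)) / norm (y - x) \<le> norm (k y) * (?r y + C) * K" if "y \<noteq> x" for y
  proof -
    have "norm (f y) \<le> norm (f y - f' (y - x)) + norm (y - x) * C"
      using norm_triangle_sub[of "f y" "f' (y - x)"] C[of "y - x"] by linarith
    then have "norm (f y) / norm (y - x) \<le> ?r y + C"
      using that by (simp add: field_simps)
    then have "norm (k y) * (norm (f y) / norm (y - x)) * K \<le> norm (k y) * (?r y + C) * K"
      using K(2) by (intro mult_right_mono mult_left_mono) auto
    moreover have "norm (prod (k y) (f y)) / norm (y - x) \<le>
        norm (k y) * norm (f y) * K / norm (y - x)"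
      using K(1) by (intro divide_right_mono) auto
    ultimately show ?thesis by simp
  qed
  then have bound: "\<forall>\<^sub>F y in at x within S.
      norm (norm (prod (k y) (f y)) / norm (y - x)) \<le> norm (k y) * (?r y + C) * K"
    by (simp add: eventually_at_filter)
  have "(?r \<longlongrightarrow> 0) (at x within S)"
    using f \<open>f x = 0\<close> by (simp add: has_derivative_iff_norm)
  then have "((\<lambda>y. norm (k y) * (?r y + C) * K) \<longlongrightarrow> 0 * (0 + C) * K) (at x within S)"
    by (intro tendsto_mult tendsto_add tendsto_const tendsto_norm_zero k)
  then have "((\<lambda>y. norm (prod (k y) (f y)) / norm (y - x)) \<longlongrightarrow> 0) (at x within S)"
    using Lim_null_comparison[OF bound] by simp
  then show "((\<lambda>y. norm (prod (k y) (f y) - prod (k x) (f x) - 0) / norm (y - x)) \<longlongrightarrow> 0)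
      (at x within S)"
    by (simp add: \<open>f x = 0\<close> zero_right)
qed

lemma (in bounded_bilinear) has_derivative_right_zero:
  assumes f: "(f has_derivative f') (at x within S)" "f x = 0"
    and g: "continuous (at x within S) g"
  shows "((\<lambda>y. prod (g y) (f y)) has_derivative (\<lambda>h. prod (g x) (f' h))) (at x within S)"
proof -
  have "((\<lambda>y. g y - g x) \<longlongrightarrow> 0) (at x within S)"
    using g by (simp add: continuous_within LIM_zero)
  from has_derivative_add[OF has_derivative_both_zero[OF f this]
      bounded_linear.has_derivative[OF bounded_linear_right[of "g x"] f(1)]]
  show ?thesis
    by (simp add: diff_left)
qed

lemma has_derivative_matrix_inv:
  fixes f :: "'a::real_normed_vector \<Rightarrow> real^'n^'n"
  assumes f: "(f has_derivative f') (at x within S)" and "invertible (f x)" "x \<in> S"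
  shows "((\<lambda>y. matrix_inv (f y)) has_derivative
    (\<lambda>h. - (matrix_inv (f x) ** f' h ** matrix_inv (f x)))) (at x within S)"
proof (rule has_derivative_transform_eventually)
  let ?B = "matrix_inv (f x)"
  interpret mult: bounded_bilinear "(**) :: real^'n^'n \<Rightarrow> real^'n^'n \<Rightarrow> real^'n^'n"
    by (rule bounded_bilinear_matrix_matrix_mult)
  have cont: "(f \<longlongrightarrow> f x) (at x within S)"
    using has_derivative_continuous[OF f] by (simp add: continuous_within)
  have "((\<lambda>y. (f y - f x) ** ?B) has_derivative (\<lambda>h. f' h ** ?B)) (at x within S)"
    using has_derivative_diff[OF f has_derivative_const]
    by (intro bounded_linear.has_derivative[OF mult.bounded_linear_left]) simp
  then have "((\<lambda>y. matrix_inv (f y) ** ((f y - f x) ** ?B)) has_derivative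
      (\<lambda>h. ?B ** (f' h ** ?B))) (at x within S)"
    using tendsto_matrix_inv[OF cont assms(2)]
    by (intro mult.has_derivative_right_zero) (auto simp: continuous_within mult.zero_left)
  from has_derivative_diff[OF has_derivative_const[of ?B] this]
  show "((\<lambda>y. ?B - matrix_inv (f y) ** ((f y - f x) ** ?B)) has_derivative
      (\<lambda>h. - (?B ** f' h ** ?B))) (at x within S)"
    by (simp add: matrix_mul_assoc)
  have "?B - matrix_inv (f y) ** ((f y - f x) ** ?B) = matrix_inv (f y)" if "invertible (f y)" for y
  proof -
    have "matrix_inv (f y) ** ((f y - f x) ** ?B) =
        matrix_inv (f y) ** f y ** ?B - matrix_inv (f y) ** (f x ** ?B)"
      by (simp add: mult.diff_left mult.diff_right matrix_mul_assoc)
    then show ?thesis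
      using that assms(2) by (simp add: matrix_inv_left matrix_inv_right)
  qed
  moreover have "\<forall>\<^sub>F y in at x within S. invertible (f y)"
    using assms(2) tendsto_imp_eventually_ne[OF tendsto_det[OF cont]]
    by (simp add: invertible_det_nz)
  ultimately show "\<forall>\<^sub>F y in at x within S.
      ?B - matrix_inv (f y) ** ((f y - f x) ** ?B) = matrix_inv (f y)"
    by (auto elim: eventually_mono)
  show "?B - matrix_inv (f x) ** ((f x - f x) ** ?B) = matrix_inv (f x)"
    by (simp add: mult.zero_left mult.zero_right)
qed (rule assms(3))

lemma has_vector_derivative_matrixI:
  fixes A :: "real \<Rightarrow> real^'n^'m"
  assumes "\<And>i j. ((\<lambda>s. A s $ i $ j) has_real_derivative A' $ i $ j) (at t within S)"
  shows "(A has_vector_derivative A') (at t within S)"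
  unfolding has_vector_derivative_def
  by (subst has_derivative_componentwise_within)
     (use assms in \<open>auto simp: Basis_vec_def inner_axis has_field_derivative_def mult_commute_abs\<close>)

lemma permutes_not_id_moves_two:
  assumes "p permutes S" "p \<noteq> id"
  shows "\<exists>j. j \<noteq> i \<and> p j \<noteq> j"
proof (rule ccontr)
  assume "\<not> ?thesis"
  then have "p permutes {i}"
    using permutes_superset[OF assms(1), of "{i}"] by auto
  then show False
    using assms(2) by simp
qed

text \<open>Only the identity permutation contributes to the derivative of the Leibniz formula at the
  identity matrix.\<close>

lemma has_derivative_det_at_identity:
  fixes f :: "'a::real_normed_vector \<Rightarrow> real^'n^'n"
  assumes f: "(f has_derivative f') (at x within S)" and fx: "f x = mat 1"
  shows "((\<lambda>y. det (f y)) has_derivative (\<lambda>h. trace (f' h))) (at x within S)"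
proof -
  let ?D = "\<lambda>p h. \<Sum>i\<in>UNIV. f' h $ i $ p i * (\<Prod>j\<in>UNIV - {i}. f x $ j $ p j)"
  have entry: "((\<lambda>y. f y $ i $ j) has_derivative (\<lambda>h. f' h $ i $ j)) (at x within S)" for i j
    using f by (intro bounded_linear.has_derivative[OF bounded_linear_vec_nth])
  have D: "?D p h = (if p = id then trace (f' h) else 0)" if perm: "p permutes UNIV" for p h
  proof (cases "p = id")
    case False
    have "(\<Prod>j\<in>UNIV - {i}. f x $ j $ p j) = 0" for i
    proof -
      obtain j where "j \<noteq> i" "p j \<noteq> j"
        using permutes_not_id_moves_two[OF perm False] by blast
      then show ?thesis
        by (intro prod_zero) (auto simp: fx mat_def intro!: bexI[of _ j])
    qed
    then show ?thesis
      using False by (simp only: if_False mult_zero_right sum.neutral_const)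
  qed (simp add: fx mat_def trace_def)
  have "((\<lambda>y. det (f y)) has_derivative
      (\<lambda>h. \<Sum>p | p permutes UNIV. of_int (sign p) * ?D p h)) (at x within S)"
    unfolding det_def
    by (intro has_derivative_sum has_derivative_mult_right has_derivative_prod entry)
  also have "(\<lambda>h. \<Sum>p | p permutes UNIV. of_int (sign p) * ?D p h) =
      (\<lambda>h. \<Sum>p | p permutes (UNIV :: 'n set). if p = id then trace (f' h) else 0)"
    by (intro ext sum.cong refl) (simp add: D)
  also have "\<dots> = (\<lambda>h. trace (f' h))"
    by (simp add: sum.delta permutes_id finite_permutations)
  finally show ?thesis .
qed

lemma has_derivative_det:
  fixes f :: "'a::real_normed_vector \<Rightarrow> real^'n^'n"
  assumes f: "(f has_derivative f') (at x within S)" and "invertible (f x)"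
  shows "((\<lambda>y. det (f y)) has_derivative (\<lambda>h. det (f x) * trace (matrix_inv (f x) ** f' h)))
    (at x within S)"
proof -
  let ?B = "matrix_inv (f x)"
  have "((\<lambda>y. ?B ** f y) has_derivative (\<lambda>h. ?B ** f' h)) (at x within S)"
    by (intro bounded_linear.has_derivative[OF _ f]
        bounded_bilinear.bounded_linear_right[OF bounded_bilinear_matrix_matrix_mult])
  then have "((\<lambda>y. det (f x) * det (?B ** f y)) has_derivative
      (\<lambda>h. det (f x) * trace (?B ** f' h))) (at x within S)"
    using assms(2)
    by (intro has_derivative_mult_right has_derivative_det_at_identity)
       (simp_all add: matrix_inv_left)
  moreover have "det (f x) * det (?B ** C) = det C" for C
    using arg_cong[OF matrix_inv_right[OF assms(2)], of det] by (simp add: det_mul)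
  ultimately show ?thesis by simp
qed

subsection \<open>Change of variables\<close>

text \<open>
  The change of variables theorem of the library is restricted to wellordered index types. Every
  finite type has a wellordered copy, to which the coordinates are transported.
\<close>

typedef 'a wellordered = "UNIV :: 'a set"
  morphisms of_wellordered to_wellordered ..

lemma bij_of_wellordered: "bij of_wellordered"
  by (rule bijI')
     (auto simp: of_wellordered_inject intro: to_wellordered_inverse[OF UNIV_I, symmetric])

instance wellordered :: (finite) finite
proof
  show "finite (UNIV :: 'a wellordered set)"
    using bij_betw_finite[OF bij_of_wellordered[where 'a = 'a]] by simp
qed

instantiation wellordered :: (finite) wellorder
begin

definition less_eq_wellordered :: "'a wellordered \<Rightarrow> 'a wellordered \<Rightarrow> bool" where
  "i \<le> j \<longleftrightarrow> to_nat_on UNIV (of_wellordered i) \<le> to_nat_on UNIV (of_wellordered j)"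

definition less_wellordered :: "'a wellordered \<Rightarrow> 'a wellordered \<Rightarrow> bool" where
  "i < j \<longleftrightarrow> to_nat_on UNIV (of_wellordered i) < to_nat_on UNIV (of_wellordered j)"

instance
proof
  fix P :: "'a wellordered \<Rightarrow> bool" and i
  assume step: "\<And>j. (\<And>k. k < j \<Longrightarrow> P k) \<Longrightarrow> P j"
  show "P i"
    by (induction i rule: measure_induct_rule[where f = "\<lambda>i. to_nat_on UNIV (of_wellordered i)"])
       (rule step, simp add: less_wellordered_def)
qed (auto simp: less_eq_wellordered_def less_wellordered_def
       of_wellordered_inject countable_finite)

end

definition reindex :: "('m \<Rightarrow> 'n) \<Rightarrow> 'a^'n \<Rightarrow> 'a^'m" where
  "reindex e x = (\<chi> i. x $ e i)"

lemma reindex_nth [simp]: "reindex e x $ i = x $ e i"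
  by (simp add: reindex_def)

lemma reindex_reindex_inv [simp]:
  assumes "bij e"
  shows "reindex e (reindex (inv e) y) = y" "reindex (inv e) (reindex e x) = x"
  using assms by (simp_all add: vec_eq_iff bij_is_inj bij_is_surj surj_f_inv_f)

lemma bounded_linear_reindex: "bounded_linear (reindex e :: real^'n \<Rightarrow> real^'m)"
  by (auto simp: linear_conv_bounded_linear[symmetric] vec_eq_iff intro!: linearI)

lemma borel_measurable_reindex [measurable]:
    "(reindex e :: real^'n \<Rightarrow> real^'m) \<in> borel_measurable borel"
  by (intro borel_measurable_continuous_onI linear_continuous_on bounded_linear_reindex)

lemma det_reindex:
  fixes A :: "'a::comm_ring_1^'n^'n" and e :: "'m::finite \<Rightarrow> 'n"
  assumes e: "bij e"
  shows "det (\<chi> i j. A $ e i $ e j) = det A"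
proof -
  let ?Q = "map_permutation UNIV e"
  have Q_e: "?Q p (e i) = e (p i)" for p i
    using e by (simp add: map_permutation_apply bij_is_inj)
  have "bij_betw ?Q {p. p permutes UNIV} {q. q permutes UNIV}"
    by (rule bij_betw_byWitness[where f' = "map_permutation UNIV (inv e)"])
       (use e bij_imp_bij_inv[OF e] in \<open>auto simp: map_permutation_compose_inv[where B = UNIV]
          bij_is_inj bij_is_surj surj_f_inv_f intro!: map_permutation_permutes\<close>)
  then have "det A = (\<Sum>p | p permutes (UNIV :: 'm set). of_int (sign (?Q p)) *
      (\<Prod>k\<in>UNIV. A $ k $ ?Q p k))"
    unfolding det_def by (rule sum.reindex_bij_betw[symmetric])
  also have "\<dots> = (\<Sum>p | p permutes (UNIV :: 'm set). of_int (sign p) * (\<Prod>i\<in>UNIV. A $ e i $ e (p i)))"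
    using prod.reindex_bij_betw[OF e, of "\<lambda>k. A $ k $ ?Q _ k"] e
    by (intro sum.cong refl) (simp add: Q_e sign_map_permutation bij_is_inj)
  finally show ?thesis
    by (simp add: det_def)
qed

lemma det_matrix_reindex:
  fixes L :: "real^'n \<Rightarrow> real^'n" and e :: "'m::finite \<Rightarrow> 'n"
  assumes e: "bij e"
  shows "det (matrix (reindex e \<circ> L \<circ> reindex (inv e))) = det (matrix L)"
proof -
  have axis: "reindex (inv e) (axis i 1) = (axis (e i) 1 :: real^'n)" for i
    using e by (auto simp: vec_eq_iff axis_def bij_is_inj bij_is_surj surj_f_inv_f)
  have "matrix (reindex e \<circ> L \<circ> reindex (inv e)) $ i $ j = matrix L $ e i $ e j" for i j
    by (simp add: matrix_def axis)
  then have "matrix (reindex e \<circ> L \<circ> reindex (inv e)) = (\<chi> i j. matrix L $ e i $ e j)"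
    by (simp add: vec_eq_iff)
  then show ?thesis
    by (simp add: det_reindex[OF e])
qed

lemma emeasure_lborel_box_cart:
  fixes l u :: "real^'n"
  assumes "\<And>i. l $ i \<le> u $ i"
  shows "emeasure lborel (box l u) = (\<Prod>i\<in>UNIV. u $ i - l $ i)"
proof -
  have "emeasure lborel (box l u) = (\<Prod>b\<in>Basis. (u - l) \<bullet> b)"
    using assms by (intro emeasure_lborel_box) (auto simp: Basis_vec_def inner_axis)
  also have "(\<Prod>b\<in>Basis. (u - l) \<bullet> b) = (\<Prod>i\<in>UNIV. u $ i - l $ i)"
    by (simp add: Basis_vec_def UNION_singleton_eq_range prod.reindex inj_def axis_eq_axis
        inner_axis)
  finally show ?thesis .
qed

lemma distr_lborel_reindex:
  fixes e :: "'m::finite \<Rightarrow> 'n::finite"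
  assumes e: "bij e"
  shows "distr lborel borel (reindex e) = (lborel :: (real^'m) measure)"
proof (rule lborel_eqI[symmetric])
  fix l u :: "real^'m"
  assume le: "\<And>b. b \<in> Basis \<Longrightarrow> l \<bullet> b \<le> u \<bullet> b"
  then have le': "l $ i \<le> u $ i" for i
    by (simp add: cart_eq_inner_axis axis_in_Basis_iff)
  have "reindex e -` box l u = box (reindex (inv e) l) (reindex (inv e) u)"
    using e by (auto simp: mem_box_cart bij_is_inj) (metis bij_inv_eq_iff)+
  then have "emeasure (distr lborel borel (reindex e)) (box l u) =
      (\<Prod>k\<in>UNIV. u $ inv e k - l $ inv e k)"
    using le' by (simp add: emeasure_distr emeasure_lborel_box_cart)
  also have "(\<Prod>k\<in>UNIV. u $ inv e k - l $ inv e k) = (\<Prod>i\<in>UNIV. u $ i - l $ i)"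
    by (rule prod.reindex_bij_betw[OF bij_imp_bij_inv[OF e]])
  also have "ennreal \<dots> = (\<Prod>b\<in>Basis. (u - l) \<bullet> b)"
    using emeasure_lborel_box_cart[OF le'] emeasure_lborel_box[OF le] by simp
  finally show "emeasure (distr lborel borel (reindex e)) (box l u) = (\<Prod>b\<in>Basis. (u - l) \<bullet> b)" .
qed simp

lemma set_borel_measurable_reindex:
  fixes f :: "real^'m \<Rightarrow> real" and e :: "'m::finite \<Rightarrow> 'n::finite"
  assumes "set_borel_measurable borel S f"
  shows "set_borel_measurable borel (reindex e -` S) (\<lambda>x. f (reindex e x))"
proof -
  have "(\<lambda>x::real^'n. indicator S (reindex e x) *\<^sub>R f (reindex e x)) \<in> borel_measurable borel"
    using assms unfolding set_borel_measurable_def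
    by (rule measurable_compose[OF borel_measurable_reindex])
  then show ?thesis
    by (simp add: set_borel_measurable_def indicator_vimage)
qed

lemma set_nn_integral_reindex:
  fixes f :: "real^'m \<Rightarrow> real" and e :: "'m::finite \<Rightarrow> 'n::finite"
  assumes "bij e" and f: "set_borel_measurable borel S f"
  shows "(\<integral>\<^sup>+y\<in>S. ennreal (f y) \<partial>lborel) = (\<integral>\<^sup>+x\<in>reindex e -` S. ennreal (f (reindex e x)) \<partial>lborel)"
proof -
  have "(\<lambda>y. ennreal (indicator S y *\<^sub>R f y)) \<in> borel_measurable borel"
    using f by (simp add: set_borel_measurable_def)
  moreover have "ennreal (indicator S y *\<^sub>R f y) = ennreal (f y) * indicator S y" for y
    by (simp split: split_indicator)
  ultimately show ?thesis
    by (subst distr_lborel_reindex[OF \<open>bij e\<close>, symmetric])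
       (simp add: nn_integral_distr indicator_vimage)
qed

lemma set_nn_integral_eq_Henstock:
  fixes u :: "'a::euclidean_space \<Rightarrow> real"
  assumes meas: "set_borel_measurable borel S u" and nonneg: "\<And>x. x \<in> S \<Longrightarrow> 0 \<le> u x"
  shows "(\<integral>\<^sup>+x\<in>S. ennreal (u x) \<partial>lborel) =
    (if u absolutely_integrable_on S then ennreal (integral S u) else \<infinity>)"
proof -
  let ?v = "\<lambda>x. indicator S x *\<^sub>R u x"
  have v_meas [measurable]: "?v \<in> borel_measurable borel"
    using meas by (simp add: set_borel_measurable_def)
  have eq: "(\<integral>\<^sup>+x\<in>S. ennreal (u x) \<partial>lborel) = (\<integral>\<^sup>+x. ennreal (?v x) \<partial>lborel)"
    by (intro nn_integral_cong) (simp split: split_indicator)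
  have pos: "0 \<le> ?v x" for x
    using nonneg by (simp split: split_indicator)
  have iff: "u absolutely_integrable_on S \<longleftrightarrow> integrable lborel ?v"
    unfolding set_integrable_def by (rule integrable_completion) measurable
  show ?thesis
  proof (cases "integrable lborel ?v")
    case True
    then have "integral S u = integral\<^sup>L lborel ?v"
      using iff set_lebesgue_integral_eq_integral(2)[of S u]
      by (simp add: set_lebesgue_integral_def integral_completion)
    then show ?thesis
      using True iff pos eq by (simp add: nn_integral_eq_integral)
  next
    case False
    then have "\<not> (\<integral>\<^sup>+x. ennreal (?v x) \<partial>lborel) < \<infinity>"
      using integrableI_nonneg[of ?v lborel] v_meas pos by auto
    then have "(\<integral>\<^sup>+x. ennreal (?v x) \<partial>lborel) = \<infinity>"
      by (simp add: less_top[symmetric])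
    then show ?thesis
      using False iff eq by simp
  qed
qed

lemma nn_integral_change_of_variables_wellorder:
  fixes g :: "real^'n::{finite,wellorder} \<Rightarrow> real^'n::_" and f :: "real^'n::_ \<Rightarrow> real"
  assumes S: "S \<in> sets borel"
    and der: "\<And>x. x \<in> S \<Longrightarrow> (g has_derivative g' x) (at x within S)"
    and inj: "inj_on g S"
    and nonneg: "\<And>x. x \<in> g ` S \<Longrightarrow> 0 \<le> f x"
    and f_meas: "set_borel_measurable borel (g ` S) f"
    and f_g_meas: "set_borel_measurable borel S (\<lambda>x. \<bar>det (matrix (g' x))\<bar> * f (g x))"
  shows "(\<integral>\<^sup>+x\<in>g ` S. ennreal (f x) \<partial>lborel) =
    (\<integral>\<^sup>+x\<in>S. ennreal (\<bar>det (matrix (g' x))\<bar> * f (g x)) \<partial>lborel)"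
proof -
  let ?f_g = "\<lambda>x. \<bar>det (matrix (g' x))\<bar> * f (g x)"
  have "S \<in> sets lebesgue"
    using S by (simp add: sets_completionI_sets)
  note cov = has_absolute_integral_change_of_variables[OF this der inj,
      of "\<lambda>x. vec (f x) :: real^1", unfolded absolutely_integrable_on_1_iff integral_on_1_eq]
  have "?f_g absolutely_integrable_on S \<and> integral S ?f_g = b \<longleftrightarrow>
      f absolutely_integrable_on (g ` S) \<and> integral (g ` S) f = b" for b
    using cov[of "vec b"] by (simp add: vec_eq_iff)
  then have "?f_g absolutely_integrable_on S \<longleftrightarrow> f absolutely_integrable_on (g ` S)"
    "f absolutely_integrable_on (g ` S) \<Longrightarrow> integral S ?f_g = integral (g ` S) f"
    by blast+
  moreover have "(\<integral>\<^sup>+x\<in>S. ennreal (?f_g x) \<partial>lborel) =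
      (if ?f_g absolutely_integrable_on S then ennreal (integral S ?f_g) else \<infinity>)"
    using nonneg by (intro set_nn_integral_eq_Henstock f_g_meas) simp
  moreover have "(\<integral>\<^sup>+x\<in>g ` S. ennreal (f x) \<partial>lborel) =
      (if f absolutely_integrable_on (g ` S) then ennreal (integral (g ` S) f) else \<infinity>)"
    by (intro set_nn_integral_eq_Henstock f_meas nonneg)
  ultimately show ?thesis
    by presburger
qed

lemma reindex_conjugate_image:
  assumes "bij e"
  shows "(reindex e \<circ> g \<circ> reindex (inv e)) ` reindex (inv e) -` S = reindex (inv e) -` g ` S"
proof (intro subset_antisym subsetI)
  fix y assume "y \<in> reindex (inv e) -` g ` S"
  then obtain x where "x \<in> S" "reindex (inv e) y = g x" by auto
  then have "reindex e x \<in> reindex (inv e) -` S"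
    and "y = (reindex e \<circ> g \<circ> reindex (inv e)) (reindex e x)"
    using assms reindex_reindex_inv(1)[OF assms, of y] by simp_all
  then show "y \<in> (reindex e \<circ> g \<circ> reindex (inv e)) ` reindex (inv e) -` S" by blast
qed (use assms in auto)

lemma inj_on_reindex_conjugate:
  assumes "bij e" "inj_on g S"
  shows "inj_on (reindex e \<circ> g \<circ> reindex (inv e)) (reindex (inv e) -` S)"
  using assms(2) by (auto simp: inj_on_def) (metis reindex_reindex_inv[OF assms(1)])

lemma has_derivative_reindex_conjugate:
  fixes g :: "real^'n::finite \<Rightarrow> real^'n" and e :: "'m::finite \<Rightarrow> 'n"
  assumes "(g has_derivative g') (at (reindex (inv e) y) within S)"
  shows "((reindex e \<circ> g \<circ> reindex (inv e)) has_derivative (reindex e \<circ> g' \<circ> reindex (inv e)))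
    (at y within reindex (inv e) -` S)"
proof -
  have "(g has_derivative g')
      (at (reindex (inv e) y) within reindex (inv e) ` reindex (inv e) -` S)"
    by (rule has_derivative_subset[OF assms]) auto
  then show ?thesis
    by (intro diff_chain_within bounded_linear_imp_has_derivative bounded_linear_reindex)
       (simp_all add: o_assoc)
qed

theorem nn_integral_change_of_variables:
  fixes g :: "real^'n::finite \<Rightarrow> real^'n" and f :: "real^'n \<Rightarrow> real"
  assumes S: "S \<in> sets borel"
    and der: "\<And>x. x \<in> S \<Longrightarrow> (g has_derivative g' x) (at x within S)"
    and inj: "inj_on g S"
    and nonneg: "\<And>x. x \<in> g ` S \<Longrightarrow> 0 \<le> f x"
    and f_meas: "set_borel_measurable borel (g ` S) f"
    and f_g_meas: "set_borel_measurable borel S (\<lambda>x. \<bar>det (matrix (g' x))\<bar> * f (g x))"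
  shows "(\<integral>\<^sup>+x\<in>g ` S. ennreal (f x) \<partial>lborel) =
    (\<integral>\<^sup>+x\<in>S. ennreal (\<bar>det (matrix (g' x))\<bar> * f (g x)) \<partial>lborel)"
proof -
  let ?P = "reindex of_wellordered :: real^'n \<Rightarrow> real^'n wellordered"
  let ?R = "reindex (inv of_wellordered) :: real^'n wellordered \<Rightarrow> real^'n"
  let ?G = "?P \<circ> g \<circ> ?R" and ?G' = "\<lambda>y. ?P \<circ> g' (?R y) \<circ> ?R"
  note bij = bij_of_wellordered
  have R_G: "?R (?G y) = g (?R y)" for y
    by (simp add: bij)
  have det: "det (matrix (?G' y)) = det (matrix (g' (?R y)))" for y
    by (rule det_matrix_reindex[OF bij])
  have image: "?G ` ?R -` S = ?R -` g ` S"
    by (rule reindex_conjugate_image[OF bij])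
  have "(\<integral>\<^sup>+x\<in>g ` S. ennreal (f x) \<partial>lborel) = (\<integral>\<^sup>+y\<in>?G ` ?R -` S. ennreal (f (?R y)) \<partial>lborel)"
    unfolding image by (rule set_nn_integral_reindex[OF bij_imp_bij_inv[OF bij] f_meas])
  also have "\<dots> = (\<integral>\<^sup>+y\<in>?R -` S. ennreal (\<bar>det (matrix (?G' y))\<bar> * f (?R (?G y))) \<partial>lborel)"
  proof (rule nn_integral_change_of_variables_wellorder)
    show "?R -` S \<in> sets borel"
      using S by (intro measurable_sets_borel[OF borel_measurable_reindex])
    show "(?G has_derivative ?G' y) (at y within ?R -` S)" if "y \<in> ?R -` S" for y
      using that by (intro has_derivative_reindex_conjugate der) simp
    show "inj_on ?G (?R -` S)"
      by (rule inj_on_reindex_conjugate[OF bij inj])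
    show "0 \<le> f (?R y)" if "y \<in> ?G ` ?R -` S" for y
      using that nonneg unfolding image by simp
    show "set_borel_measurable borel (?G ` ?R -` S) (\<lambda>y. f (?R y))"
      unfolding image by (rule set_borel_measurable_reindex[OF f_meas])
    show "set_borel_measurable borel (?R -` S) (\<lambda>y. \<bar>det (matrix (?G' y))\<bar> * f (?R (?G y)))"
      unfolding det R_G by (rule set_borel_measurable_reindex[OF f_g_meas])
  qed
  also have "\<dots> = (\<integral>\<^sup>+x\<in>S. ennreal (\<bar>det (matrix (g' x))\<bar> * f (g x)) \<partial>lborel)"
    unfolding det R_G
    by (rule set_nn_integral_reindex[OF bij_imp_bij_inv[OF bij] f_g_meas, symmetric])
  finally show ?thesis .
qed

subsection \<open>Continuously differentiable functions\<close>

lemma has_derivative_cong_open: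
  assumes "open U" "x \<in> U" "\<And>y. y \<in> U \<Longrightarrow> f y = g y"
  shows "(f has_derivative f') (at x) \<longleftrightarrow> (g has_derivative f') (at x)"
  using has_derivative_transform_within_open[OF _ assms(1,2), of f f' UNIV g]
    has_derivative_transform_within_open[OF _ assms(1,2), of g f' UNIV f] assms(3) by auto

lemma frechet_derivative_cong_open:
  assumes "open U" "x \<in> U" "\<And>y. y \<in> U \<Longrightarrow> f y = g y"
  shows "frechet_derivative f (at x) = frechet_derivative g (at x)"
  using has_derivative_cong_open[of U x f g, OF assms] by (simp add: frechet_derivative_def)

lemma frechet_derivative_eq_0_outside:
  assumes "open V" "closed K" "\<And>x. x \<in> V - K \<Longrightarrow> f x = 0" "x \<in> V - K"
  shows "frechet_derivative f (at x) = (\<lambda>_. 0)"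
  using frechet_derivative_cong_open[of "V - K" x f "\<lambda>_. 0"] assms by (auto simp: open_Diff)

lemma continuous_on_locally_eq:
  fixes f :: "'a::t2_space \<Rightarrow> 'b::topological_space"
  assumes "\<And>x. x \<in> S \<Longrightarrow> \<exists>U F. open U \<and> x \<in> U \<and> continuous_on U F \<and> (\<forall>y\<in>U \<inter> S. F y = f y)"
  shows "continuous_on S f"
  unfolding continuous_on_def
proof
  fix x assume "x \<in> S"
  then obtain U F where U: "open U" "x \<in> U" "continuous_on U F" "\<And>y. y \<in> U \<inter> S \<Longrightarrow> F y = f y"
    using assms by metis
  then have "isCont F x"
    by (simp add: continuous_on_eq_continuous_at)
  then have "(F \<longlongrightarrow> F x) (at x within S)"
    by (simp add: continuous_at_imp_continuous_within flip: continuous_within)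
  moreover have "\<forall>\<^sub>F y in at x within S. F y = f y"
    using U eventually_at_topological by blast
  ultimately have "(f \<longlongrightarrow> F x) (at x within S)"
    by (rule Lim_transform_eventually)
  then show "(f \<longlongrightarrow> f x) (at x within S)"
    using U(2,4) \<open>x \<in> S\<close> by simp
qed

lemma Ck_on_subset: "Ck_on k T f \<Longrightarrow> S \<subseteq> T \<Longrightarrow> Ck_on k S f"
  by (induction k arbitrary: f) (auto intro: continuous_on_subset)

lemma Ck_on_cong_open:
  assumes "open U" "\<And>y. y \<in> U \<Longrightarrow> f y = g y" "Ck_on k U f"
  shows "Ck_on k U g"
  using assms(2,3)
proof (induction k arbitrary: f g)
  case 0
  then show ?case by (simp cong: continuous_on_cong)
next
  case (Suc k)
  have eq: "frechet_derivative f (at x) = frechet_derivative g (at x)" if "x \<in> U" for x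
    using Suc.prems(1) by (intro frechet_derivative_cong_open[OF assms(1) that])
  have "Ck_on k U (\<lambda>x. frechet_derivative g (at x) b)" if "b \<in> Basis" for b
    using Suc.prems(2) that by (auto intro: Suc.IH[of "\<lambda>x. frechet_derivative f (at x) b"] simp: eq)
  moreover have "g differentiable (at x)" if "x \<in> U" for x
  proof -
    have "f differentiable (at x)"
      using Suc.prems(2) that by simp
    then show ?thesis
      using has_derivative_cong_open[OF assms(1) that Suc.prems(1)]
      by (simp add: differentiable_def)
  qed
  ultimately show ?case by simp
qed

lemma Ck_on_locally:
  assumes "\<And>x. x \<in> S \<Longrightarrow> \<exists>U. open U \<and> x \<in> U \<and> Ck_on k U f"
  shows "Ck_on k S f"
  using assms
proof (induction k arbitrary: f)
  case 0
  show ?case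
    unfolding Ck_on.simps by (rule continuous_on_locally_eq) (use 0 in force)
next
  case (Suc k)
  then have "Ck_on k S (\<lambda>x. frechet_derivative f (at x) b)" if "b \<in> Basis" for b
    using that by (intro Suc.IH) fastforce
  then show ?case
    using Suc.prems by fastforce
qed

lemma smooth_on_imp_Ck_on:
  assumes "open S" "smooth_on S f"
  shows "Ck_on k S f"
proof (rule Ck_on_locally)
  fix x assume "x \<in> S"
  then obtain U F where U: "open U" "x \<in> U" "\<And>k. Ck_on k U F" "\<And>y. y \<in> U \<inter> S \<Longrightarrow> F y = f y"
    using assms(2) unfolding smooth_on_def by metis
  have "Ck_on k (U \<inter> S) f"
    by (rule Ck_on_cong_open[of "U \<inter> S" F])
       (use U assms(1) Ck_on_subset[OF U(3), of "U \<inter> S"] in auto)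
  then show "\<exists>U. open U \<and> x \<in> U \<and> Ck_on k U f"
    using U assms(1) \<open>x \<in> S\<close> by (intro exI[of _ "U \<inter> S"]) auto
qed

lemma smooth_on_imp_continuous_on: "smooth_on S f \<Longrightarrow> continuous_on S f"
  unfolding smooth_on_def by (intro continuous_on_locally_eq) (meson Ck_on.simps(1))

definition C1_on :: "'a::euclidean_space set \<Rightarrow> ('a \<Rightarrow> 'b::real_normed_vector) \<Rightarrow> bool" where
  "C1_on S f \<longleftrightarrow> Ck_on 1 S f"

lemma C1_on_iff:
  "C1_on S f \<longleftrightarrow> (\<forall>x\<in>S. f differentiable (at x)) \<and>
     (\<forall>b\<in>Basis. continuous_on S (\<lambda>x. frechet_derivative f (at x) b))"
  by (simp add: C1_on_def)

lemma C1_onI: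
  assumes "\<And>x. x \<in> S \<Longrightarrow> (f has_derivative f' x) (at x)"
    and "\<And>b. b \<in> Basis \<Longrightarrow> continuous_on S (\<lambda>x. f' x b)"
  shows "C1_on S f"
proof -
  have "frechet_derivative f (at x) = f' x" if "x \<in> S" for x
    using frechet_derivative_at[OF assms(1)[OF that]] by simp
  then show ?thesis
    using assms by (auto simp: C1_on_iff differentiable_def cong: continuous_on_cong)
qed

lemma C1_on_has_derivative:
  "C1_on S f \<Longrightarrow> x \<in> S \<Longrightarrow> (f has_derivative frechet_derivative f (at x)) (at x)"
  by (simp add: C1_on_iff frechet_derivative_works[symmetric])

lemma C1_on_imp_continuous_on: "C1_on S f \<Longrightarrow> continuous_on S f"
  by (meson C1_on_iff continuous_at_imp_continuous_on differentiable_imp_continuous_within)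

lemma C1_on_continuous_on_derivative_compose:
  assumes f: "C1_on S f" and g: "continuous_on T g" "g ` T \<subseteq> S" and v: "continuous_on T v"
  shows "continuous_on T (\<lambda>z. frechet_derivative f (at (g z)) (v z))"
proof -
  have "frechet_derivative f (at (g z)) (v z) =
      (\<Sum>b\<in>Basis. (v z \<bullet> b) *\<^sub>R frechet_derivative f (at (g z)) b)" if "z \<in> T" for z
  proof -
    interpret linear "frechet_derivative f (at (g z))"
      using f g(2) that by (intro linear_frechet_derivative) (auto simp: C1_on_iff)
    have "frechet_derivative f (at (g z)) (v z) =
        frechet_derivative f (at (g z)) (\<Sum>b\<in>Basis. (v z \<bullet> b) *\<^sub>R b)"
      by (simp add: euclidean_representation)
    then show ?thesis
      by (simp only: sum scale)
  qed
  moreover have "continuous_on T (\<lambda>z. \<Sum>b\<in>Basis. (v z \<bullet> b) *\<^sub>R frechet_derivative f (at (g z)) b)"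
    using f by (intro continuous_intros v continuous_on_compose2[OF _ g]) (auto simp: C1_on_iff)
  ultimately show ?thesis
    by (simp cong: continuous_on_cong)
qed

lemma C1_on_continuous_on_derivative:
  assumes "C1_on S f" "continuous_on S v"
  shows "continuous_on S (\<lambda>x. frechet_derivative f (at x) (v x))"
  using C1_on_continuous_on_derivative_compose[OF assms(1) continuous_on_id _ assms(2)] by simp

lemma C1_on_cong_open:
  assumes "open U" "\<And>y. y \<in> U \<Longrightarrow> f y = g y" "C1_on U f"
  shows "C1_on U g"
  using assms unfolding C1_on_def by (rule Ck_on_cong_open)

lemma C1_on_open_Un:
  assumes "open U" "open V" "C1_on U f" "C1_on V f"
  shows "C1_on (U \<union> V) f"
  using assms by (auto simp: C1_on_iff intro!: continuous_on_open_Un)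

lemma C1_on_const: "C1_on S (\<lambda>x. c)"
  by (rule C1_onI[where f' = "\<lambda>_ _. 0"]) auto

lemma C1_on_add:
  assumes f: "C1_on S f" and g: "C1_on S g"
  shows "C1_on S (\<lambda>x. f x + g x)"
  by (rule C1_onI[OF has_derivative_add[OF C1_on_has_derivative[OF f] C1_on_has_derivative[OF g]]])
     (assumption | intro continuous_on_add continuous_on_const
       C1_on_continuous_on_derivative[OF f] C1_on_continuous_on_derivative[OF g])+

lemma C1_on_sum: "(\<And>k. k \<in> I \<Longrightarrow> C1_on S (f k)) \<Longrightarrow> C1_on S (\<lambda>x. \<Sum>k\<in>I. f k x)"
  by (induction I rule: infinite_finite_induct) (auto intro: C1_on_add C1_on_const)

lemma C1_on_bounded_linear:
  assumes "bounded_linear L" "C1_on S f"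
  shows "C1_on S (\<lambda>x. L (f x))"
  by (rule C1_onI[OF bounded_linear.has_derivative[OF assms(1) C1_on_has_derivative[OF assms(2)]]])
     (auto intro!: bounded_linear.continuous_on[OF assms(1)]
         C1_on_continuous_on_derivative[OF assms(2)]
       continuous_on_const)

lemma (in bounded_bilinear) C1_on:
  assumes f: "C1_on S f" and g: "C1_on S g"
  shows "C1_on S (\<lambda>x. prod (f x) (g x))"
  by (rule C1_onI[OF FDERIV[OF C1_on_has_derivative[OF f] C1_on_has_derivative[OF g]]])
     (assumption | intro continuous_on continuous_on_add continuous_on_const
       C1_on_imp_continuous_on[OF f] C1_on_imp_continuous_on[OF g]
       C1_on_continuous_on_derivative[OF f] C1_on_continuous_on_derivative[OF g])+

lemmas C1_on_mult = bounded_bilinear.C1_on[OF bounded_bilinear_mult]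

lemma C1_on_compose:
  assumes f: "C1_on V f" and g: "C1_on U g" and sub: "g ` U \<subseteq> V"
  shows "C1_on U (\<lambda>x. f (g x))"
proof (rule C1_onI)
  show "((\<lambda>x. f (g x)) has_derivative
      (\<lambda>h. frechet_derivative f (at (g x)) (frechet_derivative g (at x) h))) (at x)"
    if "x \<in> U" for x
    using that sub C1_on_has_derivative[OF f, of "g x"] C1_on_has_derivative[OF g that]
    by (intro has_derivative_compose[of g _ x UNIV f]) auto
  show "continuous_on U (\<lambda>x. frechet_derivative f (at (g x)) (frechet_derivative g (at x) b))" for b
    by (intro C1_on_continuous_on_derivative_compose[OF f C1_on_imp_continuous_on[OF g] sub]
        C1_on_continuous_on_derivative[OF g] continuous_on_const)
qed

lemma C1_on_real:
  fixes f :: "real \<Rightarrow> real"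
  assumes "\<And>x. x \<in> S \<Longrightarrow> (f has_real_derivative f' x) (at x)" "continuous_on S f'"
  shows "C1_on S f"
  using assms by (intro C1_onI[where f' = "\<lambda>x. (*) (f' x)"] continuous_intros)
    (auto simp: has_field_derivative_def)

lemma C1_on_divide:
  fixes f g :: "'a::euclidean_space \<Rightarrow> real"
  assumes "C1_on S f" "C1_on S g" "\<And>x. x \<in> S \<Longrightarrow> g x \<noteq> 0"
  shows "C1_on S (\<lambda>x. f x / g x)"
proof -
  have "C1_on (- {0::real}) inverse"
    by (rule C1_on_real[OF DERIV_inverse]) (auto intro!: continuous_intros)
  then have "C1_on S (\<lambda>x. inverse (g x))"
    by (rule C1_on_compose[OF _ assms(2)]) (use assms(3) in auto)
  then show ?thesis
    using C1_on_mult[OF assms(1)] by (simp add: divide_inverse)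
qed

lemma C1_on_sqrt:
  assumes "C1_on S f" "\<And>x. x \<in> S \<Longrightarrow> 0 < f x"
  shows "C1_on S (\<lambda>x. sqrt (f x))"
proof -
  have "C1_on {0<..} sqrt"
    by (rule C1_on_real[OF DERIV_real_sqrt]) (auto intro!: continuous_intros)
  then show ?thesis
    by (rule C1_on_compose[OF _ assms(1)]) (use assms(2) in auto)
qed

lemma C1_on_det:
  fixes f :: "'a::euclidean_space \<Rightarrow> real^'n^'n"
  assumes f: "C1_on S f" and inv: "\<And>x. x \<in> S \<Longrightarrow> invertible (f x)"
  shows "C1_on S (\<lambda>x. det (f x))"
  by (rule C1_onI[OF has_derivative_det[OF C1_on_has_derivative[OF f] inv]])
     (auto intro!: continuous_intros continuous_on_matrix_inv inv
       C1_on_imp_continuous_on[OF f] C1_on_continuous_on_derivative[OF f])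

lemma C1_on_matrix_inv:
  fixes f :: "'a::euclidean_space \<Rightarrow> real^'n^'n"
  assumes f: "C1_on S f" and inv: "\<And>x. x \<in> S \<Longrightarrow> invertible (f x)"
  shows "C1_on S (\<lambda>x. matrix_inv (f x))"
  by (rule C1_onI[OF has_derivative_matrix_inv[OF C1_on_has_derivative[OF f] inv]])
     (auto intro!: continuous_intros continuous_on_matrix_inv inv
       C1_on_imp_continuous_on[OF f] C1_on_continuous_on_derivative[OF f])

lemma smooth_on_imp_C1_on:
  assumes "open S" "smooth_on S f"
  shows "C1_on S f" and "b \<in> Basis \<Longrightarrow> C1_on S (\<lambda>x. frechet_derivative f (at x) b)"
  using smooth_on_imp_Ck_on[OF assms, of 1] smooth_on_imp_Ck_on[OF assms, of 2]
  by (simp_all add: C1_on_def numeral_2_eq_2)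

lemma C1_on_extend_zero:
  assumes "open V" "compact K" "K \<subseteq> V" "C1_on V f" "\<And>x. x \<in> V - K \<Longrightarrow> f x = 0"
  shows "C1_on UNIV (\<lambda>x. if x \<in> V then f x else 0)"
proof -
  have "open (- K)"
    using assms(2) by (simp add: compact_imp_closed open_Compl)
  moreover have "C1_on V (\<lambda>x. if x \<in> V then f x else 0)"
    by (rule C1_on_cong_open[OF assms(1) _ assms(4)]) simp
  moreover have "C1_on (- K) (\<lambda>x. if x \<in> V then f x else 0)"
    by (rule C1_on_cong_open[OF \<open>open (- K)\<close> _ C1_on_const[of _ 0]]) (use assms(5) in auto)
  ultimately have "C1_on (V \<union> - K) (\<lambda>x. if x \<in> V then f x else 0)"
    using assms(1) by (intro C1_on_open_Un)
  moreover have "V \<union> - K = UNIV"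
    using assms(3) by auto
  ultimately show ?thesis by simp
qed

lemma C1_on_has_real_derivative:
  fixes F :: "real \<Rightarrow> real"
  assumes "C1_on U F" "s \<in> U"
  shows "(F has_real_derivative frechet_derivative F (at s) 1) (at s)"
proof -
  note F = C1_on_has_derivative[OF assms]
  have "frechet_derivative F (at s) v = frechet_derivative F (at s) 1 * v" for v
    using linear_scale[OF has_derivative_linear[OF F], of v 1]
    by (simp only: real_scaleR_def mult_1_right mult_1_left mult.commute)
  then show ?thesis
    unfolding has_field_derivative_def by (rule has_derivative_eq_rhs[OF F, OF ext])
qed

lemma smooth_on_imp_has_real_derivative_locally:
  fixes f :: "real \<Rightarrow> real"
  assumes f: "smooth_on S f" and "t \<in> S"
  shows "\<exists>U F'. open U \<and> t \<in> U \<and> continuous_on U F' \<and>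
    (\<forall>s\<in>U \<inter> S. (f has_real_derivative F' s) (at s within S))"
proof -
  obtain U F where U: "open U" "t \<in> U" "\<And>k. Ck_on k U F" "\<And>s. s \<in> U \<inter> S \<Longrightarrow> F s = f s"
    using f \<open>t \<in> S\<close> unfolding smooth_on_def by metis
  have F: "C1_on U F"
    using U(3) by (simp only: C1_on_def)
  let ?F' = "\<lambda>s. frechet_derivative F (at s) 1"
  have "(f has_real_derivative ?F' s) (at s within S)" if s: "s \<in> U \<inter> S" for s
  proof -
    have "\<forall>\<^sub>F y in at s within S. F y = f y"
      unfolding eventually_at_topological using U(1,4) s by (intro exI[of _ U]) blast
    then show ?thesis
      using has_field_derivative_cong_eventually[of F f s S] U(4)[OF s] s
        has_field_derivative_at_within[OF C1_on_has_real_derivative[OF F]] by blast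
  qed
  then show ?thesis
    using U(1,2) C1_on_continuous_on_derivative[OF F continuous_on_const] by blast
qed

lemma smooth_on_Icc_imp_C1:
  fixes f :: "real \<Rightarrow> real"
  assumes f: "smooth_on {a..b} f" and "a < b"
  obtains f' where "continuous_on {a..b} f'"
    "\<And>t. t \<in> {a..b} \<Longrightarrow> (f has_real_derivative f' t) (at t within {a..b})"
proof
  define f' where "f' t = vector_derivative f (at t within {a..b})" for t
  note locally = smooth_on_imp_has_real_derivative_locally[OF f]
  have unique: "f' s = D" if "(f has_real_derivative D) (at s within {a..b})" "s \<in> {a..b}" for s D
    using vector_derivative_within_cbox[of a b s f D] that \<open>a < b\<close>
    by (simp add: f'_def has_real_derivative_iff_has_vector_derivative)
  show "(f has_real_derivative f' t) (at t within {a..b})" if t: "t \<in> {a..b}" for t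
  proof -
    obtain D where "(f has_real_derivative D) (at t within {a..b})"
      using locally[OF t] t by blast
    with unique[OF this t] show ?thesis by simp
  qed
  show "continuous_on {a..b} f'"
  proof (rule continuous_on_locally_eq)
    fix t assume "t \<in> {a..b}"
    then obtain U F' where U: "open U" "t \<in> U" "continuous_on U F'"
      "\<forall>s\<in>U \<inter> {a..b}. (f has_real_derivative F' s) (at s within {a..b})"
      using locally by blast
    then have "\<forall>s\<in>U \<inter> {a..b}. F' s = f' s"
      by (meson unique[symmetric] IntD2)
    with U show "\<exists>U F'. open U \<and> t \<in> U \<and> continuous_on U F' \<and> (\<forall>s\<in>U \<inter> {a..b}. F' s = f' s)"
      by blast
  qed
qed

lemma smooth_on_Times_imp_continuous_on_frechet_derivative:
  fixes f :: "'z::euclidean_space \<Rightarrow> 'a::euclidean_space \<Rightarrow> 'b::real_normed_vector"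
  assumes V: "open V" and f: "smooth_on (Z \<times> V) (\<lambda>(z, x). f z x)" and b: "b \<in> Basis"
  shows "continuous_on (Z \<times> V) (\<lambda>(z, x). frechet_derivative (f z) (at x) b)"
proof (rule continuous_on_locally_eq)
  fix w assume "w \<in> Z \<times> V"
  then obtain U F where U: "open U" "w \<in> U" "\<And>k. Ck_on k U F"
    "\<And>y. y \<in> U \<inter> (Z \<times> V) \<Longrightarrow> F y = (\<lambda>(z, x). f z x) y"
    using f unfolding smooth_on_def by metis
  have F: "C1_on U F"
    using U(3) by (simp only: C1_on_def)
  have "frechet_derivative F (at (z, x)) (0, b) = frechet_derivative (f z) (at x) b"
    if zx: "(z, x) \<in> U \<inter> (Z \<times> V)" for z x
  proof -
    let ?W = "V \<inter> Pair z -` U"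
    have W: "open ?W" "x \<in> ?W"
      using zx V U(1) by (auto intro!: open_Int open_vimage continuous_intros)
    have "((\<lambda>x. F (z, x)) has_derivative (\<lambda>v. frechet_derivative F (at (z, x)) (0, v))) (at x)"
      by (rule has_derivative_compose[where g = F])
         (use zx C1_on_has_derivative[OF F] in \<open>auto intro!: derivative_eq_intros\<close>)
    then have "frechet_derivative (\<lambda>x. F (z, x)) (at x) b = frechet_derivative F (at (z, x)) (0, b)"
      by (simp add: frechet_derivative_at[symmetric])
    moreover have "frechet_derivative (\<lambda>x. F (z, x)) (at x) = frechet_derivative (f z) (at x)"
      by (rule frechet_derivative_cong_open[OF W]) (use U(4) zx in auto)
    ultimately show ?thesis by simp
  qed
  moreover have "continuous_on U (\<lambda>y. frechet_derivative F (at y) (0, b))"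
    by (intro C1_on_continuous_on_derivative[OF F] continuous_on_const)
  ultimately show "\<exists>U G. open U \<and> w \<in> U \<and> continuous_on U G \<and>
      (\<forall>y\<in>U \<inter> (Z \<times> V). G y = (\<lambda>(z, x). frechet_derivative (f z) (at x) b) y)"
    using U(1,2) by (intro exI[of _ U] exI[of _ "\<lambda>y. frechet_derivative F (at y) (0, b)"]) auto
qed

definition bump :: "'a::euclidean_space \<Rightarrow> real \<Rightarrow> 'a \<Rightarrow> real" where
  "bump a r x = (max 0 (r\<^sup>2 - (x - a) \<bullet> (x - a)))\<^sup>2"

lemma DERIV_max_0_square: "((\<lambda>t::real. (max 0 t)\<^sup>2) has_real_derivative 2 * max 0 t) (at t)"
proof -
  consider "t > 0" | "t < 0" | "t = 0" by linarith
  then show ?thesis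
  proof cases
    assume "t > 0"
    then have "((\<lambda>t::real. t\<^sup>2) has_real_derivative 2 * max 0 t) (at t)"
      by (auto intro!: derivative_eq_intros)
    then show ?thesis
      by (rule has_field_derivative_transform_within_open[where S = "{0<..}"]) (use \<open>t > 0\<close> in auto)
  next
    assume "t < 0"
    then have "((\<lambda>t::real. 0) has_real_derivative 2 * max 0 t) (at t)"
      by (auto intro!: derivative_eq_intros)
    then show ?thesis
      by (rule has_field_derivative_transform_within_open[where S = "{..<0}"]) (use \<open>t < 0\<close> in auto)
  next
    assume "t = 0"
    have "((\<lambda>y::real. (max 0 y)\<^sup>2 / y) \<longlongrightarrow> 0) (at 0)"
    proof (rule Lim_null_comparison)
      have "norm ((max 0 y)\<^sup>2 / y) \<le> \<bar>y\<bar>" for y :: real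
        by (simp add: max_def power2_eq_square)
      then show "\<forall>\<^sub>F y in at 0. norm ((max 0 y)\<^sup>2 / y) \<le> \<bar>y\<bar>"
        by (intro always_eventually) blast
      show "((\<lambda>y::real. \<bar>y\<bar>) \<longlongrightarrow> 0) (at 0)"
        by (intro tendsto_eq_intros) auto
    qed
    then show ?thesis
      by (simp add: \<open>t = 0\<close> has_field_derivative_iff)
  qed
qed

lemma C1_on_bump: "C1_on S (bump a r)"
proof -
  have "C1_on UNIV (\<lambda>t::real. (max 0 t)\<^sup>2)"
    by (rule C1_on_real[OF DERIV_max_0_square]) (intro continuous_intros)
  moreover have "C1_on S (\<lambda>x. r\<^sup>2 - (x - a) \<bullet> (x - a))"
    by (rule C1_onI[where f' = "\<lambda>x h. - (2 * ((x - a) \<bullet> h))"])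
       (auto intro!: derivative_eq_intros continuous_intros simp: inner_commute)
  ultimately show ?thesis
    unfolding bump_def[abs_def] by (rule C1_on_compose) simp
qed

lemma bump_nonneg: "0 \<le> bump a r x"
  by (simp add: bump_def)

lemma bump_pos_iff: "0 < r \<Longrightarrow> 0 < bump a r x \<longleftrightarrow> x \<in> ball a r"
proof -
  assume "0 < r"
  have "(x - a) \<bullet> (x - a) = (dist a x)\<^sup>2"
    by (simp add: dist_norm power2_norm_eq_inner[symmetric] norm_minus_commute)
  moreover have "(dist a x)\<^sup>2 < r\<^sup>2 \<longleftrightarrow> dist a x < r"
    using \<open>0 < r\<close> power_strict_mono[of _ r 2] power2_less_imp_less[of _ r] by auto
  ultimately show ?thesis
    by (auto simp: bump_def max_def)
qed

lemma bump_eq_0: "0 < r \<Longrightarrow> x \<notin> ball a r \<Longrightarrow> bump a r x = 0"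
  using bump_pos_iff[of r a x] bump_nonneg[of a r x] by linarith

subsection \<open>Integration\<close>

lemma set_integrable_compact_support:
  fixes f :: "'a::euclidean_space \<Rightarrow> real"
  assumes "compact K" "K \<subseteq> V" "continuous_on V f" "\<And>x. x \<in> V - K \<Longrightarrow> f x = 0"
  shows "set_integrable lborel V f"
proof -
  have "set_integrable lborel K f"
    using borel_integrable_compact[OF assms(1) continuous_on_subset[OF assms(3,2)]]
    by (simp add: set_integrable_def)
  also have "(\<lambda>x. indicator K x *\<^sub>R f x) = (\<lambda>x. indicator V x *\<^sub>R f x)"
    using assms(2,4) by (auto simp: fun_eq_iff split: split_indicator)
  then have "set_integrable lborel K f \<longleftrightarrow> set_integrable lborel V f"
    by (simp add: set_integrable_def)
  finally show ?thesis .
qed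

lemma DERIV_integral_dominated:
  fixes f :: "real \<Rightarrow> 'a \<Rightarrow> real"
  assumes "t \<in> I" and int: "\<And>s. s \<in> I \<Longrightarrow> integrable M (f s)"
    and der: "\<And>x. x \<in> space M \<Longrightarrow> ((\<lambda>s. f s x) has_real_derivative f' x) (at t within I)"
    and [measurable]: "f' \<in> borel_measurable M"
    and lipschitz: "\<And>s x. s \<in> I \<Longrightarrow> x \<in> space M \<Longrightarrow> \<bar>f s x - f t x\<bar> \<le> B x * \<bar>s - t\<bar>"
    and B: "integrable M B"
  shows "((\<lambda>s. \<integral>x. f s x \<partial>M) has_real_derivative (\<integral>x. f' x \<partial>M)) (at t within I)"
  unfolding has_field_derivative_iff tendsto_at_iff_sequentially
proof (intro allI impI)
  fix X :: "nat \<Rightarrow> real"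
  assume X: "\<forall>i. X i \<in> I - {t}" "X \<longlonglongrightarrow> t"
  have "(\<lambda>i. \<integral>x. (f (X i) x - f t x) / (X i - t) \<partial>M) \<longlonglongrightarrow> (\<integral>x. f' x \<partial>M)"
  proof (rule integral_dominated_convergence[where w = B])
    have [measurable]: "f (X i) \<in> borel_measurable M" "f t \<in> borel_measurable M" for i
      using X(1) \<open>t \<in> I\<close> by (blast intro: borel_measurable_integrable int)+
    show "(\<lambda>x. (f (X i) x - f t x) / (X i - t)) \<in> borel_measurable M" for i
      by measurable
    show "AE x in M. (\<lambda>i. (f (X i) x - f t x) / (X i - t)) \<longlonglongrightarrow> f' x"
    proof (rule AE_I2)
      fix x assume "x \<in> space M"
      from der[OF this] show "(\<lambda>i. (f (X i) x - f t x) / (X i - t)) \<longlonglongrightarrow> f' x"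
        using X unfolding has_field_derivative_iff tendsto_at_iff_sequentially o_def by blast
    qed
    show "AE x in M. norm ((f (X i) x - f t x) / (X i - t)) \<le> B x" for i
      using lipschitz[of "X i"] X(1)
      by (intro AE_I2) (simp add: pos_divide_le_eq abs_divide)
  qed (use B in measurable)
  moreover have "(\<integral>x. (f (X i) x - f t x) / (X i - t) \<partial>M) =
      ((\<integral>x. f (X i) x \<partial>M) - (\<integral>x. f t x \<partial>M)) / (X i - t)" for i
    using int[of "X i"] int[OF \<open>t \<in> I\<close>] X(1) by simp
  ultimately show "((\<lambda>s. ((\<integral>x. f s x \<partial>M) - (\<integral>x. f t x \<partial>M)) / (s - t)) \<circ> X) \<longlonglongrightarrow> (\<integral>x. f' x \<partial>M)"
    by (simp only: o_def)
qed

lemma borel_measurable_continuous_on_restrict_sets: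
  fixes f :: "'a::topological_space \<Rightarrow> 'b::topological_space"
  assumes "sets \<mu> = sets (restrict_space borel X)" "continuous_on X f"
  shows "f \<in> borel_measurable \<mu>"
  using borel_measurable_continuous_on_restrict[OF assms(2)] measurable_cong_sets[OF assms(1) refl]
  by blast

lemma integrable_continuous_on_compact:
  fixes f :: "'a::topological_space \<Rightarrow> real"
  assumes "finite_measure \<mu>" and sets: "sets \<mu> = sets (restrict_space borel X)"
    and X: "compact X" and f: "continuous_on X f"
  shows "integrable \<mu> f"
proof -
  interpret finite_measure \<mu> by fact
  have "bounded (f ` X)"
    by (intro compact_imp_bounded compact_continuous_image f X)
  then obtain B where "\<And>x. x \<in> X \<Longrightarrow> norm (f x) \<le> B"
    by (auto simp: bounded_iff)
  moreover have "space \<mu> = X"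
    using sets_eq_imp_space_eq[OF sets] by (simp add: space_restrict_space)
  ultimately show ?thesis
    by (intro integrable_const_bound[of _ B]
        borel_measurable_continuous_on_restrict_sets[OF sets f]) auto
qed

lemma DERIV_diagonal_difference:
  fixes P R :: "real \<Rightarrow> real \<Rightarrow> real"
  assumes I: "convex I" "t \<in> I"
    and der: "\<And>s r. s \<in> I \<Longrightarrow> r \<in> I \<Longrightarrow> ((\<lambda>s. P s r) has_real_derivative R s r) (at s within I)"
    and R: "continuous_on (I \<times> I) (\<lambda>(s, r). R s r)"
  shows "((\<lambda>s. P s s - P t s) has_real_derivative R t t) (at t within I)"
  unfolding has_field_derivative_iff Lim_within
proof (intro allI impI)
  fix e :: real assume "0 < e"
  then obtain d where "0 < d"
    and d: "\<And>z. z \<in> I \<times> I \<Longrightarrow> dist z (t, t) < d \<Longrightarrow> dist (case z of (s, r) \<Rightarrow> R s r) (R t t) < e / 2"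
    using R I(2) unfolding continuous_on_iff by (metis half_gt_zero mem_Sigma_iff case_prod_conv)
  let ?S = "I \<inter> ball t (d / 2)"
  have R_near: "\<bar>R s r - R t t\<bar> \<le> e / 2" if "s \<in> ?S" "r \<in> ?S" for s r
  proof -
    have "dist (s, r) (t, t) \<le> dist s t + dist r t"
      by (simp add: dist_Pair_Pair sqrt_sum_squares_le_sum)
    then show ?thesis
      using d[of "(s, r)"] that by (simp add: dist_real_def abs_minus_commute)
  qed
  have "\<bar>(P s s - P t s - (P t t - P t t)) / (s - t) - R t t\<bar> < e"
    if s: "s \<in> I" "0 < dist s t" "dist s t < d / 2" for s
  proof -
    have "((\<lambda>s'. P s' s - R t t * s') has_real_derivative R s' s - R t t) (at s' within ?S)"
      if "s' \<in> ?S" for s'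
      using that s(1) by (auto intro!: derivative_eq_intros DERIV_subset[OF der])
    then have "norm ((P s s - R t t * s) - (P t s - R t t * t)) \<le> e / 2 * norm (s - t)"
      using s I \<open>0 < d\<close> R_near
      by (intro field_differentiable_bound[of ?S]) (auto simp: convex_Int dist_commute)
    then have "\<bar>P s s - P t s - R t t * (s - t)\<bar> \<le> e / 2 * \<bar>s - t\<bar>"
      by (simp add: algebra_simps)
    moreover have "(P s s - P t s - (P t t - P t t)) / (s - t) - R t t =
        (P s s - P t s - R t t * (s - t)) / (s - t)"
      using s(2) by (simp add: field_simps)
    ultimately have "\<bar>(P s s - P t s - (P t t - P t t)) / (s - t) - R t t\<bar> \<le> e / 2"
      using s(2) by (simp add: abs_divide pos_divide_le_eq)
    then show ?thesis
      using \<open>0 < e\<close> by linarith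
  qed
  then show "\<exists>d>0. \<forall>s\<in>I. 0 < dist s t \<and> dist s t < d \<longrightarrow>
      dist ((P s s - P t s - (P t t - P t t)) / (s - t)) (R t t) < e"
    using \<open>0 < d\<close> by (intro exI[of _ "d / 2"]) (simp add: dist_real_def)
qed

lemma DERIV_integral_diagonal_difference:
  fixes P R :: "real \<Rightarrow> real \<Rightarrow> 'a::topological_space \<Rightarrow> real"
  assumes \<mu>: "finite_measure \<mu>" and sets: "sets \<mu> = sets (restrict_space borel X)"
    and X: "compact X" and I: "compact I" "convex I" "t \<in> I"
    and der: "\<And>s r x. s \<in> I \<Longrightarrow> r \<in> I \<Longrightarrow> x \<in> X \<Longrightarrow>
      ((\<lambda>s. P s r x) has_real_derivative R s r x) (at s within I)"
    and P: "\<And>s r. s \<in> I \<Longrightarrow> r \<in> I \<Longrightarrow> continuous_on X (P s r)"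
    and R: "continuous_on ((I \<times> I) \<times> X) (\<lambda>((s, r), x). R s r x)"
  shows "((\<lambda>s. \<integral>x. P s s x - P t s x \<partial>\<mu>) has_real_derivative (\<integral>x. R t t x \<partial>\<mu>)) (at t within I)"
proof -
  have space: "space \<mu> = X"
    using sets_eq_imp_space_eq[OF sets] by (simp add: space_restrict_space)
  have "bounded ((\<lambda>((s, r), x). R s r x) ` ((I \<times> I) \<times> X))"
    by (intro compact_imp_bounded compact_continuous_image R compact_Times X I)
  then obtain B where B: "\<And>s r x. s \<in> I \<Longrightarrow> r \<in> I \<Longrightarrow> x \<in> X \<Longrightarrow> \<bar>R s r x\<bar> \<le> B"
    unfolding bounded_iff by fastforce
  show ?thesis
  proof (rule DERIV_integral_dominated[OF I(3)])
    show "integrable \<mu> (\<lambda>x. P s s x - P t s x)" if "s \<in> I" for s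
      using that I(3)
      by (intro integrable_continuous_on_compact[OF \<mu> sets X] continuous_on_diff P)
    have "continuous_on X (\<lambda>x. (\<lambda>((s, r), x). R s r x) ((t, t), x))"
      by (rule continuous_on_compose2[OF R])
         (intro continuous_on_Pair continuous_on_const continuous_on_id, use I(3) in auto)
    then show "R t t \<in> borel_measurable \<mu>"
      using borel_measurable_continuous_on_restrict_sets[OF sets] by simp
    show "\<bar>(P s s x - P t s x) - (P t t x - P t t x)\<bar> \<le> B * \<bar>s - t\<bar>" if "s \<in> I" "x \<in> space \<mu>"
      for s x
      using field_differentiable_bound[OF I(2) der B[folded real_norm_def], of s x s t] that I(3)
      by (simp add: space)
    show "integrable \<mu> (\<lambda>x. B)"
      by (rule finite_measure.integrable_const[OF \<mu>])
    show "((\<lambda>s. P s s x - P t s x) has_real_derivative R t t x) (at t within I)"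
      if "x \<in> space \<mu>" for x
    proof (rule DERIV_diagonal_difference[OF I(2,3), where R = "\<lambda>s r. R s r x"])
      have "continuous_on (I \<times> I) (\<lambda>z. (\<lambda>((s, r), x). R s r x) (z, x))"
        by (rule continuous_on_compose2[OF R])
           (intro continuous_on_Pair continuous_on_const continuous_on_id, use that space in auto)
      then show "continuous_on (I \<times> I) (\<lambda>(s, r). R s r x)"
        by (simp add: case_prod_beta)
    qed (use that der space in auto)
  qed
qed

lemma
  fixes w :: "'a::euclidean_space \<Rightarrow> real"
  assumes "integrable lborel w"
  shows integrable_lborel_translate: "integrable lborel (\<lambda>x. w (x + a))"
    and integral_lborel_translate: "(\<integral>x. w (x + a) \<partial>lborel) = (\<integral>x. w x \<partial>lborel)"
proof -
  have "integrable (distr lborel borel ((+) a)) w"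
    using assms by (simp only: lborel_distr_plus)
  then show "integrable lborel (\<lambda>x. w (x + a))"
    by (subst (asm) integrable_distr_eq) (use assms in \<open>auto simp: add.commute\<close>)
  have "(\<integral>x. w x \<partial>distr lborel borel ((+) a)) = (\<integral>x. w (x + a) \<partial>lborel)"
    by (subst integral_distr) (use assms in \<open>auto simp: add.commute\<close>)
  then show "(\<integral>x. w (x + a) \<partial>lborel) = (\<integral>x. w x \<partial>lborel)"
    by (simp only: lborel_distr_plus)
qed

lemma DERIV_along_line:
  assumes "C1_on UNIV w"
  shows "((\<lambda>s. w (x + s *\<^sub>R b)) has_real_derivative frechet_derivative w (at (x + s *\<^sub>R b)) b)
      (at s)"
proof -
  have w: "(w has_derivative frechet_derivative w (at (x + s *\<^sub>R b))) (at (x + s *\<^sub>R b))"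
    by (rule C1_on_has_derivative[OF assms UNIV_I])
  have "((\<lambda>s. w (x + s *\<^sub>R b)) has_derivative
      (\<lambda>h. frechet_derivative w (at (x + s *\<^sub>R b)) (h *\<^sub>R b))) (at s)"
    by (rule has_derivative_compose[where g = w]) (auto intro!: derivative_eq_intros w)
  then show ?thesis
    using linear_scale[OF has_derivative_linear[OF w]]
    by (simp add: has_field_derivative_def mult.commute[of _ "frechet_derivative w _ b"])
qed

lemma C1_compact_support_derivative_bounded:
  fixes w :: "'a::euclidean_space \<Rightarrow> real"
  assumes w: "C1_on UNIV w" and K: "compact K" "\<And>x. x \<notin> K \<Longrightarrow> w x = 0"
  obtains C where "0 \<le> C" "\<And>x. \<bar>frechet_derivative w (at x) b\<bar> \<le> C"
proof -
  let ?w' = "\<lambda>x. frechet_derivative w (at x) b"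
  have "continuous_on K ?w'"
    by (rule continuous_on_subset[OF C1_on_continuous_on_derivative[OF w continuous_on_const]]) simp
  then have "bounded (?w' ` K)"
    by (intro compact_imp_bounded compact_continuous_image K)
  then obtain C where "\<And>x. x \<in> K \<Longrightarrow> \<bar>?w' x\<bar> \<le> C"
    by (auto simp: bounded_iff)
  moreover have "?w' x = 0" if "x \<notin> K" for x
    using frechet_derivative_eq_0_outside[OF open_UNIV compact_imp_closed[OF K(1)], of w x]
      K(2) that
    by simp
  ultimately have "\<bar>?w' x\<bar> \<le> \<bar>C\<bar>" for x
    by (cases "x \<in> K") force+
  then show ?thesis
    by (intro that[of "\<bar>C\<bar>"]) auto
qed

lemma compact_support_translate_eq_0:
  fixes w :: "'a::real_normed_vector \<Rightarrow> real"
  assumes "\<And>x. r < norm x \<Longrightarrow> w x = 0" "r + norm b < norm x" "\<bar>s\<bar> \<le> 1"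
  shows "w (x + s *\<^sub>R b) = 0"
proof -
  have "norm (s *\<^sub>R b) \<le> norm b"
    using assms(3) mult_right_mono[of "\<bar>s\<bar>" 1 "norm b"] by simp
  then have "r < norm (x + s *\<^sub>R b)"
    using assms(2) norm_diff_ineq[of x "s *\<^sub>R b"] by linarith
  then show ?thesis
    by (rule assms(1))
qed

lemma compact_support_translate_diff_le:
  fixes w :: "'a::euclidean_space \<Rightarrow> real"
  assumes w: "C1_on UNIV w" and C: "0 \<le> C" "\<And>x. \<bar>frechet_derivative w (at x) b\<bar> \<le> C"
    and supp: "\<And>x. r < norm x \<Longrightarrow> w x = 0" and s: "\<bar>s\<bar> \<le> 1"
  shows "\<bar>w (x + s *\<^sub>R b) - w x\<bar> \<le> C * indicator (cball 0 (r + norm b)) x * \<bar>s\<bar>"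
proof (cases "x \<in> cball 0 (r + norm b)")
  case True
  have "norm (w (x + s *\<^sub>R b) - w (x + 0 *\<^sub>R b)) \<le> C * norm (s - 0)"
    by (rule field_differentiable_bound[OF convex_UNIV DERIV_along_line[OF w]]) (use C in auto)
  then show ?thesis
    using True by simp
next
  case False
  have "w (x + s' *\<^sub>R b) = 0" if "\<bar>s'\<bar> \<le> 1" for s'
    by (rule compact_support_translate_eq_0[where w = w and r = r and b = b, OF supp])
       (use that False in auto)
  from this[OF s] this[of 0] show ?thesis
    using C(1) by simp
qed

text \<open>By translation invariance the integral of \<open>w\<close> does not change along the direction \<open>b\<close>.\<close>

lemma integral_directional_derivative_eq_0:
  fixes w :: "'a::euclidean_space \<Rightarrow> real"
  assumes w: "C1_on UNIV w" and K: "compact K" "\<And>x. x \<notin> K \<Longrightarrow> w x = 0"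
  shows "(\<integral>x. frechet_derivative w (at x) b \<partial>lborel) = 0"
proof -
  let ?w' = "\<lambda>x. frechet_derivative w (at x) b" and ?I = "{-1<..<1::real}"
  have w_int: "integrable lborel w"
    using set_integrable_compact_support[OF K(1) subset_UNIV C1_on_imp_continuous_on[OF w]] K(2)
    by (simp add: set_integrable_def)
  obtain C where C: "0 \<le> C" "\<And>x. \<bar>?w' x\<bar> \<le> C"
    using C1_compact_support_derivative_bounded[OF w K] by blast
  obtain r where "\<And>x. x \<in> K \<Longrightarrow> norm x \<le> r"
    using K(1) compact_imp_bounded bounded_iff by metis
  then have outside: "w x = 0" if "r < norm x" for x
    using K(2) that by (meson not_less)
  let ?B = "cball 0 (r + norm b)"
  have "((\<lambda>s. \<integral>x. w (x + s *\<^sub>R b) \<partial>lborel) has_real_derivative (\<integral>x. ?w' x \<partial>lborel))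
      (at 0 within ?I)"
  proof (rule DERIV_integral_dominated)
    show "\<bar>w (x + s *\<^sub>R b) - w (x + 0 *\<^sub>R b)\<bar> \<le> C * indicator ?B x * \<bar>s - 0\<bar>" if "s \<in> ?I" for s x
      using compact_support_translate_diff_le[where s = s and x = x, OF w C outside] that
      by (simp add: abs_le_iff)
    show "integrable lborel (\<lambda>x. C * indicator ?B x)"
      using emeasure_bounded_finite[OF bounded_cball]
      by (intro integrable_mult_right integrable_real_indicator) auto
    show "((\<lambda>s. w (x + s *\<^sub>R b)) has_real_derivative ?w' x) (at 0 within ?I)" for x
      using has_field_derivative_at_within[OF DERIV_along_line[OF w, of x b 0]] by simp
    show "?w' \<in> borel_measurable lborel"
      using C1_on_continuous_on_derivative[OF w continuous_on_const]
      by (simp add: borel_measurable_continuous_onI)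
  qed (use integrable_lborel_translate[OF w_int] in auto)
  then have "((\<lambda>s. \<integral>x. w x \<partial>lborel) has_real_derivative (\<integral>x. ?w' x \<partial>lborel)) (at 0)"
    by (simp add: integral_lborel_translate[OF w_int] at_within_open[of 0 ?I])
  then show ?thesis
    by (rule DERIV_unique) (rule DERIV_const)
qed

lemma frechet_derivative_mult_eq:
  fixes f g :: "'a::euclidean_space \<Rightarrow> real"
  assumes "C1_on V f" "C1_on V g" "x \<in> V"
  shows "frechet_derivative (\<lambda>x. f x * g x) (at x) b =
    f x * frechet_derivative g (at x) b + frechet_derivative f (at x) b * g x"
  by (subst frechet_derivative_at[OF has_derivative_mult[OF
        C1_on_has_derivative[OF assms(1,3)] C1_on_has_derivative[OF assms(2,3)]], symmetric]) simp

lemma integration_by_parts_compact_support: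
  fixes f q :: "'a::euclidean_space \<Rightarrow> real"
  assumes V: "open V" and K: "compact K" "K \<subseteq> V" and f: "C1_on V f" and q: "C1_on V q"
    and supp: "\<And>x. x \<in> V - K \<Longrightarrow> f x = 0"
  shows "set_integrable lborel V (\<lambda>x. frechet_derivative f (at x) b * q x)" (is ?int_f')
    and "set_integrable lborel V (\<lambda>x. f x * frechet_derivative q (at x) b)" (is ?int_q')
    and "(LINT x:V|lborel. f x * frechet_derivative q (at x) b) =
      - (LINT x:V|lborel. frechet_derivative f (at x) b * q x)"
proof -
  let ?f' = "\<lambda>x. frechet_derivative f (at x) b" and ?q' = "\<lambda>x. frechet_derivative q (at x) b"
  have f'_supp: "?f' x = 0" if "x \<in> V - K" for x
    using frechet_derivative_eq_0_outside[OF V compact_imp_closed[OF K(1)] supp that] by simp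
  note cont = C1_on_imp_continuous_on[OF f] C1_on_imp_continuous_on[OF q]
    C1_on_continuous_on_derivative[OF f continuous_on_const]
    C1_on_continuous_on_derivative[OF q continuous_on_const]
  show ?int_f'
    using f'_supp by (intro set_integrable_compact_support[OF K] continuous_on_mult cont) auto
  moreover show ?int_q'
    using supp by (intro set_integrable_compact_support[OF K] continuous_on_mult cont) auto
  moreover define w where "w x = (if x \<in> V then f x * q x else 0)" for x
  have w: "C1_on UNIV w"
    unfolding w_def using supp by (intro C1_on_extend_zero[OF V K] C1_on_mult f q) auto
  have w_supp: "w x = 0" if "x \<notin> K" for x
    using that supp by (auto simp: w_def)
  have "frechet_derivative w (at x) b = indicator V x *\<^sub>R (f x * ?q' x + ?f' x * q x)" for x
  proof (cases "x \<in> V")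
    case True
    have "frechet_derivative w (at x) b = frechet_derivative (\<lambda>x. f x * q x) (at x) b"
      using frechet_derivative_cong_open[OF V True, of w "\<lambda>x. f x * q x"] by (simp add: w_def)
    then show ?thesis
      using True by (simp add: frechet_derivative_mult_eq[OF f q])
  next
    case False
    then have "frechet_derivative w (at x) = (\<lambda>_. 0)"
      using frechet_derivative_eq_0_outside[OF open_UNIV compact_imp_closed[OF K(1)], of w x]
        w_supp K(2)
      by auto
    then show ?thesis
      using False by simp
  qed
  then have "(LINT x:V|lborel. f x * ?q' x + ?f' x * q x) = 0"
    using integral_directional_derivative_eq_0[OF w K(1) w_supp, of b]
    by (simp add: set_lebesgue_integral_def)
  ultimately show "(LINT x:V|lborel. f x * ?q' x) = - (LINT x:V|lborel. ?f' x * q x)"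
    by (simp add: set_integral_add)
qed

lemma integral_divergence_compact_support:
  fixes f :: "'a::euclidean_space \<Rightarrow> real" and q :: "'i \<Rightarrow> 'a \<Rightarrow> real"
  assumes V: "open V" and K: "compact K" "K \<subseteq> V" and f: "C1_on V f"
    and q: "\<And>i. i \<in> I \<Longrightarrow> C1_on V (q i)" and supp: "\<And>x. x \<in> V - K \<Longrightarrow> f x = 0"
  shows "(LINT x:V|lborel. f x * (\<Sum>i\<in>I. frechet_derivative (q i) (at x) (b i))) =
    - (LINT x:V|lborel. \<Sum>i\<in>I. frechet_derivative f (at x) (b i) * q i x)"
proof -
  note parts = integration_by_parts_compact_support[OF V K f q supp]
  have "(LINT x:V|lborel. f x * (\<Sum>i\<in>I. frechet_derivative (q i) (at x) (b i))) =
      (\<Sum>i\<in>I. LINT x:V|lborel. f x * frechet_derivative (q i) (at x) (b i))"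
    using parts(2) by (simp add: set_lebesgue_integral_def set_integrable_def sum_distrib_left)
  also have "\<dots> = - (\<Sum>i\<in>I. LINT x:V|lborel. frechet_derivative f (at x) (b i) * q i x)"
    unfolding sum_negf[symmetric] by (intro sum.cong refl parts(3))
  also have "(\<Sum>i\<in>I. LINT x:V|lborel. frechet_derivative f (at x) (b i) * q i x) =
      (LINT x:V|lborel. \<Sum>i\<in>I. frechet_derivative f (at x) (b i) * q i x)"
    using parts(1) by (simp add: set_lebesgue_integral_def set_integrable_def sum_distrib_left)
  finally show ?thesis .
qed

lemma nonpos_if_integral_bump_eq_0:
  fixes f :: "'a::euclidean_space \<Rightarrow> real"
  assumes U: "open U" "x \<in> U" and f: "continuous_on U f"
    and int0: "\<And>r. 0 < r \<Longrightarrow> cball x r \<subseteq> U \<Longrightarrow> (\<integral>y. bump x r y * f y \<partial>lborel) = 0"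
  shows "f x \<le> 0"
proof (rule ccontr)
  assume pos: "\<not> f x \<le> 0"
  then have "x \<in> U \<inter> f -` {0<..}"
    using U by simp
  moreover have "open (U \<inter> f -` {0<..})"
    by (rule continuous_open_preimage[OF f U(1) open_greaterThan])
  ultimately obtain r where r: "0 < r" "cball x r \<subseteq> U \<inter> f -` {0<..}"
    unfolding open_contains_cball by blast
  let ?F = "\<lambda>y. bump x r y * f y"
  have cont: "continuous_on (cball x r) ?F"
    using r(2) by (intro continuous_on_mult C1_on_imp_continuous_on[OF C1_on_bump]
        continuous_on_subset[OF f]) auto
  have "indicator (cball x r) y *\<^sub>R ?F y = ?F y" for y
    using bump_eq_0[OF r(1), of y x] by (cases "y \<in> cball x r") auto
  then have "(LINT y:cball x r|lborel. ?F y) = (\<integral>y. ?F y \<partial>lborel)"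
    by (simp only: set_lebesgue_integral_def)
  then have "(LINT y:cball x r|lborel. ?F y) = 0"
    using int0[OF r(1)] r(2) by simp
  moreover have "set_integrable lborel (cball x r) ?F"
    by (rule set_integrable_compact_support[OF compact_cball subset_refl cont]) auto
  ultimately have "(?F has_integral 0) (cball x r)"
    using set_borel_integral_eq_integral[of "cball x r" ?F] by (simp add: has_integral_iff)
  moreover have "emeasure lborel (cball x r) = emeasure lborel (ball x r)"
    "0 < emeasure lborel (ball x r)" "emeasure lborel (ball x r) < \<infinity>"
    using content_cball_conv_ball[of x r] content_ball_pos[OF r(1), of x]
      emeasure_bounded_finite[OF bounded_ball, of x r]
          emeasure_bounded_finite[OF bounded_cball, of x r]
    by (simp_all add: emeasure_eq_ennreal_measure less_top)
  moreover have "0 \<le> ?F y" if "y \<in> ball x r" for y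
  proof -
    have "0 < f y"
      using that r(2) ball_subset_cball[of x r] by blast
    then show ?thesis
      by (intro mult_nonneg_nonneg bump_nonneg) simp
  qed
  ultimately have "?F x = 0"
    using r(1) cont
    by (intro has_integral_0_closure_imp_0[of "ball x r" ?F x]) (auto simp: closure_ball)
  then show False
    using pos r(1) bump_pos_iff[OF r(1), of x x] by simp
qed

lemma eq_0_if_integral_bump_eq_0:
  fixes f :: "'a::euclidean_space \<Rightarrow> real"
  assumes "open U" "x \<in> U" "continuous_on U f"
    and "\<And>r. 0 < r \<Longrightarrow> cball x r \<subseteq> U \<Longrightarrow> (\<integral>y. bump x r y * f y \<partial>lborel) = 0"
  shows "f x = 0"
proof (rule antisym)
  show "f x \<le> 0"
    by (rule nonpos_if_integral_bump_eq_0[OF assms])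
  have "- f x \<le> 0"
    by (rule nonpos_if_integral_bump_eq_0[of U x "\<lambda>x. - f x"])
       (use assms in \<open>auto intro: continuous_on_minus\<close>)
  then show "0 \<le> f x" by simp
qed

lemma emeasure_eq_on_finite_cover:
  assumes "finite F" and sets: "sets \<nu> = sets \<mu>" "\<And>c. c \<in> F \<Longrightarrow> C c \<in> sets \<mu>"
    and "\<And>c E. c \<in> F \<Longrightarrow> E \<in> sets \<mu> \<Longrightarrow> E \<subseteq> C c \<Longrightarrow> emeasure \<mu> E = emeasure \<nu> E"
    and "E \<in> sets \<mu>" "E \<subseteq> (\<Union>c\<in>F. C c)"
  shows "emeasure \<mu> E = emeasure \<nu> E"
  using assms
proof (induction F arbitrary: E)
  case (insert c F)
  have split: "emeasure \<rho> E = emeasure \<rho> (E \<inter> C c) + emeasure \<rho> (E - C c)" if "sets \<rho> = sets \<mu>"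
    for \<rho>
    using that insert.prems by (subst plus_emeasure) (auto intro: arg_cong[where f = "emeasure \<rho>"])
  have "emeasure \<mu> (E - C c) = emeasure \<nu> (E - C c)"
    by (rule insert.IH[OF _ _ insert.prems(3)]) (use insert.prems(1,2,4,5) in auto)
  moreover have "emeasure \<mu> (E \<inter> C c) = emeasure \<nu> (E \<inter> C c)"
    by (rule insert.prems(3)[of c]) (use insert.prems in auto)
  ultimately show ?case
    using split[of \<mu>] split[of \<nu>] insert.prems(1) by simp
qed simp

lemma ex_measure_glue_two:
  assumes "sets \<mu> = sets N" "sets \<nu> = sets N" "C \<in> sets N"
  shows "\<exists>\<rho>. sets \<rho> = sets N \<and>
    (\<forall>E\<in>sets N. emeasure \<rho> E = emeasure \<mu> (E - C) + emeasure \<nu> (E \<inter> C))"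
proof -
  define v where "v E = emeasure \<mu> (E - C) + emeasure \<nu> (E \<inter> C)" for E
  define \<rho> where "\<rho> = measure_of (space N) (sets N) v"
  have "countably_additive (sets N) v"
    unfolding countably_additive_def
  proof (intro allI impI)
    fix E :: "nat \<Rightarrow> 'a set"
    assume E: "range E \<subseteq> sets N" "disjoint_family E"
    have "(\<Sum>i. emeasure \<mu> (E i - C)) = emeasure \<mu> (\<Union>i. E i - C)"
      using E assms by (intro suminf_emeasure) (auto simp: disjoint_family_on_def)
    moreover have "(\<Sum>i. emeasure \<nu> (E i \<inter> C)) = emeasure \<nu> (\<Union>i. E i \<inter> C)"
      using E assms by (intro suminf_emeasure) (auto simp: disjoint_family_on_def)
    moreover have "(\<Union>i. E i - C) = \<Union>(range E) - C" "(\<Union>i. E i \<inter> C) = \<Union>(range E) \<inter> C"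
      by auto
    ultimately show "(\<Sum>i. v (E i)) = v (\<Union>(range E))"
      by (simp add: v_def suminf_add[symmetric])
  qed
  moreover have "positive (sets N) v"
    by (simp add: positive_def v_def)
  ultimately have "emeasure \<rho> E = v E" if "E \<in> sets N" for E
    unfolding \<rho>_def using that by (intro emeasure_measure_of_sigma sets.sigma_algebra_axioms)
  then show ?thesis
    by (intro exI[of _ \<rho>]) (simp add: \<rho>_def v_def)
qed

lemma ex_measure_glue:
  assumes "finite F" and sets: "\<And>c. c \<in> F \<Longrightarrow> sets (\<nu> c) = sets N" "\<And>c. c \<in> F \<Longrightarrow> C c \<in> sets N"
    and "\<And>c d E. c \<in> F \<Longrightarrow> d \<in> F \<Longrightarrow> E \<in> sets N \<Longrightarrow> E \<subseteq> C c \<inter> C d \<Longrightarrow>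
      emeasure (\<nu> c) E = emeasure (\<nu> d) E"
  shows "\<exists>\<mu>. sets \<mu> = sets N \<and> (\<forall>c\<in>F. \<forall>E\<in>sets N. E \<subseteq> C c \<longrightarrow> emeasure \<mu> E = emeasure (\<nu> c) E)"
  using assms
proof (induction F)
  case empty
  then show ?case by auto
next
  case (insert c F)
  then obtain \<mu> where \<mu>: "sets \<mu> = sets N"
    "\<And>d E. d \<in> F \<Longrightarrow> E \<in> sets N \<Longrightarrow> E \<subseteq> C d \<Longrightarrow> emeasure \<mu> E = emeasure (\<nu> d) E"
    by (metis insert_iff)
  have c: "sets (\<nu> c) = sets N" "C c \<in> sets N"
    using insert.prems by auto
  obtain \<rho> where \<rho>: "sets \<rho> = sets N"
    "\<And>E. E \<in> sets N \<Longrightarrow> emeasure \<rho> E = emeasure \<mu> (E - C c) + emeasure (\<nu> c) (E \<inter> C c)"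
    using ex_measure_glue_two[OF \<mu>(1) c] by blast
  have "emeasure \<rho> E = emeasure (\<nu> d) E" if d: "d \<in> insert c F" and E: "E \<in> sets N" "E \<subseteq> C d"
    for d E
  proof (cases "d = c")
    case True
    then have "E - C c = {}" "E \<inter> C c = E"
      using E by auto
    from \<rho>(2)[OF E(1), unfolded this] show ?thesis
      using True by simp
  next
    case False
    have "emeasure \<mu> (E - C c) = emeasure (\<nu> d) (E - C c)"
      by (rule \<mu>(2)) (use False d E c in auto)
    moreover have "emeasure (\<nu> c) (E \<inter> C c) = emeasure (\<nu> d) (E \<inter> C c)"
      by (rule insert.prems(3)) (use d E c in auto)
    moreover have "emeasure (\<nu> d) (E - C c) + emeasure (\<nu> d) (E \<inter> C c) = emeasure (\<nu> d) E"
      using insert.prems(1)[OF d] E(1) c(2)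
      by (subst plus_emeasure) (auto intro: arg_cong[where f = "emeasure (\<nu> d)"])
    ultimately show ?thesis
      using \<rho>(2)[OF E(1)] by simp
  qed
  then show ?case
    using \<rho>(1) by blast
qed

subsection \<open>Charts and differentiable functions on a closed manifold\<close>

lemma continuous_on_Times_snd: "continuous_on S f \<Longrightarrow> continuous_on (Z \<times> S) (\<lambda>(z, x). f x)"
  unfolding case_prod_beta by (rule continuous_on_compose2[OF _ continuous_on_snd]) auto

lemma continuous_on_Times_slice:
  assumes "continuous_on (Z \<times> S) (\<lambda>(z, x). f z x)" "z \<in> Z"
  shows "continuous_on S (f z)"
proof -
  have "continuous_on S (\<lambda>x. (\<lambda>(z, x). f z x) (z, x))"
    by (rule continuous_on_compose2[OF assms(1)])
       (intro continuous_on_Pair continuous_on_const continuous_on_id, use assms(2) in auto)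
  then show ?thesis by simp
qed

locale manifold =
  fixes M :: "'m::t2_space set" and A :: "('m, 'n::finite) chart set"
  assumes closed_manifold: "closed_manifold M A"
begin

lemma compact_M: "compact M"
  using closed_manifold by (simp add: closed_manifold_def)

lemma closed_M: "closed M"
  using compact_M by (rule compact_imp_closed)

lemma chart_on_M: "c \<in> A \<Longrightarrow> chart_on M c"
  using closed_manifold by (simp add: closed_manifold_def smooth_atlas_def)

lemma openin_cdom: "c \<in> A \<Longrightarrow> openin (top_of_set M) (cdom c)"
  using chart_on_M by (simp add: chart_on_def)

lemma open_cimg: "c \<in> A \<Longrightarrow> open (cimg c)"
  using chart_on_M by (simp add: chart_on_def)

lemma homeomorphism_chart: "c \<in> A \<Longrightarrow> homeomorphism (cdom c) (cimg c) (cmap c) (cinv c)"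
  using chart_on_M by (simp add: chart_on_def)

lemma cdom_subset_M: "c \<in> A \<Longrightarrow> cdom c \<subseteq> M"
  using openin_cdom openin_imp_subset by blast

lemma in_cdom_imp_in_M: "c \<in> A \<Longrightarrow> p \<in> cdom c \<Longrightarrow> p \<in> M"
  using cdom_subset_M by blast

lemma cdom_eq_open_Int:
  assumes "c \<in> A"
  obtains W where "open W" "cdom c = M \<inter> W"
  using openin_cdom[OF assms] by (auto simp: openin_open)

lemma charts_cover: "(\<Union>c\<in>A. cdom c) = M"
  using closed_manifold by (simp add: closed_manifold_def smooth_atlas_def)

lemma chart_at_in:
  assumes "p \<in> M"
  shows chart_at_in_atlas: "chart_at A p \<in> A" and "p \<in> cdom (chart_at A p)"
proof -
  have "\<exists>c. c \<in> A \<and> p \<in> cdom c"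
    using assms charts_cover by blast
  then have "chart_at A p \<in> A \<and> p \<in> cdom (chart_at A p)"
    unfolding chart_at_def by (rule someI_ex)
  then show "chart_at A p \<in> A" "p \<in> cdom (chart_at A p)" by auto
qed

lemma cinv_cmap [simp]: "c \<in> A \<Longrightarrow> p \<in> cdom c \<Longrightarrow> cinv c (cmap c p) = p"
  by (rule homeomorphism_apply1[OF homeomorphism_chart])

lemma cmap_cinv [simp]: "c \<in> A \<Longrightarrow> x \<in> cimg c \<Longrightarrow> cmap c (cinv c x) = x"
  by (rule homeomorphism_apply2[OF homeomorphism_chart])

lemma cinv_in_cdom [simp]: "c \<in> A \<Longrightarrow> x \<in> cimg c \<Longrightarrow> cinv c x \<in> cdom c"
  using homeomorphism_image2[OF homeomorphism_chart] by blast

lemma cinv_in_M [simp]: "c \<in> A \<Longrightarrow> x \<in> cimg c \<Longrightarrow> cinv c x \<in> M"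
  by (rule in_cdom_imp_in_M[OF _ cinv_in_cdom])

lemma cmap_in_cimg [simp]: "p \<in> cdom c \<Longrightarrow> cmap c p \<in> cimg c"
  by (simp add: cimg_def)

lemma continuous_on_cinv: "c \<in> A \<Longrightarrow> continuous_on (cimg c) (cinv c)"
  using homeomorphism_chart homeomorphism_cont2 by blast

lemma continuous_on_cmap: "c \<in> A \<Longrightarrow> continuous_on (cdom c) (cmap c)"
  using homeomorphism_chart homeomorphism_cont1 by blast

lemma cmap_image_eq:
  assumes "c \<in> A" "E \<subseteq> cdom c"
  shows "cmap c ` E = cinv c -` E \<inter> cimg c"
proof (intro subset_antisym subsetI)
  fix x assume "x \<in> cinv c -` E \<inter> cimg c"
  then have "x = cmap c (cinv c x)" "cinv c x \<in> E"
    using assms(1) by simp_all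
  then show "x \<in> cmap c ` E" by (rule image_eqI)
qed (use assms in \<open>auto simp: subset_iff\<close>)

lemma cinv_image_eq:
  assumes "c \<in> A" "U \<subseteq> cimg c"
  shows "cinv c ` U = cmap c -` U \<inter> cdom c"
proof (intro subset_antisym subsetI)
  fix p assume "p \<in> cmap c -` U \<inter> cdom c"
  then have "p = cinv c (cmap c p)" "cmap c p \<in> U"
    using assms(1) by simp_all
  then show "p \<in> cinv c ` U" by (rule image_eqI)
qed (use assms in \<open>auto simp: subset_iff\<close>)

lemma inj_on_cmap: "c \<in> A \<Longrightarrow> E \<subseteq> cdom c \<Longrightarrow> inj_on (cmap c) E"
  by (intro inj_on_inverseI[where g = "cinv c"] cinv_cmap) auto

lemma compact_cinv_image: "c \<in> A \<Longrightarrow> compact K \<Longrightarrow> K \<subseteq> cimg c \<Longrightarrow> compact (cinv c ` K)"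
  using continuous_on_subset[OF continuous_on_cinv] by (intro compact_continuous_image)

lemma open_vimage_cinv:
  assumes "c \<in> A" "open W"
  shows "open (cinv c -` W \<inter> cimg c)"
  using continuous_on_open_vimage[OF open_cimg[OF assms(1)], of "cinv c"] continuous_on_cinv assms
  by blast

lemma overlap_eq:
  assumes "c \<in> A"
  shows "cmap c ` (cdom c \<inter> cdom d) = cinv c -` cdom d \<inter> cimg c"
  using cmap_image_eq[OF assms, of "cdom c \<inter> cdom d"] assms by auto

lemma open_overlap:
  assumes "c \<in> A" "d \<in> A"
  shows "open (cmap c ` (cdom c \<inter> cdom d))"
proof -
  obtain W where W: "open W" "cdom d = M \<inter> W"
    by (rule cdom_eq_open_Int[OF assms(2)])
  have "cinv c -` cdom d \<inter> cimg c = cinv c -` W \<inter> cimg c"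
    using W(2) assms(1) by auto
  then show ?thesis
    using open_vimage_cinv[OF assms(1) W(1)] by (simp add: overlap_eq assms(1))
qed

lemma C1_on_transition:
  assumes "c \<in> A" "d \<in> A"
  shows "C1_on (cmap c ` (cdom c \<inter> cdom d)) (cmap d \<circ> cinv c)"
  using open_overlap[OF assms] closed_manifold assms
  by (intro smooth_on_imp_C1_on) (auto simp: closed_manifold_def smooth_atlas_def)

lemma transition_has_derivative:
  assumes "c \<in> A" "d \<in> A" "p \<in> cdom c" "p \<in> cdom d"
  shows "(cmap c \<circ> cinv d has_derivative (*v) (transition_jacobian c d p)) (at (cmap d p))"
proof -
  have "(cmap c \<circ> cinv d has_derivative frechet_derivative (cmap c \<circ> cinv d) (at (cmap d p)))
      (at (cmap d p))"
    using assms by (intro C1_on_has_derivative[OF C1_on_transition]) auto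
  then show ?thesis
    by (metis transition_jacobian_def matrix_vector_mul has_derivative_linear)
qed

lemma continuous_on_Times_M:
  fixes f :: "'z::t2_space \<Rightarrow> 'm \<Rightarrow> 'b::topological_space"
  assumes "\<And>c. c \<in> A \<Longrightarrow> continuous_on (Z \<times> cimg c) (\<lambda>(z, x). f z (cinv c x))"
  shows "continuous_on (Z \<times> M) (\<lambda>(z, p). f z p)"
  unfolding continuous_on_eq_continuous_within
proof
  fix q assume q: "q \<in> Z \<times> M"
  define c where "c = chart_at A (snd q)"
  have c: "c \<in> A" "snd q \<in> cdom c"
    using q chart_at_in by (auto simp: c_def)
  obtain W where W: "open W" "cdom c = M \<inter> W"
    by (rule cdom_eq_open_Int[OF c(1)])
  have "continuous_on (Z \<times> cdom c) (\<lambda>w. (\<lambda>(z, x). f z (cinv c x)) (fst w, cmap c (snd w)))"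
    using c(1) by (intro continuous_on_compose2[OF assms] continuous_intros
        continuous_on_compose2[OF continuous_on_cmap]) auto
  then have "continuous_on (Z \<times> cdom c) (\<lambda>(z, p). f z p)"
    by (rule continuous_on_eq) (use c(1) in auto)
  moreover have q': "q \<in> Z \<times> cdom c"
    using q c(2) by (simp add: mem_Times_iff)
  ultimately have "continuous (at q within Z \<times> cdom c) (\<lambda>(z, p). f z p)"
    by (simp only: continuous_on_eq_continuous_within)
  moreover have "at q within Z \<times> cdom c = at q within Z \<times> M"
    by (rule at_within_nhd[of q "UNIV \<times> W"]) (use W q' in \<open>auto simp: open_Times\<close>)
  ultimately show "continuous (at q within Z \<times> M) (\<lambda>(z, p). f z p)" by simp
qed

lemma continuous_on_M:
  fixes f :: "'m \<Rightarrow> 'b::topological_space"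
  assumes "\<And>c. c \<in> A \<Longrightarrow> continuous_on (cimg c) (\<lambda>x. f (cinv c x))"
  shows "continuous_on M f"
  using continuous_on_Times_slice[OF continuous_on_Times_M[of "{0::real}" "\<lambda>_. f"], of 0] assms
  by (simp add: continuous_on_Times_snd)

definition C1_fun :: "('m \<Rightarrow> real) \<Rightarrow> bool" where
  "C1_fun u \<longleftrightarrow> (\<forall>c\<in>A. C1_on (cimg c) (\<lambda>x. u (cinv c x)))"

lemma smooth_fun_imp_C1_fun: "smooth_fun A u \<Longrightarrow> C1_fun u"
  using open_cimg smooth_on_imp_C1_on(1) unfolding smooth_fun_def C1_fun_def o_def by blast

lemma C1_fun_continuous_on: "C1_fun u \<Longrightarrow> continuous_on M u"
  by (rule continuous_on_M) (simp add: C1_fun_def C1_on_imp_continuous_on)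

lemma C1_fun_mult: "C1_fun u \<Longrightarrow> C1_fun v \<Longrightarrow> C1_fun (\<lambda>p. u p * v p)"
  by (simp add: C1_fun_def C1_on_mult)

lemma C1_fun_sum: "(\<And>k. k \<in> I \<Longrightarrow> C1_fun (u k)) \<Longrightarrow> C1_fun (\<lambda>p. \<Sum>k\<in>I. u k p)"
  by (simp add: C1_fun_def C1_on_sum)

lemma C1_fun_divide: "C1_fun u \<Longrightarrow> C1_fun v \<Longrightarrow> (\<And>p. p \<in> M \<Longrightarrow> v p \<noteq> 0) \<Longrightarrow> C1_fun (\<lambda>p. u p / v p)"
  by (simp add: C1_fun_def C1_on_divide)

definition differential :: "('m \<Rightarrow> real) \<Rightarrow> ('m, 'n) chart \<Rightarrow> 'm \<Rightarrow> real^'n" where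
  "differential u c p = (\<chi> i. partial c i u p)"

lemma differential_cinv_nth:
  "c \<in> A \<Longrightarrow> x \<in> cimg c \<Longrightarrow>
     differential u c (cinv c x) $ i = frechet_derivative (\<lambda>x. u (cinv c x)) (at x) (axis i 1)"
  by (simp add: differential_def partial_def o_def)

lemma frechet_derivative_eq_inner_differential:
  assumes "C1_fun u" "c \<in> A" "x \<in> cimg c"
  shows "frechet_derivative (\<lambda>x. u (cinv c x)) (at x) v = differential u c (cinv c x) \<bullet> v"
proof -
  let ?D = "frechet_derivative (\<lambda>x. u (cinv c x)) (at x)"
  have "linear ?D"
    using assms by (intro linear_frechet_derivative) (auto simp: C1_fun_def C1_on_iff)
  have "?D v = ?D (\<Sum>i\<in>UNIV. v $ i *\<^sub>R axis i 1)"
    using basis_expansion[of v] by (simp add: scalar_mult_eq_scaleR)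
  also have "\<dots> = (\<Sum>i\<in>UNIV. v $ i * ?D (axis i 1))"
    by (simp add: linear_sum[OF \<open>linear ?D\<close>] linear_scale[OF \<open>linear ?D\<close>])
  finally show ?thesis
    using assms by (simp add: differential_cinv_nth inner_vec_def mult.commute)
qed

lemma differential_transform:
  assumes u: "C1_fun u" and c: "c \<in> A" "p \<in> cdom c" and d: "d \<in> A" "p \<in> cdom d"
  shows "differential u d p = transpose (transition_jacobian c d p) *v differential u c p"
proof -
  let ?J = "transition_jacobian c d p" and ?u = "\<lambda>x. u (cinv c x)"
  have "(?u has_derivative frechet_derivative ?u (at (cmap c p))) (at (cmap c p))"
    using u c by (intro C1_on_has_derivative) (auto simp: C1_fun_def)
  then have "(?u \<circ> (cmap c \<circ> cinv d) has_derivative frechet_derivative ?u (at (cmap c p)) \<circ> (*v) ?J)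
      (at (cmap d p))"
    using transition_has_derivative[OF c(1) d(1) c(2) d(2)] d by (intro diff_chain_at) simp_all
  then have "frechet_derivative (?u \<circ> (cmap c \<circ> cinv d)) (at (cmap d p)) =
      frechet_derivative ?u (at (cmap c p)) \<circ> (*v) ?J"
    by (rule frechet_derivative_at[symmetric])
  moreover have "frechet_derivative (u \<circ> cinv d) (at (cmap d p)) =
      frechet_derivative (?u \<circ> (cmap c \<circ> cinv d)) (at (cmap d p))"
    by (rule frechet_derivative_cong_open[OF open_overlap[OF d(1) c(1)]]) (use c d in auto)
  ultimately have "partial d i u p = differential u c p \<bullet> (?J *v axis i 1)" for i
    using frechet_derivative_eq_inner_differential[OF u c(1), of "cmap c p"] c
    by (simp add: partial_def)
  moreover have "(transpose ?J *v differential u c p) $ i = differential u c p \<bullet> (?J *v axis i 1)"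
    for i
    by (metis cart_eq_inner_axis inner_commute inner_transpose_mult)
  ultimately show ?thesis
    by (simp add: vec_eq_iff differential_def[of u d])
qed

lemma continuous_on_differential:
  assumes "C1_fun u" "c \<in> A"
  shows "continuous_on (cimg c) (\<lambda>x. differential u c (cinv c x))"
proof -
  have "continuous_on (cimg c) (\<lambda>x. \<chi> i. frechet_derivative (\<lambda>x. u (cinv c x)) (at x) (axis i 1))"
    using assms by (intro continuous_intros C1_on_continuous_on_derivative) (auto simp: C1_fun_def)
  then show ?thesis
    by (rule continuous_on_eq) (simp add: vec_eq_iff differential_cinv_nth assms(2))
qed

lemma C1_on_differential:
  assumes "smooth_fun A u" "c \<in> A"
  shows "C1_on (cimg c) (\<lambda>x. differential u c (cinv c x) $ i)"
proof (rule C1_on_cong_open[OF open_cimg[OF assms(2)]])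
  have "smooth_on (cimg c) (\<lambda>x. u (cinv c x))"
    using assms by (simp add: smooth_fun_def o_def)
  then show "C1_on (cimg c) (\<lambda>x. frechet_derivative (\<lambda>x. u (cinv c x)) (at x) (axis i 1))"
    by (rule smooth_on_imp_C1_on(2)[OF open_cimg[OF assms(2)]]) (simp add: axis_in_Basis_iff)
qed (simp add: differential_cinv_nth assms(2))

lemma differential_cong:
  assumes "\<And>q. q \<in> M \<Longrightarrow> u q = v q" "c \<in> A" "p \<in> cdom c"
  shows "differential u c p = differential v c p"
proof -
  have "frechet_derivative (u \<circ> cinv c) (at (cmap c p)) =
      frechet_derivative (v \<circ> cinv c) (at (cmap c p))"
    by (rule frechet_derivative_cong_open[OF open_cimg[OF assms(2)]])
       (use assms in auto)
  then show ?thesis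
    by (simp add: differential_def partial_def)
qed

lemma differential_sum:
  assumes "\<And>k. k \<in> I \<Longrightarrow> C1_fun (u k)" "c \<in> A" "p \<in> cdom c"
  shows "differential (\<lambda>q. \<Sum>k\<in>I. u k q) c p = (\<Sum>k\<in>I. differential (u k) c p)"
proof -
  have "((\<lambda>x. \<Sum>k\<in>I. u k (cinv c x)) has_derivative
      (\<lambda>h. \<Sum>k\<in>I. frechet_derivative (\<lambda>x. u k (cinv c x)) (at (cmap c p)) h)) (at (cmap c p))"
    using assms by (intro has_derivative_sum C1_on_has_derivative) (auto simp: C1_fun_def)
  from frechet_derivative_at[OF this, symmetric] show ?thesis
    by (simp add: vec_eq_iff differential_def partial_def o_def)
qed

definition supported_in_chart :: "('m, 'n) chart \<Rightarrow> ('m \<Rightarrow> real) \<Rightarrow> bool" where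
  "supported_in_chart c u \<longleftrightarrow>
     (\<exists>K. compact K \<and> K \<subseteq> cimg c \<and> (\<forall>p\<in>M - cinv c ` K. u p = 0))"

lemma supported_in_chartE:
  assumes "supported_in_chart c u" "c \<in> A"
  obtains K where "compact K" "K \<subseteq> cimg c" "\<And>x. x \<in> cimg c - K \<Longrightarrow> u (cinv c x) = 0"
    "compact (cinv c ` K)" "cinv c ` K \<subseteq> cdom c" "\<And>p. p \<in> M - cinv c ` K \<Longrightarrow> u p = 0"
proof -
  obtain K where K: "compact K" "K \<subseteq> cimg c" "\<forall>p\<in>M - cinv c ` K. u p = 0"
    using assms(1) unfolding supported_in_chart_def by blast
  have "u (cinv c x) = 0" if "x \<in> cimg c - K" for x
  proof -
    have "cinv c x \<notin> cinv c ` K"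
      using that assms(2) by (simp add: cinv_image_eq[OF assms(2) K(2)])
    then show ?thesis
      using K(3) that assms(2) by simp
  qed
  then show ?thesis
    using K assms(2) compact_cinv_image by (intro that[of K]) auto
qed

lemma supported_in_chart_outside:
  assumes "supported_in_chart c u" "c \<in> A" "p \<in> M - cdom c"
  shows "u p = 0"
  using assms by (elim supported_in_chartE) blast+

lemma supported_in_chart_mult:
  "supported_in_chart c u \<Longrightarrow> supported_in_chart c (\<lambda>p. u p * v p)"
  unfolding supported_in_chart_def by (metis mult_zero_left)

lemma supported_in_chart_differential:
  assumes "supported_in_chart c u" "c \<in> A" and d: "d \<in> A" "p \<in> cdom d" "p \<notin> cdom c"
  shows "differential u d p = 0"
proof -
  obtain K where K: "compact (cinv c ` K)" "cinv c ` K \<subseteq> cdom c" "\<And>p. p \<in> M - cinv c ` K \<Longrightarrow> u p = 0"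
    by (rule supported_in_chartE[OF assms(1,2)]) blast
  let ?U = "cinv d -` (- cinv c ` K) \<inter> cimg d"
  have "open ?U"
    using K(1) by (intro open_vimage_cinv d open_Compl compact_imp_closed)
  then have "frechet_derivative (u \<circ> cinv d) (at (cmap d p)) =
      frechet_derivative (\<lambda>_. 0) (at (cmap d p))"
    by (rule frechet_derivative_cong_open) (use d K in auto)
  then show ?thesis
    by (simp add: differential_def partial_def vec_eq_iff)
qed

definition from_chart :: "('m, 'n) chart \<Rightarrow> (real^'n \<Rightarrow> real) \<Rightarrow> 'm \<Rightarrow> real" where
  "from_chart c f p = (if p \<in> cdom c then f (cmap c p) else 0)"

lemma from_chart_cinv: "c \<in> A \<Longrightarrow> x \<in> cimg c \<Longrightarrow> from_chart c f (cinv c x) = f x"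
  by (simp add: from_chart_def)

lemma from_chart_eq_0:
  assumes "c \<in> A" "K \<subseteq> cimg c" "\<And>x. x \<in> cimg c - K \<Longrightarrow> f x = 0" "p \<notin> cinv c ` K"
  shows "from_chart c f p = 0"
  using assms(3)[of "cmap c p"] assms(4) by (auto simp: from_chart_def cinv_image_eq[OF assms(1,2)])

lemma supported_in_chart_from_chart:
  assumes "c \<in> A" "compact K" "K \<subseteq> cimg c" "\<And>x. x \<in> cimg c - K \<Longrightarrow> f x = 0"
  shows "supported_in_chart c (from_chart c f)"
  unfolding supported_in_chart_def
proof (intro exI[of _ K] conjI ballI)
  show "from_chart c f p = 0" if "p \<in> M - cinv c ` K" for p
    by (rule from_chart_eq_0[OF assms(1,3,4)]) (use that in auto)
qed fact+

lemma C1_fun_from_chart: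
  assumes c: "c \<in> A" and K: "compact K" "K \<subseteq> cimg c"
    and supp: "\<And>x. x \<in> cimg c - K \<Longrightarrow> f x = 0" and f: "C1_on (cimg c) f"
  shows "C1_fun (from_chart c f)"
  unfolding C1_fun_def
proof
  fix d assume d: "d \<in> A"
  let ?f = "\<lambda>x. from_chart c f (cinv d x)"
  let ?U = "cmap d ` (cdom d \<inter> cdom c)" and ?V = "cinv d -` (- cinv c ` K) \<inter> cimg d"
  have U: "open ?U"
    by (rule open_overlap[OF d c])
  have "C1_on ?U (\<lambda>x. f ((cmap c \<circ> cinv d) x))"
    by (rule C1_on_compose[OF f C1_on_transition[OF d c]]) (use d in auto)
  then have "C1_on ?U ?f"
    by (rule C1_on_cong_open[OF U, rotated]) (use d in \<open>auto simp: from_chart_def\<close>)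
  moreover have V: "open ?V"
    using compact_cinv_image[OF c K] by (intro open_vimage_cinv d open_Compl compact_imp_closed)
  have "C1_on ?V ?f"
    by (rule C1_on_cong_open[OF V _ C1_on_const[of _ 0]])
       (use from_chart_eq_0[OF c K(2) supp] in auto)
  ultimately have "C1_on (?U \<union> ?V) ?f"
    using U V by (intro C1_on_open_Un)
  moreover have "?U \<union> ?V = cimg d"
    using c K(2) by (auto simp: overlap_eq[OF d] subset_iff)
  ultimately show "C1_on (cimg d) ?f" by simp
qed

definition chart_bump :: "('m, 'n) chart \<Rightarrow> real^'n \<Rightarrow> real \<Rightarrow> 'm \<Rightarrow> real" where
  "chart_bump c a r = from_chart c (bump a r)"

lemma
  assumes "c \<in> A" "0 < r" "cball a r \<subseteq> cimg c"
  shows C1_fun_chart_bump: "C1_fun (chart_bump c a r)"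
    and supported_in_chart_bump: "supported_in_chart c (chart_bump c a r)"
    and chart_bump_eq_0: "p \<notin> cinv c ` cball a r \<Longrightarrow> chart_bump c a r p = 0"
proof -
  have 0: "bump a r x = 0" if "x \<in> cimg c - cball a r" for x
    using that assms(2) by (intro bump_eq_0) auto
  show "C1_fun (chart_bump c a r)"
    unfolding chart_bump_def
    by (rule C1_fun_from_chart[OF assms(1) compact_cball assms(3) 0 C1_on_bump])
  show "supported_in_chart c (chart_bump c a r)"
    unfolding chart_bump_def
    by (rule supported_in_chart_from_chart[OF assms(1) compact_cball assms(3) 0])
  show "chart_bump c a r p = 0" if "p \<notin> cinv c ` cball a r"
    unfolding chart_bump_def by (rule from_chart_eq_0[OF assms(1,3) 0 that])
qed

lemma chart_bump_nonneg: "0 \<le> chart_bump c a r p"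
  by (simp add: chart_bump_def from_chart_def bump_nonneg)

lemma ex_local_bump:
  assumes "p \<in> M"
  shows "\<exists>b. C1_fun b \<and> supported_in_chart (chart_at A p) b \<and> (\<forall>q. 0 \<le> b q) \<and> 0 < b p"
proof -
  let ?c = "chart_at A p"
  note c = chart_at_in[OF assms]
  obtain r where r: "0 < r" "cball (cmap ?c p) r \<subseteq> cimg ?c"
    using open_cimg[OF c(1)] cmap_in_cimg[OF c(2)] open_contains_cball by metis
  then have "0 < chart_bump ?c (cmap ?c p) r p"
    using c by (simp add: chart_bump_def from_chart_def bump_pos_iff)
  then show ?thesis
    using C1_fun_chart_bump[OF c(1) r] supported_in_chart_bump[OF c(1) r] chart_bump_nonneg by blast
qed

lemma ex_finite_bump_cover:
  "\<exists>S b. finite S \<and> S \<subseteq> M \<and>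
     (\<forall>s\<in>S. C1_fun (b s) \<and> supported_in_chart (chart_at A s) (b s)) \<and>
     (\<forall>p\<in>M. 0 < (\<Sum>s\<in>S. b s p))"
proof -
  obtain b where b: "\<And>s. s \<in> M \<Longrightarrow> C1_fun (b s)"
    "\<And>s. s \<in> M \<Longrightarrow> supported_in_chart (chart_at A s) (b s)"
    "\<And>s q. s \<in> M \<Longrightarrow> 0 \<le> b s q" "\<And>s. s \<in> M \<Longrightarrow> 0 < b s s"
    using ex_local_bump by metis
  have "\<exists>W. open W \<and> {q\<in>M. 0 < b s q} = M \<inter> W" if "s \<in> M" for s
  proof -
    have "openin (top_of_set M) (M \<inter> b s -` {0<..})"
      by (rule continuous_openin_preimage_gen[OF C1_fun_continuous_on[OF b(1)[OF that]]
          open_greaterThan])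
    moreover have "M \<inter> b s -` {0<..} = {q\<in>M. 0 < b s q}" by auto
    ultimately show ?thesis
      by (auto simp: openin_open)
  qed
  then obtain W where W: "\<And>s. s \<in> M \<Longrightarrow> open (W s)" "\<And>s. s \<in> M \<Longrightarrow> {q\<in>M. 0 < b s q} = M \<inter> W s"
    by metis
  have cover: "M \<subseteq> (\<Union>s\<in>M. W s)"
    using W(2) b(4) by blast
  obtain S where S: "S \<subseteq> M" "finite S" "M \<subseteq> (\<Union>s\<in>S. W s)"
    by (rule compactE_image[OF compact_M W(1) cover])
  have "0 < (\<Sum>s\<in>S. b s p)" if p: "p \<in> M" for p
  proof -
    obtain s where s: "s \<in> S" "p \<in> W s"
      using S(3) p by blast
    then have "0 < b s p"
      using W(2)[of s] S(1) p by blast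
    then show ?thesis
      using s(1) S(1,2) b(3) by (intro sum_pos2[of S s]) auto
  qed
  with b(1,2) S(1,2) show ?thesis
    by (intro exI[of _ S] exI[of _ b]) (simp add: subset_iff)
qed

text \<open>A partition of unity in the form of a proof rule.\<close>

lemma C1_fun_localize:
  assumes u: "C1_fun u"
    and chart: "\<And>c v. c \<in> A \<Longrightarrow> C1_fun v \<Longrightarrow> supported_in_chart c v \<Longrightarrow> P v"
    and sum: "\<And>(I :: 'm set) v. finite I \<Longrightarrow> (\<And>s. s \<in> I \<Longrightarrow> C1_fun (v s)) \<Longrightarrow> (\<And>s. s \<in> I \<Longrightarrow> P (v s)) \<Longrightarrow>
      P (\<lambda>p. \<Sum>s\<in>I. v s p)"
    and cong: "\<And>v w. (\<And>p. p \<in> M \<Longrightarrow> v p = w p) \<Longrightarrow> P v \<Longrightarrow> P w"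
  shows "P u"
proof -
  obtain S b where S: "finite S" "S \<subseteq> M"
    and b: "\<And>s. s \<in> S \<Longrightarrow> C1_fun (b s)" "\<And>s. s \<in> S \<Longrightarrow> supported_in_chart (chart_at A s) (b s)"
    and pos: "\<And>p. p \<in> M \<Longrightarrow> 0 < (\<Sum>s\<in>S. b s p)"
    using ex_finite_bump_cover by blast
  define v where "v s p = b s p * (u p / (\<Sum>s\<in>S. b s p))" for s p
  have "C1_fun (\<lambda>p. u p / (\<Sum>s\<in>S. b s p))"
    using u b(1) pos by (intro C1_fun_divide C1_fun_sum) (auto simp: less_imp_neq[symmetric])
  then have v: "C1_fun (v s)" if "s \<in> S" for s
    unfolding v_def using b(1)[OF that] by (intro C1_fun_mult)
  moreover have "P (v s)" if "s \<in> S" for s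
    using S(2) that b(2) v unfolding v_def
    by (intro chart[of "chart_at A s"] supported_in_chart_mult chart_at_in_atlas) auto
  ultimately have "P (\<lambda>p. \<Sum>s\<in>S. v s p)"
    using S(1) by (intro sum)
  then show ?thesis
  proof (rule cong[rotated])
    show "(\<Sum>s\<in>S. v s p) = u p" if "p \<in> M" for p
    proof -
      have "(\<Sum>s\<in>S. v s p) = (\<Sum>s\<in>S. b s p) * (u p / (\<Sum>s\<in>S. b s p))"
        unfolding v_def by (rule sum_distrib_right[symmetric])
      then show ?thesis
        using pos[OF that] by simp
    qed
  qed
qed

end

subsection \<open>Scalars built from a metric\<close>

definition tensor_grad ::
    "('m, 'n::finite) chart set \<Rightarrow> ('m, 'n) tensor02 \<Rightarrow> ('m, 'n) tensor02 \<Rightarrow> ('m \<Rightarrow> real) \<Rightarrow>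
     ('m \<Rightarrow> real) \<Rightarrow> 'm \<Rightarrow> real" where
  "tensor_grad A g k u v p =
     (let c = chart_at A p in grad g u c p \<bullet> (k c p *v grad g v c p))"

definition volume_ratio ::
    "('m, 'n::finite) chart set \<Rightarrow> ('m, 'n) tensor02 \<Rightarrow> ('m, 'n) tensor02 \<Rightarrow> 'm \<Rightarrow> real" where
  "volume_ratio A g g' p = (let c = chart_at A p in vol_density g' c p / vol_density g c p)"

lemma symmetric_tensor02_transpose:
  "symmetric_tensor02 A k \<Longrightarrow> c \<in> A \<Longrightarrow> p \<in> cdom c \<Longrightarrow> transpose (k c p) = k c p"
  unfolding symmetric_tensor02_def by blast

lemma symmetric_tensor02_transform:
  "symmetric_tensor02 A k \<Longrightarrow> c \<in> A \<Longrightarrow> d \<in> A \<Longrightarrow> p \<in> cdom c \<Longrightarrow> p \<in> cdom d \<Longrightarrow>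
     k d p = transpose (transition_jacobian c d p) ** k c p ** transition_jacobian c d p"
  unfolding symmetric_tensor02_def by blast

locale riemannian_manifold = manifold M A
  for M :: "'m::t2_space set" and A :: "('m, 'n::finite) chart set" +
  fixes g :: "('m, 'n) tensor02"
  assumes metric: "riemannian_metric A g"
begin

lemma metric_symmetric: "symmetric_tensor02 A g"
  using metric by (simp add: riemannian_metric_def)

lemma metric_positive: "c \<in> A \<Longrightarrow> p \<in> cdom c \<Longrightarrow> v \<noteq> 0 \<Longrightarrow> 0 < v \<bullet> (g c p *v v)"
  using metric by (simp add: riemannian_metric_def)

lemma invertible_metric: "c \<in> A \<Longrightarrow> p \<in> cdom c \<Longrightarrow> invertible (g c p)"
  using metric_positive by (rule positive_definite_imp_invertible)

lemma vol_density_pos: "c \<in> A \<Longrightarrow> p \<in> cdom c \<Longrightarrow> 0 < vol_density g c p"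
  using positive_definite_imp_det_pos[OF metric_positive] by (simp add: vol_density_def)

lemma invertible_transition_jacobian:
  assumes "c \<in> A" "d \<in> A" "p \<in> cdom c" "p \<in> cdom d"
  shows "invertible (transition_jacobian c d p)"
  using invertible_metric[OF assms(2,4)]
  unfolding symmetric_tensor02_transform[OF metric_symmetric assms] invertible_det_nz
  by (simp add: det_mul)

lemma vol_density_transform:
  assumes "c \<in> A" "d \<in> A" "p \<in> cdom c" "p \<in> cdom d"
  shows "vol_density g d p = \<bar>det (transition_jacobian c d p)\<bar> * vol_density g c p"
  unfolding vol_density_def symmetric_tensor02_transform[OF metric_symmetric assms]
  by (simp add: det_mul det_transpose real_sqrt_mult mult.commute)

lemma C1_on_metric: "c \<in> A \<Longrightarrow> C1_on (cimg c) (\<lambda>x. g c (cinv c x))"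
  using metric open_cimg
  by (intro smooth_on_imp_C1_on) (simp_all add: riemannian_metric_def smooth_tensor02_def)

lemma C1_on_metric_inv: "c \<in> A \<Longrightarrow> C1_on (cimg c) (\<lambda>x. matrix_inv (g c (cinv c x)))"
  by (rule C1_on_matrix_inv[OF C1_on_metric]) (simp_all add: invertible_metric)

lemma C1_on_vol_density: "c \<in> A \<Longrightarrow> C1_on (cimg c) (\<lambda>x. vol_density g c (cinv c x))"
  unfolding vol_density_def
  by (rule C1_on_sqrt[OF C1_on_det[OF C1_on_metric]])
     (simp_all add: invertible_metric positive_definite_imp_det_pos[OF metric_positive])

lemma grad_eq: "grad g u c p = matrix_inv (g c p) *v differential u c p"
  by (simp add: grad_def differential_def)

lemma metric_mult_grad: "c \<in> A \<Longrightarrow> p \<in> cdom c \<Longrightarrow> g c p *v grad g u c p = differential u c p"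
  by (simp add: grad_eq matrix_vector_mul_assoc matrix_inv_right invertible_metric)

lemma grad_transform:
  assumes "C1_fun u" "c \<in> A" "d \<in> A" "p \<in> cdom c" "p \<in> cdom d"
  shows "transition_jacobian c d p *v grad g u d p = grad g u c p"
proof -
  let ?J = "transition_jacobian c d p"
  note G = invertible_metric[OF assms(2,4)] and J = invertible_transition_jacobian[OF assms(2-)]
  have "?J ** matrix_inv (g d p) ** transpose ?J =
      (?J ** matrix_inv ?J) ** matrix_inv (g c p) ** transpose (?J ** matrix_inv ?J)"
    unfolding symmetric_tensor02_transform[OF metric_symmetric assms(2-)]
      matrix_inv_congruence[OF G J]
    by (simp add: matrix_mul_assoc matrix_transpose_mul)
  also have "\<dots> = matrix_inv (g c p)"
    by (simp add: matrix_inv_right[OF J])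
  finally show ?thesis
    by (simp add: grad_eq differential_transform[OF assms(1,2,4,3,5)] matrix_vector_mul_assoc
        matrix_mul_assoc del: transpose_matrix_vector)
qed

lemma tensor_grad_chart:
  assumes k: "symmetric_tensor02 A k" and u: "C1_fun u" and v: "C1_fun v"
    and c: "c \<in> A" "p \<in> cdom c"
  shows "tensor_grad A g k u v p = grad g u c p \<bullet> (k c p *v grad g v c p)"
proof -
  let ?d = "chart_at A p" and ?J = "transition_jacobian c (chart_at A p) p"
  note d = chart_at_in[OF in_cdom_imp_in_M[OF c]]
  have "k ?d p *v grad g v ?d p = transpose ?J *v (k c p *v (?J *v grad g v ?d p))"
    unfolding symmetric_tensor02_transform[OF k c(1) d(1) c(2) d(2)]
    by (simp add: matrix_vector_mul_assoc matrix_mul_assoc)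
  then show ?thesis
    by (simp add: tensor_grad_def Let_def inner_transpose_mult grad_transform u v c d
        del: transpose_matrix_vector)
qed

lemma tensor_grad_metric:
  assumes "p \<in> M"
  shows "tensor_grad A g g u v p = grad g u (chart_at A p) p \<bullet> differential v (chart_at A p) p"
  using chart_at_in[OF assms] by (simp add: tensor_grad_def Let_def metric_mult_grad)

lemma tensor_grad_metric_chart:
  "C1_fun u \<Longrightarrow> C1_fun v \<Longrightarrow> c \<in> A \<Longrightarrow> p \<in> cdom c \<Longrightarrow>
     tensor_grad A g g u v p = grad g u c p \<bullet> differential v c p"
  by (simp add: tensor_grad_chart metric_symmetric metric_mult_grad)

lemma tensor_grad_commute:
  assumes "symmetric_tensor02 A k" "p \<in> M"
  shows "tensor_grad A g k u v p = tensor_grad A g k v u p"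
  using inner_transpose_mult[of _ "k (chart_at A p) p"] assms chart_at_in[OF assms(2)]
  by (simp add: tensor_grad_def Let_def symmetric_tensor02_transpose inner_commute)

lemma tensor_grad_metric_cong:
  assumes "\<And>q. q \<in> M \<Longrightarrow> v q = w q" "p \<in> M"
  shows "tensor_grad A g g u v p = tensor_grad A g g u w p"
  using chart_at_in[OF assms(2)]
  by (simp add: tensor_grad_metric assms(2) differential_cong[OF assms(1)])

lemma tensor_grad_metric_sum:
  assumes "\<And>s. s \<in> I \<Longrightarrow> C1_fun (v s)" "p \<in> M"
  shows "tensor_grad A g g u (\<lambda>p. \<Sum>s\<in>I. v s p) p = (\<Sum>s\<in>I. tensor_grad A g g u (v s) p)"
  using assms chart_at_in[OF assms(2)]
  by (simp add: tensor_grad_metric differential_sum inner_sum_right)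

lemma grad_norm_square:
  assumes "p \<in> M"
  shows "(grad_norm A g u p)\<^sup>2 = tensor_grad A g g u u p"
proof -
  let ?X = "grad g u (chart_at A p) p"
  have "0 \<le> ?X \<bullet> (g (chart_at A p) p *v ?X)"
    using metric_positive[OF chart_at_in[OF assms], of ?X] by (cases "?X = 0") auto
  then show ?thesis
    by (simp add: grad_norm_def tensor_grad_def Let_def)
qed

lemma transpose_matrix_inv_metric:
  "c \<in> A \<Longrightarrow> p \<in> cdom c \<Longrightarrow> transpose (matrix_inv (g c p)) = matrix_inv (g c p)"
  using matrix_inv_transpose[OF invertible_metric, of c p]
  by (simp add: symmetric_tensor02_transpose[OF metric_symmetric])

lemma tensor_grad_eq_differential:
  assumes "p \<in> M"
  defines "c \<equiv> chart_at A p"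
  shows "tensor_grad A g k u v p = differential u c p \<bullet>
    ((matrix_inv (g c p) ** k c p ** matrix_inv (g c p)) *v differential v c p)"
proof -
  let ?B = "matrix_inv (g c p)"
  have "tensor_grad A g k u v p =
      (?B *v differential u c p) \<bullet> (k c p *v (?B *v differential v c p))"
    by (simp add: tensor_grad_def Let_def grad_eq c_def)
  also have "\<dots> = differential u c p \<bullet> (transpose ?B *v (k c p *v (?B *v differential v c p)))"
    by (rule inner_transpose_mult[symmetric])
  finally show ?thesis
    using transpose_matrix_inv_metric[OF chart_at_in[OF assms(1)]]
    by (simp add: c_def matrix_vector_mul_assoc matrix_mul_assoc)
qed

lemma tensor_pairing_eq_tensor_grad:
  assumes "p \<in> M"
  shows "tensor_pairing A g h u p = tensor_grad A g h u u p"
proof -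
  let ?c = "chart_at A p"
  let ?B = "matrix_inv (g ?c p)" and ?w = "differential u ?c p"
  have "?B $ j $ i = ?B $ i $ j" for i j
    using arg_cong[OF transpose_matrix_inv_metric[OF chart_at_in[OF assms]], of "\<lambda>B. B $ i $ j"]
    by (simp add: transpose_def)
  then have "raise_indices g h ?c p $ i $ j = (?B ** h ?c p ** ?B) $ i $ j" for i j
    unfolding raise_indices_def matrix_matrix_mult_def
    by (simp add: sum_distrib_right) (subst sum.swap, simp add: mult_ac)
  then show ?thesis
    by (simp add: tensor_grad_eq_differential[OF assms] tensor_pairing_def Let_def inner_vec_def
        matrix_vector_mult_def differential_def sum_distrib_left mult_ac)
qed

lemma metric_trace_chart:
  assumes h: "symmetric_tensor02 A h" and c: "c \<in> A" "p \<in> cdom c"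
  shows "metric_trace A g h p = trace (matrix_inv (g c p) ** h c p)"
proof -
  let ?d = "chart_at A p" and ?J = "transition_jacobian c (chart_at A p) p"
  note d = chart_at_in[OF in_cdom_imp_in_M[OF c]]
  note G = invertible_metric[OF c] and J = invertible_transition_jacobian[OF c(1) d(1) c(2) d(2)]
  have "h ?d p $ j $ i = h ?d p $ i $ j" for i j
    using arg_cong[OF symmetric_tensor02_transpose[OF h d], of "\<lambda>B. B $ i $ j"]
    by (simp add: transpose_def)
  then have "metric_trace A g h p = trace (matrix_inv (g ?d p) ** h ?d p)"
    by (simp add: metric_trace_def Let_def trace_def matrix_matrix_mult_def)
  also have "matrix_inv (g ?d p) ** h ?d p =
      matrix_inv ?J ** (matrix_inv (g c p) ** transpose (?J ** matrix_inv ?J) ** h c p ** ?J)"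
    unfolding symmetric_tensor02_transform[OF metric_symmetric c(1) d(1) c(2) d(2)]
      symmetric_tensor02_transform[OF h c(1) d(1) c(2) d(2)] matrix_inv_congruence[OF G J]
    by (simp add: matrix_mul_assoc matrix_transpose_mul)
  also have "trace \<dots> = trace (matrix_inv (g c p) ** h c p ** (?J ** matrix_inv ?J))"
    unfolding matrix_inv_right[OF J]
    by (simp add: trace_mul_sym[of "matrix_inv ?J"] matrix_mul_assoc[symmetric]
        matrix_inv_right[OF J])
  finally show ?thesis
    by (simp add: matrix_inv_right[OF J])
qed

end

context manifold
begin

definition continuous_in_charts ::
    "'z::topological_space set \<Rightarrow> ('z \<Rightarrow> ('m, 'n) chart \<Rightarrow> 'm \<Rightarrow> 'b::topological_space) \<Rightarrow> bool" where
  "continuous_in_charts Z F \<longleftrightarrow> (\<forall>c\<in>A. continuous_on (Z \<times> cimg c) (\<lambda>(z, x). F z c (cinv c x)))"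

lemma continuous_in_charts_const:
  assumes "\<And>c. c \<in> A \<Longrightarrow> continuous_on (cimg c) (\<lambda>x. F c (cinv c x))"
  shows "continuous_in_charts Z (\<lambda>_. F)"
  unfolding continuous_in_charts_def by (rule ballI, rule continuous_on_Times_snd, rule assms)

lemma continuous_in_charts_reparametrize:
  assumes F: "continuous_in_charts Z F" and \<sigma>: "continuous_on Y \<sigma>" "\<sigma> ` Y \<subseteq> Z"
  shows "continuous_in_charts Y (\<lambda>y. F (\<sigma> y))"
  unfolding continuous_in_charts_def
proof
  fix c assume "c \<in> A"
  have "continuous_on (Y \<times> cimg c) (\<lambda>w. \<sigma> (fst w))"
    by (rule continuous_on_compose2[OF \<sigma>(1) continuous_on_fst[OF continuous_on_id]]) auto
  then have "continuous_on (Y \<times> cimg c) (\<lambda>w. (\<sigma> (fst w), snd w))"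
    by (intro continuous_on_Pair continuous_on_snd continuous_on_id)
  then have "continuous_on (Y \<times> cimg c) (\<lambda>w. (\<lambda>(z, x). F z c (cinv c x)) (\<sigma> (fst w), snd w))"
    by (rule continuous_on_compose2[OF bspec[OF F[unfolded continuous_in_charts_def] \<open>c \<in> A\<close>]])
       (use \<sigma>(2) in auto)
  then show "continuous_on (Y \<times> cimg c) (\<lambda>(y, x). F (\<sigma> y) c (cinv c x))"
    by (simp add: case_prod_beta)
qed

lemma continuous_on_metric_trace:
  fixes Z :: "'z::t2_space set"
  assumes g: "\<And>z. z \<in> Z \<Longrightarrow> riemannian_metric A (g z)" "continuous_in_charts Z g"
    and h: "\<And>z. z \<in> Z \<Longrightarrow> symmetric_tensor02 A (h z)" "continuous_in_charts Z h"
  shows "continuous_on (Z \<times> M) (\<lambda>(z, p). metric_trace A (g z) (h z) p)"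
proof (rule continuous_on_Times_M)
  fix c assume c: "c \<in> A"
  have R: "riemannian_manifold M A (g z)" if "z \<in> Z" for z
    using g(1) that by unfold_locales
  have "continuous_on (Z \<times> cimg c)
      (\<lambda>w. trace (matrix_inv (g (fst w) c (cinv c (snd w))) ** h (fst w) c (cinv c (snd w))))"
    using g(2) h(2) c riemannian_manifold.invertible_metric[OF R c]
    by (intro continuous_intros continuous_on_matrix_inv)
       (auto simp: continuous_in_charts_def case_prod_beta)
  then show "continuous_on (Z \<times> cimg c) (\<lambda>(z, x). metric_trace A (g z) (h z) (cinv c x))"
    by (rule continuous_on_eq) (auto simp: riemannian_manifold.metric_trace_chart[OF R h(1) c] c)
qed

lemma continuous_on_tensor_grad:
  fixes Z :: "'z::t2_space set"
  assumes g: "\<And>z. z \<in> Z \<Longrightarrow> riemannian_metric A (g z)" "continuous_in_charts Z g"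
    and k: "\<And>z. z \<in> Z \<Longrightarrow> symmetric_tensor02 A (k z)" "continuous_in_charts Z k"
    and u: "\<And>z. z \<in> Z \<Longrightarrow> C1_fun (u z)" "continuous_in_charts Z (\<lambda>z. differential (u z))"
    and v: "\<And>z. z \<in> Z \<Longrightarrow> C1_fun (v z)" "continuous_in_charts Z (\<lambda>z. differential (v z))"
  shows "continuous_on (Z \<times> M) (\<lambda>(z, p). tensor_grad A (g z) (k z) (u z) (v z) p)"
proof (rule continuous_on_Times_M)
  fix c assume c: "c \<in> A"
  have R: "riemannian_manifold M A (g z)" if "z \<in> Z" for z
    using g(1) that by unfold_locales
  have grad: "continuous_on (Z \<times> cimg c) (\<lambda>w. grad (g (fst w)) (f (fst w)) c (cinv c (snd w)))"
    if "continuous_in_charts Z (\<lambda>z. differential (f z))" for f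
  proof (rule continuous_on_eq)
    show "continuous_on (Z \<times> cimg c)
        (\<lambda>w. matrix_inv (g (fst w) c (cinv c (snd w))) *v
          differential (f (fst w)) c (cinv c (snd w)))"
      using g(2) that c riemannian_manifold.invertible_metric[OF R c]
      by (intro continuous_intros continuous_on_matrix_inv)
         (auto simp: continuous_in_charts_def case_prod_beta)
  qed (auto simp: riemannian_manifold.grad_eq[OF R])
  have "continuous_on (Z \<times> cimg c) (\<lambda>w. grad (g (fst w)) (u (fst w)) c (cinv c (snd w)) \<bullet>
      (k (fst w) c (cinv c (snd w)) *v grad (g (fst w)) (v (fst w)) c (cinv c (snd w))))"
    using k(2) c
    by (intro continuous_intros grad u(2) v(2)) (auto simp: continuous_in_charts_def case_prod_beta)
  then show "continuous_on (Z \<times> cimg c) (\<lambda>(z, x). tensor_grad A (g z) (k z) (u z) (v z) (cinv c x))"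
    by (rule continuous_on_eq)
       (auto simp: riemannian_manifold.tensor_grad_chart[OF R k(1) u(1) v(1) c] c)
qed

end

subsection \<open>The Riemannian volume measure\<close>

definition chart_measure ::
    "'m::t2_space set \<Rightarrow> ('m, 'n::finite) tensor02 \<Rightarrow> ('m, 'n) chart \<Rightarrow> 'm measure" where
  "chart_measure M g c =
     distr (density (restrict_space lborel (cimg c)) (\<lambda>x. ennreal (vol_density g c (cinv c x))))
       (restrict_space borel M) (cinv c)"

lemma sets_chart_measure [simp]: "sets (chart_measure M g c) = sets (restrict_space borel M)"
  by (simp add: chart_measure_def)

lemma set_borel_measurable_continuous_on:
  fixes f :: "'a::topological_space \<Rightarrow> 'b::real_normed_vector"
  shows "S \<in> sets borel \<Longrightarrow> continuous_on S f \<Longrightarrow> set_borel_measurable borel S f"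
  unfolding set_borel_measurable_def by (rule borel_measurable_continuous_on_indicator)

context manifold
begin

lemma sets_restrict_M: "E \<in> sets (restrict_space borel M) \<longleftrightarrow> E \<subseteq> M \<and> E \<in> sets borel"
  using closed_M by (subst sets_restrict_space_iff) auto

lemma cdom_in_sets:
  assumes "c \<in> A"
  shows "cdom c \<in> sets (restrict_space borel M)"
proof -
  obtain W where W: "open W" "cdom c = M \<inter> W"
    by (rule cdom_eq_open_Int[OF assms])
  have "M \<inter> W \<in> sets borel"
    by (intro sets.Int borel_closed closed_M borel_open W(1))
  then show ?thesis
    by (simp add: sets_restrict_M W(2))
qed

lemma cinv_measurable:
  assumes "c \<in> A"
  shows "cinv c \<in> restrict_space lborel (cimg c) \<rightarrow>\<^sub>M restrict_space borel M"
proof (rule measurable_restrict_space2)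
  show "cinv c \<in> borel_measurable (restrict_space lborel (cimg c))"
    by (rule borel_measurable_continuous_on_restrict_sets[OF
        sets_restrict_space_cong[OF sets_lborel]
          continuous_on_cinv[OF assms]])
qed (use assms in \<open>simp add: space_restrict_space\<close>)

lemma cmap_image_in_sets:
  assumes "c \<in> A" "E \<in> sets (restrict_space borel M)" "E \<subseteq> cdom c"
  shows "cmap c ` E \<in> sets borel"
  using measurable_sets[OF cinv_measurable[OF assms(1)] assms(2)] open_cimg[OF assms(1)]
  by (simp add: cmap_image_eq[OF assms(1,3)] space_restrict_space sets_restrict_space_iff)

lemma nn_integral_transition:
  assumes c: "c \<in> A" and d: "d \<in> A"
    and E: "E \<in> sets (restrict_space borel M)" "E \<subseteq> cdom c" "E \<subseteq> cdom d"
    and nonneg: "\<And>x. x \<in> cmap c ` E \<Longrightarrow> 0 \<le> f x"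
    and meas: "set_borel_measurable borel (cmap c ` E) f"
      "set_borel_measurable borel (cmap d ` E)
        (\<lambda>y. \<bar>det (transition_jacobian c d (cinv d y))\<bar> * f (cmap c (cinv d y)))"
  shows "(\<integral>\<^sup>+x\<in>cmap c ` E. ennreal (f x) \<partial>lborel) =
    (\<integral>\<^sup>+y\<in>cmap d ` E.
      ennreal (\<bar>det (transition_jacobian c d (cinv d y))\<bar> * f (cmap c (cinv d y))) \<partial>lborel)"
proof -
  let ?\<tau> = "cmap c \<circ> cinv d" and ?J = "\<lambda>y. transition_jacobian c d (cinv d y)"
  have image: "cmap c ` E = ?\<tau> ` cmap d ` E"
    unfolding image_image using E(3) d by (intro image_cong) auto
  have der: "(?\<tau> has_derivative (*v) (?J y)) (at y within cmap d ` E)" if y: "y \<in> cmap d ` E" for y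
  proof -
    obtain p where "p \<in> E" "y = cmap d p"
      using y by blast
    then show ?thesis
      using transition_has_derivative[OF c d, of p] E d
      by (simp add: has_derivative_at_withinI subset_iff)
  qed
  have "inj_on ?\<tau> (cmap d ` E)"
    using E(3) d inj_on_cmap[OF c E(2)] by (auto simp: inj_on_def subset_iff)
  then show ?thesis
    using nn_integral_change_of_variables[OF cmap_image_in_sets[OF d E(1,3)] der, of f] nonneg meas
    by (simp add: image)
qed

lemma ex_finite_chart_cover: "\<exists>F\<subseteq>A. finite F \<and> M \<subseteq> (\<Union>c\<in>F. cdom c)"
proof -
  have "\<forall>c\<in>A. \<exists>W. open W \<and> cdom c = M \<inter> W"
    using cdom_eq_open_Int by metis
  then obtain W where W: "\<And>c. c \<in> A \<Longrightarrow> open (W c)" "\<And>c. c \<in> A \<Longrightarrow> cdom c = M \<inter> W c"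
    by metis
  have cover: "M \<subseteq> (\<Union>c\<in>A. W c)"
    using W(2) charts_cover by blast
  obtain F where F: "F \<subseteq> A" "finite F" "M \<subseteq> (\<Union>c\<in>F. W c)"
    by (rule compactE_image[OF compact_M W(1) cover])
  have "M \<subseteq> (\<Union>c\<in>F. cdom c)"
  proof
    fix p assume p: "p \<in> M"
    then obtain c where "c \<in> F" "p \<in> W c"
      using F(3) by blast
    then show "p \<in> (\<Union>c\<in>F. cdom c)"
      using W(2)[of c] F(1) p by blast
  qed
  then show ?thesis
    using F by blast
qed

end

context riemannian_manifold
begin

lemma vol_density_measurable [measurable]:
  assumes "c \<in> A"
  shows "(\<lambda>x. vol_density g c (cinv c x)) \<in> borel_measurable (restrict_space lborel (cimg c))"
  by (rule borel_measurable_continuous_on_restrict_sets[OF sets_restrict_space_cong[OF sets_lborel]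
        C1_on_imp_continuous_on[OF C1_on_vol_density[OF assms]]])

lemma nn_integral_chart_measure:
  assumes c: "c \<in> A" and f: "f \<in> borel_measurable (restrict_space borel M)"
  shows "(\<integral>\<^sup>+p. f p \<partial>chart_measure M g c) =
    (\<integral>\<^sup>+x\<in>cimg c. ennreal (vol_density g c (cinv c x)) * f (cinv c x) \<partial>lborel)"
proof -
  note [measurable] = cinv_measurable[OF c] vol_density_measurable[OF c] f
  show ?thesis
    using open_cimg[OF c]
    by (simp add: chart_measure_def nn_integral_distr nn_integral_density
        nn_integral_restrict_space)
qed

lemma emeasure_chart_measure:
  assumes c: "c \<in> A" and E: "E \<in> sets (restrict_space borel M)" "E \<subseteq> cdom c"
  shows "emeasure (chart_measure M g c) E =
    (\<integral>\<^sup>+x\<in>cmap c ` E. ennreal (vol_density g c (cinv c x)) \<partial>lborel)"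
proof -
  have "emeasure (chart_measure M g c) E = (\<integral>\<^sup>+p. indicator E p \<partial>chart_measure M g c)"
    using E(1) by simp
  also have "\<dots> = (\<integral>\<^sup>+x\<in>cimg c. ennreal (vol_density g c (cinv c x)) *
      indicator E (cinv c x) \<partial>lborel)"
    by (intro nn_integral_chart_measure[OF c] borel_measurable_indicator E(1))
  also have "\<dots> = (\<integral>\<^sup>+x\<in>cmap c ` E. ennreal (vol_density g c (cinv c x)) \<partial>lborel)"
    unfolding cmap_image_eq[OF c E(2)] by (intro nn_integral_cong) (auto split: split_indicator)
  finally show ?thesis .
qed

lemma chart_measure_eq_on_overlap:
  assumes c: "c \<in> A" and d: "d \<in> A" and E: "E \<in> sets (restrict_space borel M)" "E \<subseteq> cdom c \<inter> cdom d"
  shows "emeasure (chart_measure M g c) E = emeasure (chart_measure M g d) E"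
proof -
  let ?v = "\<lambda>c x. vol_density g c (cinv c x)"
  let ?w = "\<lambda>y. \<bar>det (transition_jacobian c d (cinv d y))\<bar> * ?v c (cmap c (cinv d y))"
  have Ec: "E \<subseteq> cdom c" and Ed: "E \<subseteq> cdom d"
    using E(2) by auto
  have v_meas: "set_borel_measurable borel (cmap b ` E) (?v b)" if "b \<in> A" "E \<subseteq> cdom b" for b
    by (rule set_borel_measurable_continuous_on[OF cmap_image_in_sets[OF that(1) E(1) that(2)]
          continuous_on_subset[OF C1_on_imp_continuous_on[OF C1_on_vol_density[OF that(1)]]]])
       (use that(2) in auto)
  have w: "?w y = ?v d y" if y: "y \<in> cmap d ` E" for y
  proof -
    obtain p where "p \<in> E" "y = cmap d p"
      using y by blast
    then show ?thesis
      using vol_density_transform[OF c d, of p] Ec Ed c d by (simp add: subset_iff)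
  qed
  then have "indicator (cmap d ` E) y *\<^sub>R ?w y = indicator (cmap d ` E) y *\<^sub>R ?v d y" for y
    by (simp split: split_indicator)
  then have w_meas: "set_borel_measurable borel (cmap d ` E) ?w"
    using v_meas[OF d Ed] by (simp only: set_borel_measurable_def)
  have "emeasure (chart_measure M g c) E = (\<integral>\<^sup>+x\<in>cmap c ` E. ennreal (?v c x) \<partial>lborel)"
    by (rule emeasure_chart_measure[OF c E(1) Ec])
  also have "\<dots> = (\<integral>\<^sup>+y\<in>cmap d ` E. ennreal (?w y) \<partial>lborel)"
    by (rule nn_integral_transition[OF c d E(1) Ec Ed _ v_meas[OF c Ec] w_meas])
       (use Ec c vol_density_pos[OF c] in \<open>auto simp: less_imp_le subset_iff\<close>)
  also have "\<dots> = (\<integral>\<^sup>+y\<in>cmap d ` E. ennreal (?v d y) \<partial>lborel)"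
    using w by (intro nn_integral_cong) (simp split: split_indicator)
  also have "\<dots> = emeasure (chart_measure M g d) E"
    by (rule emeasure_chart_measure[OF d E(1) Ed, symmetric])
  finally show ?thesis .
qed

definition is_volume :: "'m measure \<Rightarrow> bool" where
  "is_volume \<mu> \<longleftrightarrow> sets \<mu> = sets (restrict_space borel M) \<and>
     (\<forall>c\<in>A. \<forall>E\<in>sets \<mu>. E \<subseteq> cdom c \<longrightarrow> emeasure \<mu> E = emeasure (chart_measure M g c) E)"

lemma ex_volume: "\<exists>\<mu>. is_volume \<mu>"
proof -
  obtain F where F: "F \<subseteq> A" "finite F" "M \<subseteq> (\<Union>c\<in>F. cdom c)"
    using ex_finite_chart_cover by blast
  have "\<exists>\<mu>. sets \<mu> = sets (restrict_space borel M) \<and>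
      (\<forall>c\<in>F. \<forall>E\<in>sets (restrict_space borel M). E \<subseteq> cdom c \<longrightarrow>
        emeasure \<mu> E = emeasure (chart_measure M g c) E)"
    using F(1) cdom_in_sets chart_measure_eq_on_overlap
    by (intro ex_measure_glue[OF F(2)]) (auto simp: subset_iff)
  then obtain \<mu> where sets: "sets \<mu> = sets (restrict_space borel M)"
    and \<mu>: "\<And>c E. c \<in> F \<Longrightarrow> E \<in> sets \<mu> \<Longrightarrow> E \<subseteq> cdom c \<Longrightarrow>
      emeasure \<mu> E = emeasure (chart_measure M g c) E"
    by auto
  have "emeasure \<mu> E = emeasure (chart_measure M g c) E"
    if c: "c \<in> A" and E: "E \<in> sets \<mu>" "E \<subseteq> cdom c" for c E
  proof (rule emeasure_eq_on_finite_cover[OF F(2), where C = "\<lambda>d. cdom c \<inter> cdom d"])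
    show "emeasure \<mu> B = emeasure (chart_measure M g c) B"
      if "d \<in> F" "B \<in> sets \<mu>" "B \<subseteq> cdom c \<inter> cdom d" for d B
      using \<mu>[of d B] chart_measure_eq_on_overlap[OF c, of d B] that F(1) by (auto simp: sets)
    show "E \<subseteq> (\<Union>d\<in>F. cdom c \<inter> cdom d)"
      using E(2) F(3) cdom_subset_M[OF c] by blast
  qed (use E F(1) c in \<open>auto simp: sets intro!: sets.Int cdom_in_sets\<close>)
  then show ?thesis
    using sets unfolding is_volume_def by blast
qed

lemma is_volume_unique:
  assumes "is_volume \<mu>" "is_volume \<nu>"
  shows "\<mu> = \<nu>"
proof (rule measure_eqI)
  obtain F where F: "F \<subseteq> A" "finite F" "M \<subseteq> (\<Union>c\<in>F. cdom c)"
    using ex_finite_chart_cover by blast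
  have sets: "sets \<mu> = sets (restrict_space borel M)" "sets \<nu> = sets (restrict_space borel M)"
    using assms by (simp_all add: is_volume_def)
  then show "sets \<mu> = sets \<nu>" by simp
  fix E assume E: "E \<in> sets \<mu>"
  show "emeasure \<mu> E = emeasure \<nu> E"
  proof (rule emeasure_eq_on_finite_cover[OF F(2), where C = cdom])
    show "emeasure \<mu> B = emeasure \<nu> B" if "c \<in> F" "B \<in> sets \<mu>" "B \<subseteq> cdom c" for c B
      using assms that F(1) sets unfolding is_volume_def by (metis subsetD)
    show "E \<subseteq> (\<Union>c\<in>F. cdom c)"
      using E F(3) by (auto simp: sets sets_restrict_M)
  qed (use E F(1) in \<open>auto simp: sets intro!: cdom_in_sets\<close>)
qed

abbreviation vol :: "'m measure" where
  "vol \<equiv> riemannian_volume M A g"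

lemma is_volume_vol: "is_volume vol"
proof -
  have "is_volume \<mu> \<longleftrightarrow> sets \<mu> = sets (restrict_space borel M) \<and>
      (\<forall>c\<in>A. \<forall>E\<in>sets \<mu>. E \<subseteq> cdom c \<longrightarrow>
        emeasure \<mu> E = (\<integral>\<^sup>+x\<in>cmap c ` E. ennreal (vol_density g c (cinv c x)) \<partial>lborel))" for \<mu>
    unfolding is_volume_def
    by (intro conj_cong ball_cong imp_cong refl) (simp add: emeasure_chart_measure)
  moreover have "\<exists>!\<mu>. is_volume \<mu>"
    using ex_volume is_volume_unique by blast
  ultimately show ?thesis
    unfolding riemannian_volume_def using theI'[of is_volume] by simp
qed

lemma sets_vol: "sets vol = sets (restrict_space borel M)"
  using is_volume_vol by (simp add: is_volume_def)

lemma space_vol: "space vol = M"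
  using sets_eq_imp_space_eq[OF sets_vol] by (simp add: space_restrict_space)

lemma measurable_vol_iff: "f \<in> borel_measurable vol \<longleftrightarrow> f \<in> borel_measurable (restrict_space borel M)"
  by (simp only: measurable_cong_sets[OF sets_vol refl])

lemma continuous_on_imp_measurable_vol: "continuous_on M f \<Longrightarrow> f \<in> borel_measurable vol"
  by (rule borel_measurable_continuous_on_restrict_sets[OF sets_vol])

lemma density_vol_cdom:
  assumes "c \<in> A"
  shows "density vol (indicator (cdom c)) = chart_measure M g c"
proof (rule measure_eqI)
  fix E assume "E \<in> sets (density vol (indicator (cdom c)))"
  then have E: "E \<in> sets (restrict_space borel M)"
    by (simp add: sets_vol)
  have "emeasure (density vol (indicator (cdom c))) E = emeasure vol (cdom c \<inter> E)"
    using E cdom_in_sets[OF assms] by (intro emeasure_restricted) (simp_all add: sets_vol)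
  also have "\<dots> = emeasure (chart_measure M g c) (cdom c \<inter> E)"
    using is_volume_vol assms E cdom_in_sets[OF assms] unfolding is_volume_def
    by (auto simp: sets_vol)
  also have "\<dots> = (\<integral>\<^sup>+p. indicator (cdom c \<inter> E) p \<partial>chart_measure M g c)"
    using E cdom_in_sets[OF assms] by simp
  also have "\<dots> = (\<integral>\<^sup>+p. indicator E p \<partial>chart_measure M g c)"
    using E cdom_in_sets[OF assms] assms
    by (subst (1 2) nn_integral_chart_measure[OF assms])
       (auto intro!: nn_integral_cong split: split_indicator)
  finally show "emeasure (density vol (indicator (cdom c))) E = emeasure (chart_measure M g c) E"
    using E by simp
qed (simp add: sets_vol)

lemma nn_integral_vol_chart:
  assumes c: "c \<in> A" and f [measurable]: "f \<in> borel_measurable (restrict_space borel M)"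
  shows "(\<integral>\<^sup>+p\<in>cdom c. f p \<partial>vol) =
    (\<integral>\<^sup>+x\<in>cimg c. ennreal (vol_density g c (cinv c x)) * f (cinv c x) \<partial>lborel)"
proof -
  have "(\<integral>\<^sup>+p\<in>cdom c. f p \<partial>vol) = (\<integral>\<^sup>+p. f p \<partial>density vol (indicator (cdom c)))"
    using f cdom_in_sets[OF c]
    by (subst nn_integral_density) (simp_all add: measurable_vol_iff sets_vol mult.commute)
  then show ?thesis
    by (simp only: density_vol_cdom[OF c] nn_integral_chart_measure[OF c f])
qed

lemma
  fixes f :: "'m \<Rightarrow> real"
  assumes c: "c \<in> A" and f [measurable]: "f \<in> borel_measurable (restrict_space borel M)"
  shows integrable_chart_measure: "integrable (chart_measure M g c) f \<longleftrightarrow>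
      set_integrable lborel (cimg c) (\<lambda>x. vol_density g c (cinv c x) * f (cinv c x))"
    and integral_chart_measure: "(\<integral>p. f p \<partial>chart_measure M g c) =
      (LINT x:cimg c|lborel. vol_density g c (cinv c x) * f (cinv c x))"
proof -
  let ?R = "restrict_space lborel (cimg c)" and ?v = "\<lambda>x. vol_density g c (cinv c x)"
  note [measurable] = cinv_measurable[OF c] vol_density_measurable[OF c]
  have v_nonneg: "AE x in ?R. 0 \<le> ?v x"
    using vol_density_pos[OF c] c by (intro AE_I2) (simp add: space_restrict_space less_imp_le)
  have "integrable (chart_measure M g c) f \<longleftrightarrow> integrable (density ?R ?v) (\<lambda>x. f (cinv c x))"
    unfolding chart_measure_def by (rule integrable_distr_eq) measurable
  also have "\<dots> \<longleftrightarrow> integrable ?R (\<lambda>x. ?v x *\<^sub>R f (cinv c x))"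
    by (rule integrable_density[OF _ _ v_nonneg]) measurable
  finally show "integrable (chart_measure M g c) f \<longleftrightarrow>
      set_integrable lborel (cimg c) (\<lambda>x. ?v x * f (cinv c x))"
    using open_cimg[OF c] by (simp add: set_integrable_def integrable_restrict_space)
  have "(\<integral>p. f p \<partial>chart_measure M g c) = (\<integral>x. f (cinv c x) \<partial>density ?R ?v)"
    unfolding chart_measure_def by (rule integral_distr) measurable
  also have "\<dots> = (\<integral>x. ?v x *\<^sub>R f (cinv c x) \<partial>?R)"
    by (rule integral_density[OF _ _ v_nonneg]) measurable
  finally show "(\<integral>p. f p \<partial>chart_measure M g c) = (LINT x:cimg c|lborel. ?v x * f (cinv c x))"
    using open_cimg[OF c] by (simp add: set_lebesgue_integral_def integral_restrict_space)
qed

lemma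
  fixes f :: "'m \<Rightarrow> real"
  assumes c: "c \<in> A" and f: "set_borel_measurable vol (cdom c) f"
  shows set_integrable_vol_chart: "set_integrable vol (cdom c) f \<longleftrightarrow>
      set_integrable lborel (cimg c) (\<lambda>x. vol_density g c (cinv c x) * f (cinv c x))"
    and set_integral_vol_chart: "(LINT p:cdom c|vol. f p) =
      (LINT x:cimg c|lborel. vol_density g c (cinv c x) * f (cinv c x))"
proof -
  let ?f = "\<lambda>p. indicator (cdom c) p *\<^sub>R f p" and ?v = "\<lambda>x. vol_density g c (cinv c x)"
  have f_vol [measurable]: "?f \<in> borel_measurable vol"
    using f by (simp add: set_borel_measurable_def)
  have [measurable]: "(indicator (cdom c) :: 'm \<Rightarrow> real) \<in> borel_measurable vol"
    by (rule borel_measurable_indicator) (simp add: sets_vol cdom_in_sets[OF c])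
  note f_M = f_vol[unfolded measurable_vol_iff]
  have f_f: "indicator (cdom c) p * (indicator (cdom c) p * f p) = indicator (cdom c) p * f p" for p
    by (simp split: split_indicator)
  have on_cimg: "indicator (cimg c) x *\<^sub>R (?v x * ?f (cinv c x)) =
      indicator (cimg c) x *\<^sub>R (?v x * f (cinv c x))" for x
    using c by (simp split: split_indicator)
  have density: "density vol (\<lambda>p. ennreal (indicator (cdom c) p)) = chart_measure M g c"
    by (simp only: ennreal_indicator density_vol_cdom[OF c])
  have "set_integrable vol (cdom c) f \<longleftrightarrow> integrable (chart_measure M g c) ?f"
    unfolding density[symmetric]
    by (subst integrable_density) (use f_vol in \<open>simp_all add: f_f set_integrable_def\<close>)
  then show "set_integrable vol (cdom c) f \<longleftrightarrow>
      set_integrable lborel (cimg c) (\<lambda>x. ?v x * f (cinv c x))"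
    by (simp only: integrable_chart_measure[OF c f_M] set_integrable_def on_cimg)
  have "(LINT p:cdom c|vol. f p) = (\<integral>p. ?f p \<partial>chart_measure M g c)"
    unfolding density[symmetric]
    by (subst integral_density) (use f_vol in \<open>simp_all add: f_f set_lebesgue_integral_def\<close>)
  then show "(LINT p:cdom c|vol. f p) = (LINT x:cimg c|lborel. ?v x * f (cinv c x))"
    by (simp only: integral_chart_measure[OF c f_M] set_lebesgue_integral_def on_cimg)
qed

lemma set_borel_measurable_vol_chart:
  fixes f :: "'m \<Rightarrow> real"
  assumes "c \<in> A" "continuous_on (cimg c) (\<lambda>x. f (cinv c x))"
  shows "set_borel_measurable vol (cdom c) f"
proof -
  have "continuous_on (cdom c) (\<lambda>p. f (cinv c (cmap c p)))"
    by (rule continuous_on_compose2[OF assms(2) continuous_on_cmap[OF assms(1)]]) auto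
  then have "continuous_on (cdom c) f"
    by (rule continuous_on_eq) (simp add: assms(1))
  then have "(\<lambda>p. indicator (cdom c) p *\<^sub>R f p) \<in> borel_measurable borel"
    using cdom_in_sets[OF assms(1)]
    by (intro borel_measurable_continuous_on_indicator) (simp add: sets_restrict_M)
  then show ?thesis
    unfolding set_borel_measurable_def measurable_vol_iff by (rule measurable_restrict_space1)
qed

lemma set_integral_vol_cdom_supported:
  assumes "supported_in_chart c f" "c \<in> A"
  shows "set_integrable vol (cdom c) f \<longleftrightarrow> integrable vol f"
    and "(LINT p:cdom c|vol. f p) = (\<integral>p. f p \<partial>vol)"
proof -
  have f: "indicator (cdom c) p *\<^sub>R f p = f p" if "p \<in> space vol" for p
    using supported_in_chart_outside[OF assms, of p] that
    by (cases "p \<in> cdom c") (auto simp: space_vol)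
  show "set_integrable vol (cdom c) f \<longleftrightarrow> integrable vol f"
    unfolding set_integrable_def by (rule Bochner_Integration.integrable_cong[OF refl f])
  show "(LINT p:cdom c|vol. f p) = (\<integral>p. f p \<partial>vol)"
    unfolding set_lebesgue_integral_def by (rule Bochner_Integration.integral_cong[OF refl f])
qed

lemma set_integrable_vol_supported:
  assumes c: "c \<in> A" and f: "supported_in_chart c f" "continuous_on (cimg c) (\<lambda>x. f (cinv c x))"
  shows "set_integrable vol (cdom c) f"
proof -
  obtain K where K: "compact K" "K \<subseteq> cimg c" "\<And>x. x \<in> cimg c - K \<Longrightarrow> f (cinv c x) = 0"
    by (rule supported_in_chartE[OF f(1) c]) blast
  have "set_integrable lborel (cimg c) (\<lambda>x. vol_density g c (cinv c x) * f (cinv c x))"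
    using K(3)
    by (intro set_integrable_compact_support[OF K(1,2)] continuous_on_mult f(2)
        C1_on_imp_continuous_on[OF C1_on_vol_density[OF c]]) auto
  then show ?thesis
    using set_integrable_vol_chart[OF c set_borel_measurable_vol_chart[OF c f(2)]] by simp
qed

lemma finite_measure_vol: "finite_measure vol"
proof -
  have "C1_fun (\<lambda>_. 1)"
    by (simp add: C1_fun_def C1_on_const)
  then have "integrable vol (\<lambda>_. 1 :: real)"
  proof (rule C1_fun_localize[where P = "integrable vol"])
    show "integrable vol v" if "c \<in> A" "C1_fun v" "supported_in_chart c v" for c v
      using set_integrable_vol_supported[of c v] set_integral_vol_cdom_supported(1)[of c v] that
      by (simp add: C1_fun_def C1_on_imp_continuous_on)
    show "integrable vol w" if "\<And>p. p \<in> M \<Longrightarrow> v p = w p" "integrable vol v" for v w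
      using that Bochner_Integration.integrable_cong[OF refl, of vol v w] by (simp add: space_vol)
  qed simp
  then show ?thesis
    by (intro finite_measureI) (simp add: integrable_iff_bounded less_top[symmetric])
qed

lemma integrable_vol_continuous_on:
  "continuous_on M f \<Longrightarrow> integrable vol (f :: 'm \<Rightarrow> real)"
  by (rule integrable_continuous_on_compact[OF finite_measure_vol sets_vol compact_M])

lemma volume_ratio_chart:
  assumes g': "riemannian_metric A g'" and c: "c \<in> A" "p \<in> cdom c"
  shows "volume_ratio A g g' p = vol_density g' c p / vol_density g c p"
proof -
  interpret g': riemannian_manifold M A g'
    using g' by unfold_locales
  let ?d = "chart_at A p"
  note d = chart_at_in[OF in_cdom_imp_in_M[OF c]]
  have "det (transition_jacobian c ?d p) \<noteq> 0"
    using invertible_transition_jacobian[OF c(1) d(1) c(2) d(2)] by (simp add: invertible_det_nz)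
  then show ?thesis
    by (simp add: volume_ratio_def Let_def vol_density_transform[OF c(1) d(1) c(2) d(2)]
        g'.vol_density_transform[OF c(1) d(1) c(2) d(2)])
qed

lemma continuous_on_Times_volume_ratio:
  fixes Z :: "'z::t2_space set"
  assumes g': "\<And>z. z \<in> Z \<Longrightarrow> riemannian_metric A (g' z)" "continuous_in_charts Z g'"
  shows "continuous_on (Z \<times> M) (\<lambda>(z, p). volume_ratio A g (g' z) p)"
proof (rule continuous_on_Times_M)
  fix c assume c: "c \<in> A"
  have vol_density: "continuous_on (Z \<times> cimg c) (\<lambda>w. vol_density (g' (fst w)) c (cinv c (snd w)))"
    using g'(2) c unfolding vol_density_def
    by (intro continuous_intros) (auto simp: continuous_in_charts_def case_prod_beta)
  have "continuous_on (Z \<times> cimg c)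
      (\<lambda>w. vol_density (g' (fst w)) c (cinv c (snd w)) / vol_density g c (cinv c (snd w)))"
    using vol_density_pos[OF c] c
    by (intro continuous_on_divide vol_density
        continuous_on_compose2[OF C1_on_imp_continuous_on[OF C1_on_vol_density[OF c]]
            continuous_on_snd])
       (auto simp: less_imp_neq[symmetric])
  then show "continuous_on (Z \<times> cimg c) (\<lambda>(z, x). volume_ratio A g (g' z) (cinv c x))"
    by (rule continuous_on_eq) (auto simp: volume_ratio_chart[OF g'(1) c] c)
qed

lemma continuous_on_volume_ratio:
  assumes "riemannian_metric A g'"
  shows "continuous_on M (volume_ratio A g g')"
proof -
  interpret g': riemannian_manifold M A g'
    using assms by unfold_locales
  have "continuous_on ({0::real} \<times> M) (\<lambda>(z, p). volume_ratio A g g' p)"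
    using assms g'.C1_on_metric
    by (intro continuous_on_Times_volume_ratio continuous_in_charts_const C1_on_imp_continuous_on)
  then show ?thesis
    by (rule continuous_on_Times_slice) simp
qed

lemma riemannian_volume_change_metric:
  assumes g': "riemannian_metric A g'"
  shows "riemannian_volume M A g' = density vol (\<lambda>p. ennreal (volume_ratio A g g' p))"
proof -
  interpret g': riemannian_manifold M A g'
    using g' by unfold_locales
  let ?\<theta> = "\<lambda>p. ennreal (volume_ratio A g g' p)"
  have \<theta> [measurable]: "?\<theta> \<in> borel_measurable (restrict_space borel M)"
    using borel_measurable_continuous_on_restrict[OF continuous_on_volume_ratio[OF g']]
    by measurable
  have ratio: "ennreal (vol_density g c (cinv c x)) * ?\<theta> (cinv c x) =
      ennreal (vol_density g' c (cinv c x))"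
    if "c \<in> A" "x \<in> cimg c" for c x
    using that vol_density_pos[of c "cinv c x"] g'.vol_density_pos[of c "cinv c x"]
    by (simp add: volume_ratio_chart[OF g'] ennreal_mult'[symmetric])
  have "emeasure (density vol ?\<theta>) E = emeasure (chart_measure M g' c) E"
    if c: "c \<in> A" and E [measurable]: "E \<in> sets (restrict_space borel M)" "E \<subseteq> cdom c" for c E
  proof -
    have "emeasure (density vol ?\<theta>) E = (\<integral>\<^sup>+p. ?\<theta> p * indicator E p \<partial>vol)"
      using \<theta> E(1) by (intro emeasure_density) (simp_all add: measurable_vol_iff sets_vol)
    also have "\<dots> = (\<integral>\<^sup>+p\<in>cdom c. ?\<theta> p * indicator E p \<partial>vol)"
      using E(2) by (intro nn_integral_cong) (auto split: split_indicator)
    also have "\<dots> = (\<integral>\<^sup>+x\<in>cimg c. ennreal (vol_density g c (cinv c x)) *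
        (?\<theta> (cinv c x) * indicator E (cinv c x)) \<partial>lborel)"
      by (rule nn_integral_vol_chart[OF c]) measurable
    also have "\<dots> = (\<integral>\<^sup>+x\<in>cimg c. ennreal (vol_density g' c (cinv c x)) *
        indicator E (cinv c x) \<partial>lborel)"
      using ratio[OF c]
      by (intro nn_integral_cong) (simp add: mult.assoc[symmetric] split: split_indicator)
    also have "\<dots> = emeasure (chart_measure M g' c) E"
      using E(1) by (subst g'.nn_integral_chart_measure[OF c, symmetric]) simp_all
    finally show ?thesis .
  qed
  then have "g'.is_volume (density vol ?\<theta>)"
    by (simp add: g'.is_volume_def sets_vol)
  then show ?thesis
    by (rule g'.is_volume_unique[OF g'.is_volume_vol])
qed

lemma integral_change_metric:
  assumes g': "riemannian_metric A g'" and f: "continuous_on M (f :: 'm \<Rightarrow> real)"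
  shows "(\<integral>p. f p \<partial>riemannian_volume M A g') = (\<integral>p. volume_ratio A g g' p * f p \<partial>vol)"
proof -
  interpret g': riemannian_manifold M A g'
    using g' by unfold_locales
  have "0 \<le> volume_ratio A g g' p" if "p \<in> M" for p
    using chart_at_in[OF that] vol_density_pos g'.vol_density_pos
    by (simp add: volume_ratio_def Let_def less_imp_le)
  then show ?thesis
    unfolding riemannian_volume_change_metric[OF g']
    using continuous_on_imp_measurable_vol[OF f]
      continuous_on_imp_measurable_vol[OF continuous_on_volume_ratio[OF g']]
    by (subst integral_density) (auto simp: space_vol)
qed

end

subsection \<open>Green's formula\<close>

definition chart_laplacian ::
    "('m, 'n::finite) tensor02 \<Rightarrow> ('m \<Rightarrow> real) \<Rightarrow> ('m, 'n) chart \<Rightarrow> 'm \<Rightarrow> real" where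
  "chart_laplacian g u c p =
     (\<Sum>i\<in>UNIV. partial c i (\<lambda>q. vol_density g c q * grad g u c q $ i) p) / vol_density g c p"

lemma laplacian_eq_chart_laplacian:
  "laplacian A g u p = chart_laplacian g u (chart_at A p) p"
  by (simp add: laplacian_def divergence_def chart_laplacian_def Let_def)

lemma (in manifold) supported_in_chart_overlap:
  assumes c: "c \<in> A" and d: "d \<in> A" and K: "compact K" "K \<subseteq> cmap c ` (cdom c \<inter> cdom d)"
    and supp: "\<And>p. p \<notin> cinv c ` K \<Longrightarrow> u p = 0"
  shows "supported_in_chart d u"
  unfolding supported_in_chart_def
proof (intro exI conjI ballI)
  have sub: "cinv c ` K \<subseteq> cdom d" and "K \<subseteq> cimg c"
    using K(2) c by auto
  show "compact (cmap d ` cinv c ` K)"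
    using sub by (intro compact_continuous_image compact_cinv_image c K \<open>K \<subseteq> cimg c\<close>
        continuous_on_subset[OF continuous_on_cmap[OF d]])
  show "cmap d ` cinv c ` K \<subseteq> cimg d"
    using sub by auto
  have "cinv d ` cmap d ` cinv c ` K = cinv c ` K"
    using sub d by (auto simp: image_image subset_iff)
  then show "u p = 0" if "p \<in> M - cinv d ` cmap d ` cinv c ` K" for p
    using supp that by simp
qed

context riemannian_manifold
begin

lemma continuous_on_tensor_grad_metric:
  assumes "C1_fun u" "C1_fun v"
  shows "continuous_on M (tensor_grad A g g u v)"
proof -
  have "continuous_on ({0::real} \<times> M) (\<lambda>(z, p). tensor_grad A g g u v p)"
    by (intro continuous_on_tensor_grad continuous_in_charts_const continuous_on_differential
        C1_on_imp_continuous_on[OF C1_on_metric] metric metric_symmetric assms)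
  then show ?thesis
    by (rule continuous_on_Times_slice) simp
qed

lemma C1_on_flux:
  assumes "smooth_fun A u" "c \<in> A"
  shows "C1_on (cimg c) (\<lambda>x. vol_density g c (cinv c x) * grad g u c (cinv c x) $ i)"
proof -
  have "C1_on (cimg c) (\<lambda>x. \<Sum>j\<in>UNIV. matrix_inv (g c (cinv c x)) $ i $ j *
      differential u c (cinv c x) $ j)"
    by (intro C1_on_sum C1_on_mult C1_on_differential assms
        C1_on_bounded_linear[OF bounded_linear_vec_nth] C1_on_metric_inv)
  then show ?thesis
    by (intro C1_on_mult C1_on_vol_density assms(2)) (simp add: grad_eq matrix_vector_mult_def)
qed

lemma vol_density_mult_chart_laplacian:
  assumes "c \<in> A" "x \<in> cimg c"
  shows "vol_density g c (cinv c x) * chart_laplacian g u c (cinv c x) =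
    (\<Sum>i\<in>UNIV. frechet_derivative (\<lambda>x. vol_density g c (cinv c x) * grad g u c (cinv c x) $ i)
        (at x) (axis i 1))"
  using vol_density_pos[OF assms(1) cinv_in_cdom[OF assms]] assms
  by (simp add: chart_laplacian_def partial_def o_def)

lemma continuous_on_chart_laplacian:
  assumes u: "smooth_fun A u" and c: "c \<in> A"
  shows "continuous_on (cimg c) (\<lambda>x. chart_laplacian g u c (cinv c x))"
proof (rule continuous_on_eq)
  show "continuous_on (cimg c) (\<lambda>x.
      (\<Sum>i\<in>UNIV. frechet_derivative (\<lambda>x. vol_density g c (cinv c x) * grad g u c (cinv c x) $ i)
          (at x) (axis i 1)) /
      vol_density g c (cinv c x))"
    using vol_density_pos[OF c] c
    by (intro continuous_on_divide continuous_on_sum C1_on_continuous_on_derivative C1_on_flux u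
        continuous_on_const C1_on_imp_continuous_on[OF C1_on_vol_density[OF c]])
       (auto simp: less_imp_neq[symmetric])
qed (simp add: chart_laplacian_def partial_def o_def c)

lemma integral_tensor_grad_supported:
  assumes c: "c \<in> A" and f: "C1_fun f" "supported_in_chart c f" and u: "C1_fun u"
  shows "(\<integral>p. tensor_grad A g g u f p \<partial>vol) =
    (LINT x:cimg c|lborel. \<Sum>i\<in>UNIV. frechet_derivative (\<lambda>x. f (cinv c x)) (at x) (axis i 1) *
      (vol_density g c (cinv c x) * grad g u c (cinv c x) $ i))"
proof -
  let ?T = "tensor_grad A g g u f"
  have cont: "continuous_on M ?T"
    using u f(1) by (rule continuous_on_tensor_grad_metric)
  have "?T p = 0" if "p \<in> M - cdom c" for p
    using that chart_at_in[of p] supported_in_chart_differential[OF f(2) c]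
    by (simp add: tensor_grad_metric)
  then have "(\<integral>p. ?T p \<partial>vol) = (LINT p:cdom c|vol. ?T p)"
    unfolding set_lebesgue_integral_def
    by (intro Bochner_Integration.integral_cong refl) (auto simp: space_vol split: split_indicator)
  also have "\<dots> = (LINT x:cimg c|lborel. vol_density g c (cinv c x) * ?T (cinv c x))"
    by (intro set_integral_vol_chart c set_borel_measurable_vol_chart
        continuous_on_compose2[OF cont continuous_on_cinv]) (use c in auto)
  also have "\<dots> = (LINT x:cimg c|lborel.
      \<Sum>i\<in>UNIV. frechet_derivative (\<lambda>x. f (cinv c x)) (at x) (axis i 1) *
      (vol_density g c (cinv c x) * grad g u c (cinv c x) $ i))"
    unfolding set_lebesgue_integral_def
  proof (intro Bochner_Integration.integral_cong refl)
    fix x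
    have "?T (cinv c x) = (\<Sum>i\<in>UNIV. grad g u c (cinv c x) $ i * differential f c (cinv c x) $ i)"
      if "x \<in> cimg c"
      using that c by (simp add: tensor_grad_metric_chart u f(1) inner_vec_def)
    then show "indicator (cimg c) x *\<^sub>R (vol_density g c (cinv c x) * ?T (cinv c x)) =
        indicator (cimg c) x *\<^sub>R (\<Sum>i\<in>UNIV. frechet_derivative (\<lambda>x. f (cinv c x)) (at x) (axis i 1) *
          (vol_density g c (cinv c x) * grad g u c (cinv c x) $ i))"
      using c by (simp add: differential_cinv_nth sum_distrib_left mult_ac split: split_indicator)
  qed
  finally show ?thesis .
qed

lemma green_chart:
  assumes c: "c \<in> A" and f: "C1_fun f" "supported_in_chart c f" and u: "smooth_fun A u"
  shows "set_integrable vol (cdom c) (\<lambda>p. f p * chart_laplacian g u c p)"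
    and "(LINT p:cdom c|vol. f p * chart_laplacian g u c p) = - (\<integral>p. tensor_grad A g g u f p \<partial>vol)"
proof -
  let ?f = "\<lambda>x. f (cinv c x)"
    and ?q = "\<lambda>i x. vol_density g c (cinv c x) * grad g u c (cinv c x) $ i"
  obtain K where K: "compact K" "K \<subseteq> cimg c" "\<And>x. x \<in> cimg c - K \<Longrightarrow> ?f x = 0"
    by (rule supported_in_chartE[OF f(2) c]) blast
  have f_C1: "C1_on (cimg c) ?f"
    using f(1) c by (simp add: C1_fun_def)
  then have cont: "continuous_on (cimg c) (\<lambda>x. ?f x * chart_laplacian g u c (cinv c x))"
    by (intro continuous_on_mult C1_on_imp_continuous_on continuous_on_chart_laplacian u c)
  show "set_integrable vol (cdom c) (\<lambda>p. f p * chart_laplacian g u c p)"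
    by (rule set_integrable_vol_supported[OF c supported_in_chart_mult[OF f(2)] cont])
  have "(LINT p:cdom c|vol. f p * chart_laplacian g u c p) =
      (LINT x:cimg c|lborel. vol_density g c (cinv c x) *
          (?f x * chart_laplacian g u c (cinv c x)))"
    by (rule set_integral_vol_chart[OF c set_borel_measurable_vol_chart[OF c cont]])
  also have "\<dots> = (LINT x:cimg c|lborel. ?f x *
      (\<Sum>i\<in>UNIV. frechet_derivative (?q i) (at x) (axis i 1)))"
    unfolding set_lebesgue_integral_def
  proof (intro Bochner_Integration.integral_cong refl)
    show "indicator (cimg c) x *\<^sub>R
          (vol_density g c (cinv c x) * (?f x * chart_laplacian g u c (cinv c x))) =
        indicator (cimg c) x *\<^sub>R
          (?f x * (\<Sum>i\<in>UNIV. frechet_derivative (?q i) (at x) (axis i 1)))" for x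
      using vol_density_mult_chart_laplacian[OF c, of x u]
      by (simp add: mult.left_commute split: split_indicator)
  qed
  also have "\<dots> = - (LINT x:cimg c|lborel.
      \<Sum>i\<in>UNIV. frechet_derivative ?f (at x) (axis i 1) * ?q i x)"
    by (rule integral_divergence_compact_support[OF open_cimg[OF c] K(1,2) f_C1
        C1_on_flux[OF u c] K(3)])
  also have "\<dots> = - (\<integral>p. tensor_grad A g g u f p \<partial>vol)"
    using integral_tensor_grad_supported[OF c f smooth_fun_imp_C1_fun[OF u]] by simp
  finally show "(LINT p:cdom c|vol. f p * chart_laplacian g u c p) =
      - (\<integral>p. tensor_grad A g g u f p \<partial>vol)" .
qed

lemma
  assumes c: "c \<in> A" and d: "d \<in> A" and u: "smooth_fun A u"
    and f: "C1_fun f" "supported_in_chart c f" "supported_in_chart d f"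
  shows set_integrable_chart_laplacian_diff:
      "set_integrable vol (cdom c) (\<lambda>p. f p * (chart_laplacian g u c p - chart_laplacian g u d p))"
    and set_integral_chart_laplacian_diff:
      "(LINT p:cdom c|vol. f p * (chart_laplacian g u c p - chart_laplacian g u d p)) = 0"
proof -
  let ?L = "\<lambda>c. chart_laplacian g u c"
  have cdom_eq: "indicator (cdom d) p *\<^sub>R (f p * ?L d p) = indicator (cdom c) p *\<^sub>R (f p * ?L d p)"
    if "p \<in> space vol" for p
    using supported_in_chart_outside[OF f(2) c, of p] supported_in_chart_outside[OF f(3) d, of p]
      that
    by (auto simp: space_vol split: split_indicator)
  have int_d: "set_integrable vol (cdom c) (\<lambda>p. f p * ?L d p)"
    using green_chart(1)[OF d f(1,3) u] unfolding set_integrable_def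
    by (rule iffD1[OF Bochner_Integration.integrable_cong[OF refl cdom_eq], rotated])
  show "set_integrable vol (cdom c) (\<lambda>p. f p * (?L c p - ?L d p))"
    using set_integral_diff(1)[OF green_chart(1)[OF c f(1,2) u] int_d] by (simp add: algebra_simps)
  have "(LINT p:cdom c|vol. f p * ?L d p) = (LINT p:cdom d|vol. f p * ?L d p)"
    unfolding set_lebesgue_integral_def
    by (rule Bochner_Integration.integral_cong[OF refl cdom_eq[symmetric]])
  then show "(LINT p:cdom c|vol. f p * (?L c p - ?L d p)) = 0"
    using green_chart[OF c f(1,2) u] green_chart(2)[OF d f(1,3) u] int_d
    by (simp add: right_diff_distrib)
qed

text \<open>The weak formulation determines the Laplacian: the difference of its two coordinate
  expressions is orthogonal to all bump functions.\<close>

lemma integral_bump_chart_laplacian_diff: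
  assumes c: "c \<in> A" and d: "d \<in> A" and u: "smooth_fun A u"
    and r: "0 < r" "cball a r \<subseteq> cmap c ` (cdom c \<inter> cdom d)"
  shows "(\<integral>x. bump a r x * (vol_density g c (cinv c x) *
    (chart_laplacian g u c (cinv c x) - chart_laplacian g u d (cinv c x))) \<partial>lborel) = 0"
proof -
  let ?b = "chart_bump c a r"
  let ?D = "\<lambda>p. chart_laplacian g u c p - chart_laplacian g u d p"
  have sub: "cball a r \<subseteq> cimg c"
    using r(2) by auto
  note b = C1_fun_chart_bump[OF c r(1) sub] supported_in_chart_bump[OF c r(1) sub]
  have b_d: "supported_in_chart d ?b"
    by (rule supported_in_chart_overlap[OF c d compact_cball r(2) chart_bump_eq_0[OF c r(1) sub]])
  have "set_borel_measurable vol (cdom c) (\<lambda>p. ?b p * ?D p)"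
    using set_integrable_chart_laplacian_diff[OF c d u b b_d]
    unfolding set_integrable_def set_borel_measurable_def by (rule borel_measurable_integrable)
  then have "(LINT x:cimg c|lborel. vol_density g c (cinv c x) *
      (?b (cinv c x) * ?D (cinv c x))) = 0"
    using set_integral_chart_laplacian_diff[OF c d u b b_d]
    by (simp only: set_integral_vol_chart[OF c])
  moreover have "indicator (cimg c) x *\<^sub>R
      (vol_density g c (cinv c x) * (?b (cinv c x) * ?D (cinv c x))) =
      bump a r x * (vol_density g c (cinv c x) * ?D (cinv c x))" for x
  proof (cases "x \<in> cimg c")
    case True
    then show ?thesis
      using c by (simp add: chart_bump_def from_chart_cinv)
  next
    case False
    then have "bump a r x = 0"
      using sub ball_subset_cball[of a r] by (intro bump_eq_0 r(1)) blast
    then show ?thesis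
      using False by simp
  qed
  ultimately show ?thesis
    by (simp only: set_lebesgue_integral_def)
qed

lemma chart_laplacian_eq:
  assumes u: "smooth_fun A u" and c: "c \<in> A" "p \<in> cdom c" and d: "d \<in> A" "p \<in> cdom d"
  shows "chart_laplacian g u c p = chart_laplacian g u d p"
proof -
  let ?U = "cmap c ` (cdom c \<inter> cdom d)"
  let ?D = "\<lambda>x. vol_density g c (cinv c x) *
    (chart_laplacian g u c (cinv c x) - chart_laplacian g u d (cinv c x))"
  have sub: "?U \<subseteq> cimg c" by auto
  have "continuous_on ?U (\<lambda>x. chart_laplacian g u d (cinv d ((cmap d \<circ> cinv c) x)))"
    by (rule continuous_on_compose2[OF continuous_on_chart_laplacian[OF u d(1)]
          C1_on_imp_continuous_on[OF C1_on_transition[OF c(1) d(1)]]]) (use c(1) in auto)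
  then have "continuous_on ?U (\<lambda>x. chart_laplacian g u d (cinv c x))"
    by (rule continuous_on_eq) (use c(1) d(1) in auto)
  then have "continuous_on ?U ?D"
    by (intro continuous_on_mult continuous_on_diff)
       (auto intro: continuous_on_subset[OF _ sub] continuous_on_chart_laplacian[OF u c(1)]
         C1_on_imp_continuous_on[OF C1_on_vol_density[OF c(1)]])
  then have "?D (cmap c p) = 0"
    by (rule eq_0_if_integral_bump_eq_0[where f = ?D, OF open_overlap[OF c(1) d(1)], rotated])
       (use c d integral_bump_chart_laplacian_diff[OF c(1) d(1) u] in auto)
  then show ?thesis
    using vol_density_pos[OF c] c by simp
qed

lemma laplacian_chart:
  "smooth_fun A u \<Longrightarrow> c \<in> A \<Longrightarrow> p \<in> cdom c \<Longrightarrow> laplacian A g u p = chart_laplacian g u c p"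
  unfolding laplacian_eq_chart_laplacian
  by (rule chart_laplacian_eq) (simp_all add: chart_at_in in_cdom_imp_in_M)

lemma continuous_on_laplacian:
  assumes "smooth_fun A u"
  shows "continuous_on M (laplacian A g u)"
proof (rule continuous_on_M)
  fix c assume c: "c \<in> A"
  show "continuous_on (cimg c) (\<lambda>x. laplacian A g u (cinv c x))"
    by (rule continuous_on_eq[OF continuous_on_chart_laplacian[OF assms c]])
       (simp add: laplacian_chart[OF assms c] c)
qed

lemma green_supported:
  assumes c: "c \<in> A" and f: "C1_fun f" "supported_in_chart c f" and u: "smooth_fun A u"
  shows "(\<integral>p. f p * laplacian A g u p \<partial>vol) = - (\<integral>p. tensor_grad A g g u f p \<partial>vol)"
proof -
  have "(\<integral>p. f p * laplacian A g u p \<partial>vol) = (LINT p:cdom c|vol. f p * laplacian A g u p)"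
    by (rule set_integral_vol_cdom_supported(2)[OF supported_in_chart_mult[OF f(2)] c, symmetric])
  also have "\<dots> = (LINT p:cdom c|vol. f p * chart_laplacian g u c p)"
    unfolding set_lebesgue_integral_def
    by (intro Bochner_Integration.integral_cong refl)
       (simp add: laplacian_chart[OF u c] split: split_indicator)
  also have "\<dots> = - (\<integral>p. tensor_grad A g g u f p \<partial>vol)"
    by (rule green_chart(2)[OF c f u])
  finally show ?thesis .
qed

lemma integral_tensor_grad_metric_sum:
  assumes u: "C1_fun u" and v: "\<And>s. s \<in> I \<Longrightarrow> C1_fun (v s)"
  shows "(\<integral>p. tensor_grad A g g u (\<lambda>p. \<Sum>s\<in>I. v s p) p \<partial>vol) =
    (\<Sum>s\<in>I. \<integral>p. tensor_grad A g g u (v s) p \<partial>vol)"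
proof -
  have "(\<integral>p. tensor_grad A g g u (\<lambda>p. \<Sum>s\<in>I. v s p) p \<partial>vol) =
      (\<integral>p. (\<Sum>s\<in>I. tensor_grad A g g u (v s) p) \<partial>vol)"
    by (intro Bochner_Integration.integral_cong refl) (simp add: space_vol tensor_grad_metric_sum v)
  also have "\<dots> = (\<Sum>s\<in>I. \<integral>p. tensor_grad A g g u (v s) p \<partial>vol)"
    by (intro Bochner_Integration.integral_sum integrable_vol_continuous_on
        continuous_on_tensor_grad_metric u v)
  finally show ?thesis .
qed

theorem green:
  assumes u: "smooth_fun A u" and "C1_fun \<psi>"
  shows "(\<integral>p. \<psi> p * laplacian A g u p \<partial>vol) = - (\<integral>p. tensor_grad A g g u \<psi> p \<partial>vol)"
  using assms(2)
proof (rule C1_fun_localize[where P = "\<lambda>f. (\<integral>p. f p * laplacian A g u p \<partial>vol) =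
      - (\<integral>p. tensor_grad A g g u f p \<partial>vol)"])
  show "(\<integral>p. f p * laplacian A g u p \<partial>vol) = - (\<integral>p. tensor_grad A g g u f p \<partial>vol)"
    if "c \<in> A" "C1_fun f" "supported_in_chart c f" for c f
    by (rule green_supported[OF that u])
next
  fix I :: "'m set" and v
  assume v: "\<And>s. s \<in> I \<Longrightarrow> C1_fun (v s)"
    and green: "\<And>s. s \<in> I \<Longrightarrow>
      (\<integral>p. v s p * laplacian A g u p \<partial>vol) = - (\<integral>p. tensor_grad A g g u (v s) p \<partial>vol)"
  have "(\<integral>p. (\<Sum>s\<in>I. v s p) * laplacian A g u p \<partial>vol) =
      (\<Sum>s\<in>I. \<integral>p. v s p * laplacian A g u p \<partial>vol)"
    unfolding sum_distrib_right
    by (intro Bochner_Integration.integral_sum integrable_vol_continuous_on continuous_on_mult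
        C1_fun_continuous_on v continuous_on_laplacian u)
  then show "(\<integral>p. (\<Sum>s\<in>I. v s p) * laplacian A g u p \<partial>vol) =
      - (\<integral>p. tensor_grad A g g u (\<lambda>p. \<Sum>s\<in>I. v s p) p \<partial>vol)"
    by (simp add: green sum_negf integral_tensor_grad_metric_sum[OF smooth_fun_imp_C1_fun[OF u] v])
next
  fix v w :: "'m \<Rightarrow> real"
  assume eq: "\<And>p. p \<in> M \<Longrightarrow> v p = w p"
    and green: "(\<integral>p. v p * laplacian A g u p \<partial>vol) = - (\<integral>p. tensor_grad A g g u v p \<partial>vol)"
  have "(\<integral>p. tensor_grad A g g u v p \<partial>vol) = (\<integral>p. tensor_grad A g g u w p \<partial>vol)"
    by (intro Bochner_Integration.integral_cong refl tensor_grad_metric_cong)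
       (simp_all add: space_vol eq)
  moreover have "(\<integral>p. v p * laplacian A g u p \<partial>vol) = (\<integral>p. w p * laplacian A g u p \<partial>vol)"
    by (intro Bochner_Integration.integral_cong refl) (simp add: space_vol eq)
  ultimately show "(\<integral>p. w p * laplacian A g u p \<partial>vol) = - (\<integral>p. tensor_grad A g g u w p \<partial>vol)"
    using green by simp
qed

corollary weak_eigenvalue_equation:
  assumes u: "laplace_eigenfunction M A g \<nu> u" and "C1_fun \<psi>"
  shows "(\<integral>p. tensor_grad A g g u \<psi> p \<partial>vol) = \<nu> * (\<integral>p. u p * \<psi> p \<partial>vol)"
proof -
  have eigen: "laplacian A g u p = - (\<nu> * u p)" if "p \<in> M" for p
  proof -
    have "- laplacian A g u p = \<nu> * u p"
      using u that by (simp add: laplace_eigenfunction_def)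
    then show ?thesis by linarith
  qed
  have "- (\<integral>p. tensor_grad A g g u \<psi> p \<partial>vol) = (\<integral>p. \<psi> p * laplacian A g u p \<partial>vol)"
    using u by (intro green[symmetric] assms(2)) (simp add: laplace_eigenfunction_def)
  also have "\<dots> = (\<integral>p. - \<nu> * (u p * \<psi> p) \<partial>vol)"
    by (intro Bochner_Integration.integral_cong refl) (simp add: eigen space_vol mult_ac)
  also have "\<dots> = - (\<nu> * (\<integral>p. u p * \<psi> p \<partial>vol))"
    by simp
  finally show ?thesis by simp
qed

end

subsection \<open>Evolution of the first eigenvalue\<close>

context manifold
begin

lemma smooth_tensor02_family_continuous_in_charts:
  "smooth_tensor02_family A I k \<Longrightarrow> continuous_in_charts I k"
  using smooth_on_imp_continuous_on unfolding smooth_tensor02_family_def continuous_in_charts_def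
  by blast

lemma smooth_fun_family_continuous_in_charts:
  "smooth_fun_family A I \<phi> \<Longrightarrow> continuous_in_charts I (\<lambda>t c. \<phi> t)"
  using smooth_on_imp_continuous_on unfolding smooth_fun_family_def continuous_in_charts_def
  by blast

lemma smooth_fun_family_continuous_in_charts_differential:
  assumes "smooth_fun_family A I \<phi>"
  shows "continuous_in_charts I (\<lambda>t. differential (\<phi> t))"
  unfolding continuous_in_charts_def
proof
  fix c assume c: "c \<in> A"
  have "continuous_on (I \<times> cimg c)
      (\<lambda>w. \<chi> i. frechet_derivative (\<lambda>x. \<phi> (fst w) (cinv c x)) (at (snd w)) (axis i 1))"
    using assms c smooth_on_Times_imp_continuous_on_frechet_derivative[OF open_cimg[OF c],
        of I "\<lambda>t x. \<phi> t (cinv c x)"]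
    by (intro continuous_on_vec_lambda)
       (simp add: smooth_fun_family_def case_prod_beta axis_in_Basis_iff)
  then show "continuous_on (I \<times> cimg c) (\<lambda>(t, x). differential (\<phi> t) c (cinv c x))"
    by (rule continuous_on_eq) (auto simp: vec_eq_iff differential_cinv_nth c)
qed

end

locale metric_flow = manifold M A
  for M :: "'m::t2_space set" and A :: "('m, 'n::finite) chart set" +
  fixes T :: real and g h :: "real \<Rightarrow> ('m, 'n) tensor02"
  assumes T_pos: "0 < T"
    and metric: "\<And>t. t \<in> {0..T} \<Longrightarrow> riemannian_metric A (g t)"
    and smooth_g: "smooth_tensor02_family A {0..T} g"
    and symmetric_h: "\<And>t. t \<in> {0..T} \<Longrightarrow> symmetric_tensor02 A (h t)"
    and smooth_h: "smooth_tensor02_family A {0..T} h"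
    and flow: "\<And>t c p i j. t \<in> {0..T} \<Longrightarrow> c \<in> A \<Longrightarrow> p \<in> cdom c \<Longrightarrow>
      ((\<lambda>s. g s c p $ i $ j) has_real_derivative - 2 * h t c p $ i $ j) (at t within {0..T})"
begin

lemma riemannian_manifold_g: "t \<in> {0..T} \<Longrightarrow> riemannian_manifold M A (g t)"
  using metric by unfold_locales

lemma metric_has_derivative:
  assumes "t \<in> {0..T}" "c \<in> A" "p \<in> cdom c"
  shows "((\<lambda>s. g s c p) has_derivative (\<lambda>r. r *\<^sub>R (- 2 *\<^sub>R h t c p))) (at t within {0..T})"
  unfolding has_vector_derivative_def[symmetric]
  by (rule has_vector_derivative_matrixI) (use flow[OF assms] in simp)

lemma DERIV_vol_density:
  assumes t: "t \<in> {0..T}" and c: "c \<in> A" "p \<in> cdom c"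
  shows "((\<lambda>s. vol_density (g s) c p) has_real_derivative
    - (metric_trace A (g t) (h t) p * vol_density (g t) c p)) (at t within {0..T})"
proof -
  interpret t: riemannian_manifold M A "g t"
    by (rule riemannian_manifold_g[OF t])
  let ?d = "det (g t c p)" and ?H = "metric_trace A (g t) (h t) p"
  interpret mult: bounded_bilinear "(**) :: real^'n^'n \<Rightarrow> real^'n^'n \<Rightarrow> real^'n^'n"
    by (rule bounded_bilinear_matrix_matrix_mult)
  have pos: "0 < ?d"
    by (rule positive_definite_imp_det_pos[OF t.metric_positive[OF c]])
  have "trace (matrix_inv (g t c p) ** (r *\<^sub>R (- 2 *\<^sub>R h t c p))) = - 2 * ?H * r" for r
    by (simp add: t.metric_trace_chart[OF symmetric_h[OF t] c] mult.scaleR_right mult.minus_right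
        linear_scale[OF bounded_linear.linear[OF bounded_linear_trace]]
        linear_neg[OF bounded_linear.linear[OF bounded_linear_trace]])
  then have "((\<lambda>s. det (g s c p)) has_real_derivative ?d * (- 2 * ?H)) (at t within {0..T})"
    unfolding has_field_derivative_def
    by (intro has_derivative_eq_rhs[OF
        has_derivative_det[OF metric_has_derivative[OF t c] t.invertible_metric[OF c]]])
       (simp only: fun_eq_iff mult.assoc simp_thms)
  from DERIV_chain2[OF DERIV_real_sqrt[OF pos] this]
  show ?thesis
    unfolding vol_density_def
    by (rule DERIV_cong) (use pos real_sqrt_mult_self[of ?d] in \<open>simp add: field_simps\<close>)
qed

lemma DERIV_volume_ratio:
  assumes "t \<in> {0..T}" "p \<in> M"
  shows "((\<lambda>s. volume_ratio A k (g s) p) has_real_derivative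
    - (metric_trace A (g t) (h t) p * volume_ratio A k (g t) p)) (at t within {0..T})"
  unfolding volume_ratio_def Let_def
  by (rule DERIV_cong[OF DERIV_cdivide[OF DERIV_vol_density[OF assms(1) chart_at_in[OF assms(2)]]]])
      simp

lemma DERIV_tensor_grad:
  assumes t: "t \<in> {0..T}" and p: "p \<in> M"
  shows "((\<lambda>s. tensor_grad A (g s) (g s) u v p) has_real_derivative
    2 * tensor_grad A (g t) (h t) u v p) (at t within {0..T})"
proof -
  let ?c = "chart_at A p"
  let ?B = "\<lambda>s. matrix_inv (g s ?c p)" and ?u = "differential u ?c p" and ?v = "differential v ?c p"
  let ?K = "?B t ** h t ?c p ** ?B t"
  interpret t: riemannian_manifold M A "g t"
    by (rule riemannian_manifold_g[OF t])
  interpret mult: bounded_bilinear "(**) :: real^'n^'n \<Rightarrow> real^'n^'n \<Rightarrow> real^'n^'n"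
    by (rule bounded_bilinear_matrix_matrix_mult)
  note c = chart_at_in[OF p]
  have "(?B has_derivative (\<lambda>r. - (?B t ** (r *\<^sub>R (- 2 *\<^sub>R h t ?c p)) ** ?B t)))
      (at t within {0..T})"
    by (rule has_derivative_matrix_inv[OF metric_has_derivative[OF t c] t.invertible_metric[OF c]
        t])
  then have "(?B has_derivative (\<lambda>r. r *\<^sub>R (2 *\<^sub>R ?K))) (at t within {0..T})"
    by (simp add: mult.scaleR_left mult.scaleR_right mult.minus_left mult.minus_right)
  then have "((\<lambda>s. (?B s *v ?u) \<bullet> ?v) has_derivative (\<lambda>r. ((r *\<^sub>R (2 *\<^sub>R ?K)) *v ?u) \<bullet> ?v))
      (at t within {0..T})"
    by (intro bounded_linear.has_derivative[OF bounded_linear_inner_left]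
        bounded_linear.has_derivative[OF
          bounded_bilinear.bounded_linear_left[OF bounded_bilinear_matrix_vector_mult]])
  moreover have "(?K *v ?u) \<bullet> ?v = tensor_grad A (g t) (h t) u v p"
    using t.tensor_grad_eq_differential[OF p, of "h t" v u]
      t.tensor_grad_commute[OF symmetric_h[OF t] p]
    by (simp add: inner_commute)
  then have "((r *\<^sub>R (2 *\<^sub>R ?K)) *v ?u) \<bullet> ?v = 2 * tensor_grad A (g t) (h t) u v p * r" for r
    by (simp add: scaleR_matrix_vector_assoc[symmetric])
  ultimately have "((\<lambda>s. (?B s *v ?u) \<bullet> ?v) has_real_derivative
      2 * tensor_grad A (g t) (h t) u v p) (at t within {0..T})"
    unfolding has_field_derivative_def by (simp only:)
  then show ?thesis
    by (rule has_field_derivative_transform_within[OF _ zero_less_one t])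
       (simp add: riemannian_manifold.tensor_grad_metric[OF riemannian_manifold_g p]
         riemannian_manifold.grad_eq[OF riemannian_manifold_g])
qed

lemma continuous_in_charts_g: "continuous_in_charts {0..T} g"
  by (rule smooth_tensor02_family_continuous_in_charts[OF smooth_g])

lemma continuous_in_charts_h: "continuous_in_charts {0..T} h"
  by (rule smooth_tensor02_family_continuous_in_charts[OF smooth_h])

end

locale eigenfunction_flow = metric_flow M A T g h
  for M :: "'m::t2_space set" and A :: "('m, 'n::finite) chart set" and T g h +
  fixes lam lam' :: "real \<Rightarrow> real" and \<phi> :: "real \<Rightarrow> 'm \<Rightarrow> real"
  assumes eigenfunction: "\<And>t. t \<in> {0..T} \<Longrightarrow> laplace_eigenfunction M A (g t) (lam t) (\<phi> t)"
    and smooth_\<phi>: "smooth_fun_family A {0..T} \<phi>"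
    and DERIV_lam: "\<And>t. t \<in> {0..T} \<Longrightarrow> (lam has_real_derivative lam' t) (at t within {0..T})"
    and continuous_on_lam': "continuous_on {0..T} lam'"
begin

lemma C1_fun_\<phi>: "t \<in> {0..T} \<Longrightarrow> C1_fun (\<phi> t)"
  using eigenfunction smooth_fun_imp_C1_fun by (simp add: laplace_eigenfunction_def)

definition rayleigh_defect :: "real \<Rightarrow> real \<Rightarrow> real \<Rightarrow> 'm \<Rightarrow> real" where
  "rayleigh_defect t s r p =
     tensor_grad A (g s) (g s) (\<phi> r) (\<phi> t) p - lam s * (\<phi> r p * \<phi> t p)"

definition rayleigh_defect' :: "real \<Rightarrow> real \<Rightarrow> real \<Rightarrow> 'm \<Rightarrow> real" where
  "rayleigh_defect' t s r p =
     2 * tensor_grad A (g s) (h s) (\<phi> r) (\<phi> t) p - lam' s * (\<phi> r p * \<phi> t p)"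

definition density_defect :: "real \<Rightarrow> real \<Rightarrow> real \<Rightarrow> 'm \<Rightarrow> real" where
  "density_defect t s r p = volume_ratio A (g t) (g s) p * rayleigh_defect t s r p"

definition density_defect' :: "real \<Rightarrow> real \<Rightarrow> real \<Rightarrow> 'm \<Rightarrow> real" where
  "density_defect' t s r p = volume_ratio A (g t) (g s) p *
     (rayleigh_defect' t s r p - metric_trace A (g s) (h s) p * rayleigh_defect t s r p)"

lemma DERIV_density_defect:
  assumes s: "s \<in> {0..T}" and p: "p \<in> M"
  shows "((\<lambda>s. density_defect t s r p) has_real_derivative density_defect' t s r p)
      (at s within {0..T})"
  unfolding density_defect_def density_defect'_def rayleigh_defect_def rayleigh_defect'_def
  by (rule DERIV_cong[OF DERIV_mult[OF DERIV_volume_ratio[OF s p]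
          DERIV_diff[OF DERIV_tensor_grad[OF s p] DERIV_cmult_right[OF DERIV_lam[OF s]]]]])
     (simp add: algebra_simps)

lemma continuous_on_tensor_grad_eigenfunctions:
  assumes t: "t \<in> {0..T}"
    and k: "\<And>s. s \<in> {0..T} \<Longrightarrow> symmetric_tensor02 A (k s)" "continuous_in_charts {0..T} k"
  shows "continuous_on (({0..T} \<times> {0..T}) \<times> M)
    (\<lambda>((s, r), p). tensor_grad A (g s) (k s) (\<phi> r) (\<phi> t) p)"
proof -
  let ?Z = "{0..T} \<times> {0..T}"
  have fst: "continuous_on ?Z fst" "fst ` ?Z \<subseteq> {0..T}"
    and snd: "continuous_on ?Z snd" "snd ` ?Z \<subseteq> {0..T}"
    by (auto intro!: continuous_intros)
  have "continuous_on (?Z \<times> M) (\<lambda>(z, p). tensor_grad A (g (fst z)) (k (fst z)) (\<phi> (snd z)) (\<phi> t) p)"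
  proof (rule continuous_on_tensor_grad)
    show "continuous_in_charts ?Z (\<lambda>z. g (fst z))"
      by (rule continuous_in_charts_reparametrize[OF continuous_in_charts_g fst])
    show "continuous_in_charts ?Z (\<lambda>z. k (fst z))"
      by (rule continuous_in_charts_reparametrize[OF k(2) fst])
    show "continuous_in_charts ?Z (\<lambda>z. differential (\<phi> (snd z)))"
      by (rule continuous_in_charts_reparametrize[OF
            smooth_fun_family_continuous_in_charts_differential[OF smooth_\<phi>] snd])
    show "continuous_in_charts ?Z (\<lambda>z. differential (\<phi> t))"
      by (rule continuous_in_charts_const[OF continuous_on_differential[OF C1_fun_\<phi>[OF t]]])
  qed (use metric C1_fun_\<phi> t k(1) in \<open>simp_all only: mem_Times_iff\<close>)
  then show ?thesis
    by (simp add: case_prod_beta)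
qed

lemma continuous_on_density_defects:
  assumes t: "t \<in> {0..T}"
  defines "Z \<equiv> {0..T} \<times> {0..T}"
  shows "continuous_on (Z \<times> M) (\<lambda>((s, r), p). density_defect t s r p)"
    and "continuous_on (Z \<times> M) (\<lambda>((s, r), p). density_defect' t s r p)"
proof -
  interpret t: riemannian_manifold M A "g t"
    by (rule riemannian_manifold_g[OF t])
  have fst: "continuous_on Z fst" "fst ` Z \<subseteq> {0..T}"
    and snd: "continuous_on Z snd" "snd ` Z \<subseteq> {0..T}"
    by (auto simp: Z_def intro!: continuous_intros)
  have time: "fst z \<in> {0..T}" if "z \<in> Z" for z
    using that by (auto simp: Z_def)
  note charts = continuous_in_charts_reparametrize[OF _ fst]
  note g = metric[OF time] charts[OF continuous_in_charts_g]
    and h = symmetric_h[OF time] charts[OF continuous_in_charts_h]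
  have "continuous_on (Z \<times> M) (\<lambda>((s, r), p). tensor_grad A (g s) (g s) (\<phi> r) (\<phi> t) p)"
    unfolding Z_def
    by (rule continuous_on_tensor_grad_eigenfunctions[OF t
          riemannian_manifold.metric_symmetric[OF riemannian_manifold_g] continuous_in_charts_g])
  moreover have "continuous_on (Z \<times> M) (\<lambda>((s, r), p). tensor_grad A (g s) (h s) (\<phi> r) (\<phi> t) p)"
    unfolding Z_def
    by (rule continuous_on_tensor_grad_eigenfunctions[OF t symmetric_h continuous_in_charts_h])
  moreover have "continuous_on (Z \<times> M) (\<lambda>(z, p). metric_trace A (g (fst z)) (h (fst z)) p)"
    by (rule continuous_on_metric_trace[OF g h])
  moreover have "continuous_on (Z \<times> M) (\<lambda>(z, p). volume_ratio A (g t) (g (fst z)) p)"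
    by (rule t.continuous_on_Times_volume_ratio[OF g])
  moreover have "continuous_on (Z \<times> M) (\<lambda>(z, p). \<phi> (snd z) p)"
    using continuous_in_charts_reparametrize[OF smooth_fun_family_continuous_in_charts[OF smooth_\<phi>]
        snd]
    by (intro continuous_on_Times_M) (simp add: continuous_in_charts_def)
  moreover have "continuous_on (Z \<times> M) (\<lambda>(z, p). \<phi> t p)"
    by (rule continuous_on_Times_snd[OF C1_fun_continuous_on[OF C1_fun_\<phi>[OF t]]])
  moreover have "continuous_on (Z \<times> M) (\<lambda>w. lam (fst (fst w)))"
    by (rule continuous_on_compose2[OF DERIV_continuous_on[OF DERIV_lam]])
       (use fst in \<open>auto intro!: continuous_intros\<close>)
  moreover have "continuous_on (Z \<times> M) (\<lambda>w. lam' (fst (fst w)))"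
    by (rule continuous_on_compose2[OF continuous_on_lam'])
       (use fst in \<open>auto intro!: continuous_intros\<close>)
  ultimately show "continuous_on (Z \<times> M) (\<lambda>((s, r), p). density_defect t s r p)"
    "continuous_on (Z \<times> M) (\<lambda>((s, r), p). density_defect' t s r p)"
    unfolding density_defect_def density_defect'_def rayleigh_defect_def rayleigh_defect'_def
        case_prod_beta
    by - (intro continuous_intros; assumption)+
qed

lemma integral_density_defect:
  assumes t: "t \<in> {0..T}" and s: "s \<in> {0..T}" and r: "r \<in> {0..T}"
  shows "(\<integral>p. density_defect t s r p \<partial>riemannian_volume M A (g t)) =
    (\<integral>p. tensor_grad A (g s) (g s) (\<phi> r) (\<phi> t) p \<partial>riemannian_volume M A (g s)) -
    lam s * (\<integral>p. \<phi> r p * \<phi> t p \<partial>riemannian_volume M A (g s))"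
proof -
  interpret t: riemannian_manifold M A "g t"
    by (rule riemannian_manifold_g[OF t])
  interpret s: riemannian_manifold M A "g s"
    by (rule riemannian_manifold_g[OF s])
  note cont = s.continuous_on_tensor_grad_metric[OF C1_fun_\<phi>[OF r] C1_fun_\<phi>[OF t]]
    C1_fun_continuous_on[OF C1_fun_mult[OF C1_fun_\<phi>[OF r] C1_fun_\<phi>[OF t]]]
  have "(\<integral>p. density_defect t s r p \<partial>t.vol) = (\<integral>p. rayleigh_defect t s r p \<partial>s.vol)"
    unfolding density_defect_def rayleigh_defect_def
    by (rule t.integral_change_metric[OF metric[OF s], symmetric]) (intro continuous_intros cont)
  also have "\<dots> = (\<integral>p. tensor_grad A (g s) (g s) (\<phi> r) (\<phi> t) p \<partial>s.vol) -
      lam s * (\<integral>p. \<phi> r p * \<phi> t p \<partial>s.vol)"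
    unfolding rayleigh_defect_def
    using s.integrable_vol_continuous_on[OF cont(1)]
      s.integrable_vol_continuous_on[OF cont(2)]
    by simp
  finally show ?thesis .
qed

lemma integral_density_defect_diagonal:
  assumes t: "t \<in> {0..T}" and s: "s \<in> {0..T}"
  shows "(\<integral>p. density_defect t s s p \<partial>riemannian_volume M A (g t)) = 0"
  using riemannian_manifold.weak_eigenvalue_equation[OF riemannian_manifold_g[OF s]
      eigenfunction[OF s] C1_fun_\<phi>[OF t]]
  by (simp add: integral_density_defect[OF t s s])

lemma integral_density_defect_frozen:
  assumes t: "t \<in> {0..T}" and s: "s \<in> {0..T}"
  shows "(\<integral>p. density_defect t t s p \<partial>riemannian_volume M A (g t)) = 0"
proof -
  interpret t: riemannian_manifold M A "g t"
    by (rule riemannian_manifold_g[OF t])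
  have "(\<integral>p. tensor_grad A (g t) (g t) (\<phi> s) (\<phi> t) p \<partial>t.vol) =
      (\<integral>p. tensor_grad A (g t) (g t) (\<phi> t) (\<phi> s) p \<partial>t.vol)"
    by (intro Bochner_Integration.integral_cong refl t.tensor_grad_commute t.metric_symmetric)
       (simp add: t.space_vol)
  also have "\<dots> = lam t * (\<integral>p. \<phi> t p * \<phi> s p \<partial>t.vol)"
    by (rule t.weak_eigenvalue_equation[OF eigenfunction[OF t] C1_fun_\<phi>[OF s]])
  finally show ?thesis
    by (simp add: integral_density_defect[OF t t s] mult.commute)
qed

lemma integral_density_defect'_eq_0:
  assumes t: "t \<in> {0..T}"
  shows "(\<integral>p. density_defect' t t t p \<partial>riemannian_volume M A (g t)) = 0"
proof -
  interpret t: riemannian_manifold M A "g t"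
    by (rule riemannian_manifold_g[OF t])
  have slice: "continuous_on M (density_defect t s r)" if "s \<in> {0..T}" "r \<in> {0..T}" for s r
    using continuous_on_Times_slice[of "{0..T} \<times> {0..T}" M "\<lambda>z. density_defect t (fst z) (snd z)"
        "(s, r)"]
      continuous_on_density_defects(1)[OF t] that by (simp add: case_prod_beta)
  have "((\<lambda>s. \<integral>p. density_defect t s s p - density_defect t t s p \<partial>t.vol) has_real_derivative
      (\<integral>p. density_defect' t t t p \<partial>t.vol)) (at t within {0..T})"
    by (rule DERIV_integral_diagonal_difference[OF t.finite_measure_vol t.sets_vol compact_M
          compact_Icc _ t DERIV_density_defect slice continuous_on_density_defects(2)[OF t]]) simp
  moreover have "(\<integral>p. density_defect t s s p - density_defect t t s p \<partial>t.vol) = 0"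
    if s: "s \<in> {0..T}" for s
    using t.integrable_vol_continuous_on[OF slice[OF s s]]
      t.integrable_vol_continuous_on[OF slice[OF t s]]
    by (simp add: integral_density_defect_diagonal[OF t s] integral_density_defect_frozen[OF t s])
  ultimately have "((\<lambda>s. 0) has_real_derivative (\<integral>p. density_defect' t t t p \<partial>t.vol))
      (at t within {0..T})"
    by (rule has_field_derivative_transform_within[OF _ zero_less_one t])
  then show ?thesis
    using vector_derivative_unique_within_closed_interval[of 0 T t "\<lambda>_. 0" _ 0] T_pos t
    by (simp add: has_real_derivative_iff_has_vector_derivative)
qed

theorem eigenvalue_evolution:
  assumes t: "t \<in> {0..T}"
  defines "\<mu> \<equiv> riemannian_volume M A (g t)"
  shows "lam' t * (LINT p|\<mu>. (\<phi> t p)\<^sup>2) =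
      lam t * (LINT p|\<mu>. metric_trace A (g t) (h t) p * (\<phi> t p)\<^sup>2)
      - (LINT p|\<mu>. metric_trace A (g t) (h t) p * (grad_norm A (g t) (\<phi> t) p)\<^sup>2)
      + 2 * (LINT p|\<mu>. tensor_pairing A (g t) (h t) (\<phi> t) p)"
proof -
  interpret t: riemannian_manifold M A "g t"
    by (rule riemannian_manifold_g[OF t])
  let ?H = "metric_trace A (g t) (h t)" and ?h = "tensor_pairing A (g t) (h t) (\<phi> t)"
  let ?G = "\<lambda>p. (grad_norm A (g t) (\<phi> t) p)\<^sup>2"
  have density_defect': "density_defect' t t t p =
      2 * ?h p - lam' t * (\<phi> t p)\<^sup>2 - (?H p * ?G p - lam t * (?H p * (\<phi> t p)\<^sup>2))" if "p \<in> M" for p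
    unfolding t.tensor_pairing_eq_tensor_grad[OF that] t.grad_norm_square[OF that]
      power2_eq_square[of "\<phi> t p"]
    using t.vol_density_pos[OF chart_at_in[OF that]]
    by (simp add: density_defect'_def rayleigh_defect'_def rayleigh_defect_def
        volume_ratio_def Let_def algebra_simps)
  have H: "continuous_on M ?H"
    by (rule continuous_on_Times_slice[OF
        continuous_on_metric_trace[OF metric continuous_in_charts_g
            symmetric_h continuous_in_charts_h] t])
  have "continuous_on M (tensor_grad A (g t) (h t) (\<phi> t) (\<phi> t))"
    using smooth_fun_family_continuous_in_charts_differential[OF smooth_\<phi>]
    by (intro continuous_on_Times_slice[OF continuous_on_tensor_grad _ , of "{0..T}" g h \<phi> \<phi>]
        metric continuous_in_charts_g symmetric_h continuous_in_charts_h C1_fun_\<phi> t)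
  then have h: "continuous_on M ?h"
    by (rule continuous_on_eq) (simp add: t.tensor_pairing_eq_tensor_grad)
  have G: "continuous_on M ?G"
    by (rule continuous_on_eq[OF
        t.continuous_on_tensor_grad_metric[OF C1_fun_\<phi>[OF t] C1_fun_\<phi>[OF t]]])
       (simp add: t.grad_norm_square)
  note \<phi> = C1_fun_continuous_on[OF C1_fun_\<phi>[OF t]]
  have "0 = (LINT p|\<mu>. 2 * ?h p - lam' t * (\<phi> t p)\<^sup>2 - (?H p * ?G p - lam t * (?H p * (\<phi> t p)\<^sup>2)))"
    unfolding \<mu>_def integral_density_defect'_eq_0[OF t, symmetric]
    by (intro Bochner_Integration.integral_cong refl) (simp add: t.space_vol density_defect')
  also have "\<dots> = 2 * (LINT p|\<mu>. ?h p) - lam' t * (LINT p|\<mu>. (\<phi> t p)\<^sup>2) -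
      ((LINT p|\<mu>. ?H p * ?G p) - lam t * (LINT p|\<mu>. ?H p * (\<phi> t p)\<^sup>2))"
    unfolding \<mu>_def
    by (subst Bochner_Integration.integral_diff Bochner_Integration.integral_mult_right_zero;
        (intro t.integrable_vol_continuous_on continuous_intros H h G \<phi>)?)+ simp
  finally show ?thesis by linarith
qed

end

theorem theorem2p6:
  fixes M :: "'m::t2_space set"
    and A :: "('m, 'n::finite) chart set"
    and g h :: "real \<Rightarrow> ('m, 'n) tensor02"
    and T :: real
    and lam :: "real \<Rightarrow> real"
    and \<phi> :: "real \<Rightarrow> 'm \<Rightarrow> real"
  assumes "closed_manifold M A"
    and "CARD('n) > 1"
    and "T > 0"
    and "\<And>t. t \<in> {0..T} \<Longrightarrow> riemannian_metric A (g t)"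
    and "smooth_tensor02_family A {0..T} g"
    and "\<And>t. t \<in> {0..T} \<Longrightarrow> symmetric_tensor02 A (h t)"
    and "smooth_tensor02_family A {0..T} h"
    and "\<And>t c p i j. t \<in> {0..T} \<Longrightarrow> c \<in> A \<Longrightarrow> p \<in> cdom c \<Longrightarrow>
           ((\<lambda>s. g s c p $ i $ j) has_real_derivative - 2 * h t c p $ i $ j) (at t within {0..T})"
    and "\<And>t. t \<in> {0..T} \<Longrightarrow> first_nonzero_eigenvalue M A (g t) (lam t)"
    and "\<And>t. t \<in> {0..T} \<Longrightarrow> laplace_eigenfunction M A (g t) (lam t) (\<phi> t)"
    and "smooth_on {0..T} lam"
    and "smooth_fun_family A {0..T} \<phi>"
  shows "\<forall>t\<in>{0..T}. \<exists>lam'. (lam has_real_derivative lam') (at t within {0..T}) \<and>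
    lam' * (LINT p|riemannian_volume M A (g t). (\<phi> t p)\<^sup>2) =
      lam t * (LINT p|riemannian_volume M A (g t). metric_trace A (g t) (h t) p * (\<phi> t p)\<^sup>2)
      - (LINT p|riemannian_volume M A (g t).
           metric_trace A (g t) (h t) p * (grad_norm A (g t) (\<phi> t) p)\<^sup>2)
      + 2 * (LINT p|riemannian_volume M A (g t). tensor_pairing A (g t) (h t) (\<phi> t) p)"
proof -
  obtain lam' where "continuous_on {0..T} lam'"
    and "\<And>t. t \<in> {0..T} \<Longrightarrow> (lam has_real_derivative lam' t) (at t within {0..T})"
    using smooth_on_Icc_imp_C1[OF \<open>smooth_on {0..T} lam\<close> \<open>T > 0\<close>] by blast
  then interpret eigenfunction_flow M A T g h lam lam' \<phi>
    using assms by unfold_locales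
  show ?thesis
    using DERIV_lam eigenvalue_evolution by blast
qed

end
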